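(* Let $1\le m_j<n_j$ be integer sequences such that $m_j\to\infty$ and $n_j/m_j\to\lambda$ for some real $\lambda>1$. Then $$\liminf_{j\to\infty}\frac12d_{\mathrm I}^{\chi}(\mathbb S^{m_j},\mathbb S^{n_j})\ge\Phi_\chi(\lambda),\qquad\liminf_{j\to\infty}d_{\mathrm{GH}}(\mathbb S^{m_j},\mathbb S^{n_j})\ge\Phi_\chi(\lambda).$$ Moreover, $\tfrac12c_{m_j,n_j}\to\tfrac\pi4$, and hence $$\liminf_{j\to\infty}\left(d_{\mathrm{GH}}(\mathbb S^{m_j},\mathbb S^{n_j})-\frac12c_{m_j,n_j}\right)\ge\Phi_\chi(\lambda)-\frac\pi4.$$
   Context: For $m\ge1$, $\mathbb S^m\subset\mathbb R^{m+1}$ is the unit round sphere with geodesic metric $\arccos\langle x,x'\rangle$; $\mathbb S^0$ is two points at distance $\pi$. $d_{\mathrm{GH}}$ is the Gromov--Hausdorff distance between compact metric spaces (half the infimum of distortions of correspondences). For a nonempty metric space $X$ and $s>0$, $\mathrm{Bor}_{\ge s}(X)$ is the simple graph with vertex set $X$ in which distinct points are adjacent exactly when their distance is at least $s$, and $\chi_X(s):=\chi(\mathrm{Bor}_{\ge s}(X))$ is its chromatic number (finite for totally bounded $X$). $d_{\mathrm I}^{\chi}(X,Y)$ is the infimum of the $\delta\ge0$ such that, for every $u>\delta$, $\chi_X(u)\le\chi_Y(u-\delta)$ and $\chi_Y(u)\le\chi_X(u-\delta)$. The group $C_2$ of order two acts antipodally on each sphere; a map between $C_2$-spaces is odd if it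 is $C_2$-equivariant. The coindex of a $C_2$-space $X$ is $\mathrm{coind}(X):=\sup\{k\ge0:\text{there is a continuous odd map }\mathbb S^k\to X\}$. $\mathrm{VR}(X;r)$ is the geometric realization of the simplicial complex with vertex set $X$ whose simplices are the nonempty finite subsets of diameter at most $r$; $\mathrm{VR}(\mathbb S^m;r)$ carries the $C_2$-action induced by the antipodal map. For integers $0\le m\le n$, $c_{m,n}:=\inf\{r\ge0:\mathrm{coind}(\mathrm{VR}(\mathbb S^m;r))\ge n\}$. For $\lambda>1$, $\Phi_\chi(\lambda):=\max_{0<x<\pi/2}\left[x-\arcsin\bigl((\sin x)^\lambda\bigr)\right]$. *)

theory Defs
  imports "HOL-Analysis.Analysis" "HOL-Library.Extended_Nat"
begin

text \<open>A metric space is given, as in the locale \<^locale>\<open>Metric_space\<close>, by a carrier set and a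
  distance function. Infima and suprema that may range over the empty set or be infinite are taken
  in \<^typ>\<open>ereal\<close> or \<^typ>\<open>enat\<close>, so that no value is an artefact of totality.\<close>

section \<open>Round spheres\<close>

text \<open>Points of the \<open>m\<close>-sphere are those of the library's \<^const>\<open>nsphere\<close>: functions on \<open>nat\<close> that
  vanish above \<open>m\<close> and whose coordinates \<open>0, \<dots>, m\<close> have square sum \<open>1\<close>. For \<open>m = 0\<close> the distance
  below is \<open>arccos (- 1) = pi\<close> between the two points.\<close>

abbreviation sphere_set :: "nat \<Rightarrow> (nat \<Rightarrow> real) set" where
  "sphere_set m \<equiv> topspace (nsphere m)"

definition geodesic_dist :: "nat \<Rightarrow> (nat \<Rightarrow> real) \<Rightarrow> (nat \<Rightarrow> real) \<Rightarrow> real" where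
  "geodesic_dist m x y = arccos (\<Sum>i\<le>m. x i * y i)"

definition antipode :: "(nat \<Rightarrow> real) \<Rightarrow> (nat \<Rightarrow> real)" where
  "antipode x = (\<lambda>i. - x i)"


section \<open>Gromov--Hausdorff distance\<close>

definition correspondence :: "'a set \<Rightarrow> 'b set \<Rightarrow> ('a \<times> 'b) set \<Rightarrow> bool" where
  "correspondence M N R \<longleftrightarrow> R \<subseteq> M \<times> N \<and> fst ` R = M \<and> snd ` R = N"

definition distortion ::
  "('a \<Rightarrow> 'a \<Rightarrow> real) \<Rightarrow> ('b \<Rightarrow> 'b \<Rightarrow> real) \<Rightarrow> ('a \<times> 'b) set \<Rightarrow> ereal" where
  "distortion d e R = (SUP ((x, y), (x', y')) \<in> R \<times> R. ereal \<bar>d x x' - e y y'\<bar>)"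

definition GH_dist ::
  "'a set \<Rightarrow> ('a \<Rightarrow> 'a \<Rightarrow> real) \<Rightarrow> 'b set \<Rightarrow> ('b \<Rightarrow> 'b \<Rightarrow> real) \<Rightarrow> ereal" where
  "GH_dist M d N e = (INF R \<in> {R. correspondence M N R}. distortion d e R) / 2"


section \<open>Chromatic numbers of Borsuk graphs\<close>

text \<open>The chromatic number is \<open>\<infinity>\<close> if there is no proper colouring with finitely many colours.\<close>

definition chromatic_number :: "'a set \<Rightarrow> ('a \<Rightarrow> 'a \<Rightarrow> bool) \<Rightarrow> enat" where
  "chromatic_number V E =
    (INF k \<in> {k. \<exists>c :: 'a \<Rightarrow> nat.
        (\<forall>v\<in>V. c v < k) \<and> (\<forall>v\<in>V. \<forall>w\<in>V. E v w \<longrightarrow> c v \<noteq> c w)}. enat k)"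

definition Bor_adj :: "('a \<Rightarrow> 'a \<Rightarrow> real) \<Rightarrow> real \<Rightarrow> 'a \<Rightarrow> 'a \<Rightarrow> bool" where
  "Bor_adj d s x y \<longleftrightarrow> x \<noteq> y \<and> s \<le> d x y"

definition chi :: "'a set \<Rightarrow> ('a \<Rightarrow> 'a \<Rightarrow> real) \<Rightarrow> real \<Rightarrow> enat" where
  "chi M d s = chromatic_number M (Bor_adj d s)"

definition chi_interleaving_dist ::
  "'a set \<Rightarrow> ('a \<Rightarrow> 'a \<Rightarrow> real) \<Rightarrow> 'b set \<Rightarrow> ('b \<Rightarrow> 'b \<Rightarrow> real) \<Rightarrow> ereal" where
  "chi_interleaving_dist M d N e =
    (INF \<delta> \<in> {\<delta>. 0 \<le> \<delta> \<and>
        (\<forall>u>\<delta>. chi M d u \<le> chi N e (u - \<delta>) \<and> chi N e u \<le> chi M d (u - \<delta>))}. ereal \<delta>)"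


section \<open>Coindex\<close>

text \<open>A \<open>C\<^sub>2\<close>-space is a topology together with an involution \<open>a\<close>, the action of the generator.\<close>

definition coind :: "'a topology \<Rightarrow> ('a \<Rightarrow> 'a) \<Rightarrow> enat" where
  "coind X a =
    (SUP k \<in> {k. \<exists>f. continuous_map (nsphere k) X f \<and>
        (\<forall>x\<in>sphere_set k. f (antipode x) = a (f x))}. enat k)"


section \<open>Vietoris--Rips complexes and their geometric realization\<close>

definition VR_complex :: "'a set \<Rightarrow> ('a \<Rightarrow> 'a \<Rightarrow> real) \<Rightarrow> real \<Rightarrow> 'a set set" where
  "VR_complex M d r = {\<sigma>. \<sigma> \<noteq> {} \<and> finite \<sigma> \<and> \<sigma> \<subseteq> M \<and> (\<forall>x\<in>\<sigma>. \<forall>y\<in>\<sigma>. d x y \<le> r)}"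

text \<open>Points of the realization of an abstract simplicial complex \<open>K\<close> (a family of finite sets)
  are given by their barycentric coordinates. The topology is the weak one: a set is open iff its
  trace on every closed simplex is open in the Euclidean topology of that simplex, which is the
  one induced by the product topology on coordinates.\<close>

definition realization_points :: "'a set set \<Rightarrow> ('a \<Rightarrow> real) set" where
  "realization_points K = {t. (\<forall>v. 0 \<le> t v) \<and> {v. t v \<noteq> 0} \<in> K \<and> (\<Sum>v | t v \<noteq> 0. t v) = 1}"

definition closed_simplex :: "'a set set \<Rightarrow> 'a set \<Rightarrow> ('a \<Rightarrow> real) set" where
  "closed_simplex K \<sigma> = {t \<in> realization_points K. {v. t v \<noteq> 0} \<subseteq> \<sigma>}"

definition realization :: "'a set set \<Rightarrow> ('a \<Rightarrow> real) topology" where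
  "realization K = topology (\<lambda>U. U \<subseteq> realization_points K \<and>
    (\<forall>\<sigma>\<in>K. openin (subtopology (powertop_real UNIV) (closed_simplex K \<sigma>)) (U \<inter> closed_simplex K \<sigma>)))"

lemma openin_realization:
  "openin (realization K) U \<longleftrightarrow> U \<subseteq> realization_points K \<and>
    (\<forall>\<sigma>\<in>K. openin (subtopology (powertop_real UNIV) (closed_simplex K \<sigma>)) (U \<inter> closed_simplex K \<sigma>))"
proof -
  let ?T = "\<lambda>\<sigma>. subtopology (powertop_real UNIV) (closed_simplex K \<sigma>)"
  let ?P = "\<lambda>U. U \<subseteq> realization_points K \<and> (\<forall>\<sigma>\<in>K. openin (?T \<sigma>) (U \<inter> closed_simplex K \<sigma>))"
  have "istopology ?P"
    unfolding istopology_def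
  proof (intro conjI allI impI ballI)
    fix S T \<sigma>
    assume "?P S" "?P T" "\<sigma> \<in> K"
    then have "openin (?T \<sigma>) ((S \<inter> closed_simplex K \<sigma>) \<inter> (T \<inter> closed_simplex K \<sigma>))"
      using openin_Int by blast
    moreover have "(S \<inter> closed_simplex K \<sigma>) \<inter> (T \<inter> closed_simplex K \<sigma>) = S \<inter> T \<inter> closed_simplex K \<sigma>"
      by auto
    ultimately show "openin (?T \<sigma>) (S \<inter> T \<inter> closed_simplex K \<sigma>)" by simp
  next
    fix \<U> \<sigma>
    assume "\<forall>U\<in>\<U>. ?P U" "\<sigma> \<in> K"
    then have "openin (?T \<sigma>) (\<Union>U\<in>\<U>. U \<inter> closed_simplex K \<sigma>)"
      by (intro openin_Union) auto
    then show "openin (?T \<sigma>) (\<Union>\<U> \<inter> closed_simplex K \<sigma>)"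
      by (simp add: Int_commute Int_Union)
  qed auto
  then show ?thesis
    by (simp add: realization_def topology_inverse')
qed

lemma topspace_realization: "topspace (realization K) = realization_points K"
proof -
  have "openin (subtopology (powertop_real UNIV) (closed_simplex K \<sigma>))
      (realization_points K \<inter> closed_simplex K \<sigma>)" for \<sigma>
  proof -
    have "realization_points K \<inter> closed_simplex K \<sigma>
        = topspace (subtopology (powertop_real UNIV) (closed_simplex K \<sigma>))"
      by (auto simp: closed_simplex_def)
    then show ?thesis by (metis openin_topspace)
  qed
  then have "openin (realization K) (realization_points K)"
    by (simp add: openin_realization)
  then show ?thesis
    by (metis openin_realization openin_subset openin_topspace subset_antisym)
qed

definition VR_sphere :: "nat \<Rightarrow> real \<Rightarrow> ((nat \<Rightarrow> real) \<Rightarrow> real) topology" where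
  "VR_sphere m r = realization (VR_complex (sphere_set m) (geodesic_dist m) r)"

text \<open>The action on realizations pushes barycentric coordinates forward along the antipodal map;
  as the latter is its own inverse, this is precomposition.\<close>

definition VR_antipode :: "((nat \<Rightarrow> real) \<Rightarrow> real) \<Rightarrow> ((nat \<Rightarrow> real) \<Rightarrow> real)" where
  "VR_antipode t = (\<lambda>x. t (antipode x))"

definition c_VR :: "nat \<Rightarrow> nat \<Rightarrow> ereal" where
  "c_VR m n = (INF r \<in> {r. 0 \<le> r \<and> enat n \<le> coind (VR_sphere m r) VR_antipode}. ereal r)"


section \<open>The limiting constant\<close>

text \<open>For \<open>L > 1\<close> the maximum exists: the function extends continuously by \<open>0\<close> to the end points
  of the interval and is positive inside.\<close>

definition Phi_chi :: "real \<Rightarrow> real" where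
  "Phi_chi L = (GREATEST v. v \<in> (\<lambda>x. x - arcsin (sin x powr L)) ` {0<..<pi / 2})"


section \<open>Distances between round spheres\<close>

definition GH_sphere :: "nat \<Rightarrow> nat \<Rightarrow> ereal" where
  "GH_sphere m n = GH_dist (sphere_set m) (geodesic_dist m) (sphere_set n) (geodesic_dist n)"

definition dI_chi_sphere :: "nat \<Rightarrow> nat \<Rightarrow> ereal" where
  "dI_chi_sphere m n =
    chi_interleaving_dist (sphere_set m) (geodesic_dist m) (sphere_set n) (geodesic_dist n)"

end

theory Submission
  imports Defs "HOL-Library.Z2"
begin

text \<open>The function \<open>x - arcsin ((sin x)^L)\<close> arises because \<open>\<chi>(S^m, 2x)\<close> grows like \<open>(1 / sin x)^m\<close> up to
  subexponential factors. A colour class has diameter at most \<open>2x\<close>, so thickening it radially and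
  applying the isodiametric inequality gives the lower bound; averaging over the choice of centres
  gives a covering by caps of angular radius \<open>x\<close>, hence the upper bound. An interleaving with
  parameter \<open>\<delta>\<close> then forces \<open>(sin x)^L \<ge> sin (x - \<delta>/2)\<close> in the limit, and a correspondence of
  distortion \<open>\<delta>\<close> induces such an interleaving.

  For \<open>r < \<pi>/2\<close> the weighted sum of the vertices never vanishes on a simplex, so that normalising it
  is an odd map from the Vietoris--Rips complex to \<open>S\<^sup>m\<close> and Borsuk--Ulam bounds the coindex by \<open>m\<close>.
  For \<open>r > \<pi>/2\<close> the exponential lower bound for \<open>\<chi>\<close> produces \<open>n + 1\<close> almost orthogonal vectors once
  \<open>m\<close> is large; with their antipodes they span the boundary of a cross-polytope, an odd \<open>n\<close>-sphere.\<close>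

section \<open>The Prekopa--Leindler and isodiametric inequalities\<close>

text \<open>Both bounds on \<open>chi\<close> need the same exponential rate, and the cheap
  arguments miss it: covering by a maximal separated set and comparing volumes can lose a factor
  exponential in the dimension, and Borsuk--Ulam bounds \<open>chi\<close> below only linearly.
  Hence the isodiametric inequality on one side and, on the other, an averaging in which the number
  of points to be covered enters only through its logarithm. All volumes are Euclidean. Covering
  centres are taken inside the unit ball: a ball of radius sin x about a point at distance cos x
  from the origin cuts a cap of angular radius x from the sphere, and no two points of that cap are
  farther apart than 2 sin x. Prekopa--Leindler is used because, unlike the inequality for sets, it
  passes to products one coordinate at a time. At most m + 1 vectors in dimension m + 1 are
  orthonormal, fewer than the n + 1 required; almost orthogonality admits exponentially many.
  Borsuk--Ulam comes from Fan's count of alternating simplices, done with cochains mod 2 so that no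
  orientations occur.\<close>

lemma emeasure_lborel_translate:
  fixes A :: "real set"
  assumes [measurable]: "A \<in> sets borel"
  shows "emeasure lborel {x. x + t \<in> A} = emeasure lborel A"
proof -
  have "emeasure lborel A = (\<integral>\<^sup>+x. indicator A x \<partial>lborel)" by simp
  also have "\<dots> = ennreal \<bar>1\<bar> * (\<integral>\<^sup>+x. indicator A (t + 1 * x) \<partial>lborel)"
    using nn_integral_real_affine[of "indicator A" 1 t] by simp
  also have "\<dots> = (\<integral>\<^sup>+x. indicator A (t + x) \<partial>lborel)" by simp
  also have "\<dots> = (\<integral>\<^sup>+x. indicator {x. x + t \<in> A} x \<partial>lborel)"
    by (intro nn_integral_cong) (auto simp: indicator_def add.commute)
  also have "\<dots> = emeasure lborel {x. x + t \<in> A}" by simp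
  finally show ?thesis ..
qed

lemma emeasure_lborel_half:
  fixes A :: "real set"
  assumes [measurable]: "A \<in> sets borel"
  shows "emeasure lborel {x. x / 2 \<in> A} = 2 * emeasure lborel A"
proof -
  have "(\<integral>\<^sup>+x. indicator {x. x / 2 \<in> A} x \<partial>lborel) = ennreal \<bar>2\<bar> * (\<integral>\<^sup>+x. indicator {x. x / 2 \<in> A} (0 + 2 * x) \<partial>lborel)"
    by (intro nn_integral_real_affine) auto
  also have "(\<integral>\<^sup>+x. indicator {x. x / 2 \<in> A} (0 + 2 * x) \<partial>lborel) = (\<integral>\<^sup>+x. indicator A x \<partial>lborel)"
    by (intro nn_integral_cong) (auto simp: indicator_def)
  finally show ?thesis by simp
qed

text \<open>The translates A + b0 and a0 + B, with a0 near the supremum of A and b0 near the infimum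
  of B, both lie in 2C and overlap only in an interval of length below e.\<close>

lemma brunn_minkowski_real:
  fixes A B C :: "real set"
  assumes [measurable]: "A \<in> sets borel" "B \<in> sets borel" "C \<in> sets borel"
    and ne: "A \<noteq> {}" "B \<noteq> {}" and bdd: "bounded A" "bounded B"
    and AB: "\<And>a b. a \<in> A \<Longrightarrow> b \<in> B \<Longrightarrow> (a + b) / 2 \<in> C"
  shows "emeasure lborel A + emeasure lborel B \<le> 2 * emeasure lborel C"
proof (rule ennreal_le_epsilon)
  fix e :: real assume "e > 0"
  have bA: "bdd_above A" and bB: "bdd_below B"
    using bdd bounded_imp_bdd_above bounded_imp_bdd_below by auto
  obtain a0 where a0: "a0 \<in> A" "Sup A - e / 2 < a0"
    using less_cSupE[of "Sup A - e/2" A] ne \<open>e > 0\<close> by auto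
  obtain b0 where b0: "b0 \<in> B" "b0 < Inf B + e / 2"
    using cInf_lessD[of B "Inf B + e/2"] ne \<open>e > 0\<close> by auto
  define U where "U = {x. x + (- b0) \<in> A}"
  define V where "V = {x. x + (- a0) \<in> B}"
  have [measurable]: "U \<in> sets borel" "V \<in> sets borel" unfolding U_def V_def by measurable
  have "U \<inter> V \<subseteq> {a0 + Inf B .. Sup A + b0}"
  proof
    fix x assume "x \<in> U \<inter> V"
    then have "x - b0 \<le> Sup A" "Inf B \<le> x - a0"
      using cSup_upper[OF _ bA, of "x - b0"] cInf_lower[OF _ bB, of "x - a0"] by (auto simp: U_def V_def)
    then show "x \<in> {a0 + Inf B .. Sup A + b0}" by auto
  qed
  then have "emeasure lborel (U \<inter> V) \<le> emeasure lborel {a0 + Inf B .. Sup A + b0}"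
    by (intro emeasure_mono) auto
  also have "\<dots> \<le> ennreal e"
    using a0 b0 by (auto simp: emeasure_lborel_Icc_eq intro!: ennreal_leI)
  finally have int: "emeasure lborel (U \<inter> V) \<le> ennreal e" .
  have "U \<union> V \<subseteq> {x. x / 2 \<in> C}"
  proof
    fix x assume "x \<in> U \<union> V"
    then consider "x - b0 \<in> A" | "x - a0 \<in> B" by (auto simp: U_def V_def)
    then show "x \<in> {x. x / 2 \<in> C}"
    proof cases
      case 1 show ?thesis using AB[OF 1 b0(1)] by simp
    next
      case 2 show ?thesis using AB[OF a0(1) 2] by simp
    qed
  qed
  then have un: "emeasure lborel (U \<union> V) \<le> 2 * emeasure lborel C"
    unfolding emeasure_lborel_half[OF assms(3), symmetric] by (intro emeasure_mono) auto
  have "emeasure lborel A + emeasure lborel B = emeasure lborel U + emeasure lborel V"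
    unfolding U_def V_def by (simp only: emeasure_lborel_translate assms)
  also have "\<dots> = emeasure lborel (U \<union> V) + emeasure lborel (U \<inter> V)"
    by (rule emeasure_Un_Int) auto
  also have "\<dots> \<le> 2 * emeasure lborel C + ennreal e"
    using un int by (rule add_mono)
  finally show "emeasure lborel A + emeasure lborel B \<le> 2 * emeasure lborel C + ennreal e" .
qed

lemma nn_integral_layers:
  fixes f :: "real \<Rightarrow> real"
  assumes [measurable]: "f \<in> borel_measurable borel" and nn: "\<And>x. 0 \<le> f x"
  shows "(\<integral>\<^sup>+x. ennreal (f x) \<partial>lborel) = (\<integral>\<^sup>+t. indicator {0..} t * emeasure lborel {x. t < f x} \<partial>lborel)"
proof -
  have "(\<integral>\<^sup>+x. ennreal (f x) \<partial>lborel)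
      = (\<integral>\<^sup>+x. (\<integral>\<^sup>+t. (if 0 \<le> t \<and> t < f x then 1 else 0) \<partial>lborel) \<partial>lborel)"
  proof (rule nn_integral_cong)
    fix x
    have "(\<integral>\<^sup>+t. (if 0 \<le> t \<and> t < f x then 1 else 0) \<partial>lborel) = (\<integral>\<^sup>+t. indicator {0..<f x} t \<partial>lborel)"
      by (intro nn_integral_cong) (auto simp: indicator_def)
    then show "ennreal (f x) = (\<integral>\<^sup>+t. (if 0 \<le> t \<and> t < f x then 1 else 0) \<partial>lborel)"
      using nn[of x] by simp
  qed
  also have "\<dots> = (\<integral>\<^sup>+t. (\<integral>\<^sup>+x. (if 0 \<le> t \<and> t < f x then 1 else 0) \<partial>lborel) \<partial>lborel)"
    by (rule lborel_pair.Fubini'[of "\<lambda>x t. if 0 \<le> t \<and> t < f x then 1 else 0", symmetric]) measurable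
  also have "\<dots> = (\<integral>\<^sup>+t. indicator {0..} t * emeasure lborel {x. t < f x} \<partial>lborel)"
  proof (rule nn_integral_cong)
    fix t :: real
    have "(\<integral>\<^sup>+x. (if 0 \<le> t \<and> t < f x then 1 else 0) \<partial>lborel)
        = (\<integral>\<^sup>+x. indicator {0..} t * indicator {x. t < f x} x \<partial>lborel)"
      by (intro nn_integral_cong) (auto simp: indicator_def)
    also have "\<dots> = indicator {0..} t * emeasure lborel {x. t < f x}"
      by (subst nn_integral_cmult) auto
    finally show "(\<integral>\<^sup>+x. (if 0 \<le> t \<and> t < f x then 1 else 0) \<partial>lborel)
        = indicator {0..} t * emeasure lborel {x. t < f x}" .
  qed
  finally show ?thesis .
qed

lemma ennreal_mult_le_square_mean:
  fixes a b c :: ennreal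
  assumes "a + b \<le> 2 * c"
  shows "a * b \<le> c\<^sup>2"
proof (cases "c = \<infinity>")
  case True
  then show ?thesis by (simp add: power2_eq_square)
next
  case False
  then have "2 * c < \<infinity>" by (simp add: ennreal_mult_less_top less_top)
  then have ab: "a < \<infinity>" "b < \<infinity>"
    using le_less_trans[OF assms \<open>2 * c < \<infinity>\<close>] by simp_all
  obtain x y z where xyz: "a = ennreal x" "b = ennreal y" "c = ennreal z" "0 \<le> x" "0 \<le> y" "0 \<le> z"
    using ab False by (metis ennreal_cases infinity_ennreal_def less_irrefl)
  have "ennreal (x + y) \<le> ennreal (2 * z)"
    using assms xyz by (simp add: ennreal_mult ennreal_numeral)
  then have "x + y \<le> 2 * z" using xyz by (subst (asm) ennreal_le_iff) auto
  then have "(x + y)\<^sup>2 \<le> (2 * z)\<^sup>2" using xyz by (intro power_mono) auto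
  moreover have "4 * (x * y) \<le> (x + y)\<^sup>2" using zero_le_power2[of "x - y"]
    by (simp add: power2_eq_square algebra_simps)
  ultimately have "x * y \<le> z\<^sup>2" by (simp add: power_mult_distrib)
  then show ?thesis using xyz by (simp add: ennreal_power flip: ennreal_mult)
qed

text \<open>With both suprema equal to 1, the level sets of f and g at any height t < 1 are
  nonempty, so the inequality for sets applies at each height. Integrating over t bounds the sum of
  the two integrals by twice that of h; the product follows by the inequality of the means.\<close>

lemma prekopa_leindler_real_normalized:
  fixes f g h :: "real \<Rightarrow> real"
  assumes meas[measurable]: "f \<in> borel_measurable borel" "g \<in> borel_measurable borel" "h \<in> borel_measurable borel"
    and nn: "\<And>x. 0 \<le> f x" "\<And>x. 0 \<le> g x" "\<And>x. 0 \<le> h x"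
    and le1: "\<And>x. f x \<le> 1" "\<And>x. g x \<le> 1"
    and sup: "\<And>t. t < 1 \<Longrightarrow> \<exists>x. t < f x" "\<And>t. t < 1 \<Longrightarrow> \<exists>x. t < g x"
    and supp: "\<And>x. K < \<bar>x\<bar> \<Longrightarrow> f x = 0 \<and> g x = 0"
    and fgh: "\<And>x y. f x * g y \<le> (h ((x + y) / 2))\<^sup>2"
  shows "(\<integral>\<^sup>+x. f x \<partial>lborel) * (\<integral>\<^sup>+x. g x \<partial>lborel) \<le> (\<integral>\<^sup>+x. h x \<partial>lborel)\<^sup>2"
proof (rule ennreal_mult_le_square_mean)
  have lev: "emeasure lborel {x. t < f x} + emeasure lborel {x. t < g x} \<le> 2 * emeasure lborel {x. t < h x}"
    if t: "0 \<le> t" for t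
  proof (cases "t < 1")
    case True
    have bd: "bounded {x. t < f x}" "bounded {x. t < g x}"
    proof -
      have "{x. t < u x} \<subseteq> {-K..K}" if "\<And>x. K < \<bar>x\<bar> \<Longrightarrow> u x = 0" for u :: "real \<Rightarrow> real"
      proof
        fix x assume "x \<in> {x. t < u x}"
        then have "\<not> K < \<bar>x\<bar>" using that[of x] t by auto
        then show "x \<in> {-K..K}" by auto
      qed
      then show "bounded {x. t < f x}" "bounded {x. t < g x}"
        using supp bounded_closed_interval bounded_subset by blast+
    qed
    show ?thesis
    proof (rule brunn_minkowski_real)
      show "{x. t < f x} \<noteq> {}" "{x. t < g x} \<noteq> {}" using sup True by auto
      fix a b assume "a \<in> {x. t < f x}" "b \<in> {x. t < g x}"
      then have "t * t < f a * g b" using t by (intro mult_strict_mono') auto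
      also have "\<dots> \<le> (h ((a + b) / 2))\<^sup>2" by (rule fgh)
      finally have "t\<^sup>2 < (h ((a + b) / 2))\<^sup>2" by (simp add: power2_eq_square)
      then show "(a + b) / 2 \<in> {x. t < h x}" using nn(3) by (auto intro: power2_less_imp_less)
    qed (use bd in auto)
  next
    case False
    then have "{x. t < f x} = {}" "{x. t < g x} = {}" using le1 by (auto simp: not_less intro: order_trans)
    then show ?thesis by simp
  qed
  have "(\<integral>\<^sup>+x. f x \<partial>lborel) + (\<integral>\<^sup>+x. g x \<partial>lborel)
      = (\<integral>\<^sup>+t. indicator {0..} t * emeasure lborel {x. t < f x} + indicator {0..} t * emeasure lborel {x. t < g x} \<partial>lborel)"
    unfolding nn_integral_layers[OF meas(1) nn(1)] nn_integral_layers[OF meas(2) nn(2)]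
    by (rule nn_integral_add[symmetric]) measurable
  also have "\<dots> \<le> (\<integral>\<^sup>+t. 2 * (indicator {0..} t * emeasure lborel {x. t < h x}) \<partial>lborel)"
    using lev by (intro nn_integral_mono) (auto simp: indicator_def)
  also have "\<dots> = 2 * (\<integral>\<^sup>+x. h x \<partial>lborel)"
    unfolding nn_integral_layers[OF meas(3) nn(3)]
    by (rule nn_integral_cmult) measurable
  finally show "(\<integral>\<^sup>+x. f x \<partial>lborel) + (\<integral>\<^sup>+x. g x \<partial>lborel) \<le> 2 * (\<integral>\<^sup>+x. h x \<partial>lborel)" .
qed

text \<open>Dividing f and g by their suprema and h by the geometric mean of these suprema preserves
  the hypothesis and scales both sides alike.\<close>

lemma prekopa_leindler_real_bounded:
  fixes f g h :: "real \<Rightarrow> real"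
  assumes meas[measurable]: "f \<in> borel_measurable borel" "g \<in> borel_measurable borel" "h \<in> borel_measurable borel"
    and nn: "\<And>x. 0 \<le> f x" "\<And>x. 0 \<le> g x" "\<And>x. 0 \<le> h x"
    and bd: "\<And>x. f x \<le> K" "\<And>x. g x \<le> K"
    and supp: "\<And>x. K < \<bar>x\<bar> \<Longrightarrow> f x = 0 \<and> g x = 0"
    and fgh: "\<And>x y. f x * g y \<le> (h ((x + y) / 2))\<^sup>2"
  shows "(\<integral>\<^sup>+x. f x \<partial>lborel) * (\<integral>\<^sup>+x. g x \<partial>lborel) \<le> (\<integral>\<^sup>+x. h x \<partial>lborel)\<^sup>2"
proof (cases "(\<forall>x. f x = 0) \<or> (\<forall>x. g x = 0)")
  case True
  then show ?thesis by auto
next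
  case False
  define F where "F = Sup (range f)"
  define G where "G = Sup (range g)"
  have bF: "bdd_above (range f)" and bG: "bdd_above (range g)" using bd by (auto intro!: bdd_aboveI)
  have leF: "f x \<le> F" and leG: "g x \<le> G" for x
    unfolding F_def G_def using bF bG by (auto intro: cSUP_upper)
  obtain x0 y0 where "f x0 > 0" "g y0 > 0" using False nn by (metis order_le_less)
  then have F0: "F > 0" and G0: "G > 0" using leF[of x0] leG[of y0] by auto
  define c where "c = sqrt (F * G)"
  have c0: "c > 0" and c2: "c\<^sup>2 = F * G" using F0 G0 by (auto simp: c_def)
  have "(\<integral>\<^sup>+x. (f x / F) \<partial>lborel) * (\<integral>\<^sup>+x. (g x / G) \<partial>lborel) \<le> (\<integral>\<^sup>+x. (h x / c) \<partial>lborel)\<^sup>2"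
  proof (rule prekopa_leindler_real_normalized[where K = K])
    fix t :: real assume "t < 1"
    then have "t * F < F" "t * G < G" using F0 G0 by simp_all
    obtain x where "t * F < f x"
      using less_cSupD[of "range f" "t * F"] \<open>t * F < F\<close> by (auto simp: F_def)
    moreover obtain y where "t * G < g y"
      using less_cSupD[of "range g" "t * G"] \<open>t * G < G\<close> by (auto simp: G_def)
    ultimately show "\<exists>x. t < f x / F" "\<exists>x. t < g x / G" using F0 G0 by (auto simp: field_simps)
  next
    fix x y show "f x / F * (g y / G) \<le> (h ((x + y) / 2) / c)\<^sup>2"
      unfolding power_divide c2 using fgh[of x y] F0 G0 by (simp add: divide_right_mono)
  qed (use nn leF leG F0 G0 c0 supp in simp_all)
  then have "ennreal F * ennreal G * ((\<integral>\<^sup>+x. (f x / F) \<partial>lborel) * (\<integral>\<^sup>+x. (g x / G) \<partial>lborel))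
      \<le> (ennreal c)\<^sup>2 * (\<integral>\<^sup>+x. (h x / c) \<partial>lborel)\<^sup>2"
    using c2 c0 F0 G0 by (intro mult_mono) (auto simp: ennreal_power simp flip: ennreal_mult)
  moreover have "(\<integral>\<^sup>+x. f x \<partial>lborel) = ennreal F * (\<integral>\<^sup>+x. (f x / F) \<partial>lborel)"
    using F0 nn by (subst nn_integral_cmult[symmetric]) (auto simp flip: ennreal_mult)
  moreover have "(\<integral>\<^sup>+x. g x \<partial>lborel) = ennreal G * (\<integral>\<^sup>+x. (g x / G) \<partial>lborel)"
    using G0 nn by (subst nn_integral_cmult[symmetric]) (auto simp flip: ennreal_mult)
  moreover have "(\<integral>\<^sup>+x. h x \<partial>lborel) = ennreal c * (\<integral>\<^sup>+x. (h x / c) \<partial>lborel)"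
    using c0 nn by (subst nn_integral_cmult[symmetric]) (auto simp flip: ennreal_mult)
  ultimately show ?thesis by (simp only: power_mult_distrib mult_ac)
qed

lemma SUP_mult_le_ennreal:
  fixes a b :: "nat \<Rightarrow> ennreal"
  assumes "incseq a" "incseq b" and le: "\<And>k. a k * b k \<le> c"
  shows "(SUP k. a k) * (SUP k. b k) \<le> c"
proof -
  have "a i * b j \<le> c" for i j
  proof -
    have "a i * b j \<le> a (max i j) * b (max i j)"
      using assms(1,2) by (intro mult_mono) (auto simp: incseq_def)
    then show ?thesis using le order_trans by blast
  qed
  then show ?thesis
    by (simp add: SUP_mult_left_ennreal SUP_mult_right_ennreal SUP_le_iff)
qed

text \<open>Truncation in height and in support reduces this to bounded functions; monotone
  convergence removes the truncation.\<close>

lemma prekopa_leindler_real: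
  fixes f g h :: "real \<Rightarrow> ennreal"
  assumes meas[measurable]: "f \<in> borel_measurable borel" "g \<in> borel_measurable borel" "h \<in> borel_measurable borel"
    and fgh: "\<And>x y. f x * g y \<le> (h ((x + y) / 2))\<^sup>2"
  shows "(\<integral>\<^sup>+x. f x \<partial>lborel) * (\<integral>\<^sup>+x. g x \<partial>lborel) \<le> (\<integral>\<^sup>+x. h x \<partial>lborel)\<^sup>2"
proof -
  define T where "T = (\<lambda>(k::nat) (u :: real \<Rightarrow> ennreal) x. min (u x) (of_nat k) * indicator {- real k..real k} x)"
  have T_top: "T k u x < top" for k u x
    by (auto simp: T_def indicator_def min_less_iff_disj of_nat_less_top)
  have T_mono: "incseq (\<lambda>k. T k u)" for u
    unfolding incseq_def T_def le_fun_def
    by (auto simp: indicator_def min_le_iff_disj of_nat_mono)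
  have T_sup: "(SUP k. T k u x) = u x" for u x
  proof (rule antisym)
    show "(SUP k. T k u x) \<le> u x" by (rule SUP_least) (auto simp: T_def indicator_def)
    obtain k0 :: nat where k0: "\<bar>x\<bar> \<le> real k0" using real_arch_simple by blast
    show "u x \<le> (SUP k. T k u x)"
    proof (rule dense_le)
      fix y assume y: "y < u x"
      then have "y < top" by (rule order.strict_trans2) simp
      then obtain l :: nat where l: "y < of_nat l" using ennreal_Ex_less_of_nat by blast
      have "y \<le> of_nat (max l k0)"
        using l by (auto simp: of_nat_max intro: less_imp_le max.coboundedI1)
      then have "y \<le> min (u x) (of_nat (max l k0))" using y by (auto intro: less_imp_le)
      also have "\<dots> = T (max l k0) u x" using k0 by (auto simp: T_def indicator_def)
      also have "\<dots> \<le> (SUP k. T k u x)" by (rule SUP_upper) simp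
      finally show "y \<le> (SUP k. T k u x)" .
    qed
  qed
  have T_meas[measurable]: "T k u \<in> borel_measurable borel" if [measurable]: "u \<in> borel_measurable borel" for k u
    unfolding T_def by measurable
  have step: "(\<integral>\<^sup>+x. T k f x \<partial>lborel) * (\<integral>\<^sup>+x. T k g x \<partial>lborel) \<le> (\<integral>\<^sup>+x. h x \<partial>lborel)\<^sup>2" for k
  proof -
    \<comment> \<open>Capping h at the same height keeps its values finite and preserves the
      hypothesis: a product of two values that are at most k is at most k squared.\<close>
    define H where "H = (\<lambda>x. min (h x) (of_nat k))"
    have H_top: "H x < top" for x by (auto simp: H_def min_less_iff_disj of_nat_less_top)
    have [measurable]: "H \<in> borel_measurable borel" unfolding H_def by measurable
    have TH: "T k f x * T k g y \<le> (H ((x + y) / 2))\<^sup>2" for x y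
    proof (cases "h ((x + y) / 2) \<le> of_nat k")
      case True
      have "T k f x * T k g y \<le> f x * g y" by (intro mult_mono) (auto simp: T_def indicator_def)
      then show ?thesis using fgh[of x y] True by (auto simp: H_def min_def)
    next
      case False
      have "T k f x * T k g y \<le> of_nat k * of_nat k" by (intro mult_mono) (auto simp: T_def indicator_def)
      then show ?thesis using False by (auto simp: H_def min_def power2_eq_square)
    qed
    have "(\<integral>\<^sup>+x. ennreal (enn2real (T k f x)) \<partial>lborel) * (\<integral>\<^sup>+x. ennreal (enn2real (T k g x)) \<partial>lborel)
        \<le> (\<integral>\<^sup>+x. ennreal (enn2real (H x)) \<partial>lborel)\<^sup>2"
    proof (rule prekopa_leindler_real_bounded[where K = "real k"])
      show "enn2real (T k f x) \<le> real k" for x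
        by (rule enn2real_leI) (auto simp: T_def indicator_def ennreal_of_nat_eq_real_of_nat)
      show "enn2real (T k g x) \<le> real k" for x
        by (rule enn2real_leI) (auto simp: T_def indicator_def ennreal_of_nat_eq_real_of_nat)
      show "enn2real (T k f x) * enn2real (T k g y) \<le> (enn2real (H ((x + y) / 2)))\<^sup>2" for x y
        using enn2real_mono[OF TH[of x y]] H_top[of "(x+y)/2"]
        by (simp add: enn2real_mult power2_eq_square ennreal_mult_less_top)
    qed (auto simp: T_def indicator_def)
    then have "(\<integral>\<^sup>+x. T k f x \<partial>lborel) * (\<integral>\<^sup>+x. T k g x \<partial>lborel) \<le> (\<integral>\<^sup>+x. H x \<partial>lborel)\<^sup>2"
      using T_top H_top by simp
    also have "\<dots> \<le> (\<integral>\<^sup>+x. h x \<partial>lborel)\<^sup>2"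
      by (intro power_mono nn_integral_mono) (auto simp: H_def)
    finally show ?thesis .
  qed
  have eq: "(\<integral>\<^sup>+x. u x \<partial>lborel) = (SUP k. \<integral>\<^sup>+x. T k u x \<partial>lborel)" if [measurable]: "u \<in> borel_measurable borel" for u
  proof -
    have "(\<integral>\<^sup>+x. u x \<partial>lborel) = (\<integral>\<^sup>+x. (SUP k. T k u x) \<partial>lborel)" by (simp add: T_sup)
    also have "\<dots> = (SUP k. \<integral>\<^sup>+x. T k u x \<partial>lborel)"
      by (rule nn_integral_monotone_convergence_SUP[OF T_mono]) measurable
    finally show ?thesis .
  qed
  have inc: "incseq (\<lambda>k. \<integral>\<^sup>+x. T k u x \<partial>lborel)" for u
    using T_mono[of u] by (auto simp: incseq_def le_fun_def intro!: nn_integral_mono)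
  show ?thesis unfolding eq[OF meas(1)] eq[OF meas(2)]
    by (rule SUP_mult_le_ennreal[OF inc inc step])
qed

section \<open>Prekopa--Leindler and volumes of balls in finite products of the line\<close>

interpretation lborel_PiM: product_sigma_finite "\<lambda>_. lborel :: real measure"
  by standard

abbreviation lebesgue_PiM :: "'i set \<Rightarrow> ('i \<Rightarrow> real) measure" where
  "lebesgue_PiM I \<equiv> Pi\<^sub>M I (\<lambda>_. lborel)"

abbreviation vol :: "'i set \<Rightarrow> ('i \<Rightarrow> real) set \<Rightarrow> ennreal" where
  "vol I \<equiv> emeasure (lebesgue_PiM I)"

text \<open>Induction on the coordinates. For values s and t of one coordinate, the slices of f and
  g satisfy the hypothesis with the slice of h at (s + t) / 2; so by induction the integrals over
  the slices satisfy the one-dimensional hypothesis. These may be infinite, hence the values in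
  \<open>ennreal\<close>.\<close>

theorem prekopa_leindler:
  fixes f g h :: "('i \<Rightarrow> real) \<Rightarrow> ennreal"
  assumes "finite I"
    and "f \<in> borel_measurable (lebesgue_PiM I)" "g \<in> borel_measurable (lebesgue_PiM I)"
    and "h \<in> borel_measurable (lebesgue_PiM I)"
    and "\<And>x y. x \<in> space (lebesgue_PiM I) \<Longrightarrow> y \<in> space (lebesgue_PiM I) \<Longrightarrow>
      f x * g y \<le> (h (\<lambda>i\<in>I. (x i + y i) / 2))\<^sup>2"
  shows "(\<integral>\<^sup>+x. f x \<partial>lebesgue_PiM I) * (\<integral>\<^sup>+x. g x \<partial>lebesgue_PiM I) \<le> (\<integral>\<^sup>+x. h x \<partial>lebesgue_PiM I)\<^sup>2"
  using assms
proof (induction I arbitrary: f g h rule: finite_induct)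
  case empty
  then show ?case by (simp add: lborel_PiM.nn_integral_empty space_PiM restrict_def)
next
  case (insert j I)
  note [measurable] = insert.prems(1-3)
  have upd: "x(j := a) \<in> space (lebesgue_PiM (insert j I))" if "x \<in> space (lebesgue_PiM I)" for x a
    using that by (auto simp: space_PiM PiE_def extensional_def)
  have up[measurable]: "(\<lambda>x. x(j := a)) \<in> lebesgue_PiM I \<rightarrow>\<^sub>M lebesgue_PiM (insert j I)" for a
    by measurable
  show ?case
    unfolding lborel_PiM.product_nn_integral_insert_rev[OF insert.hyps insert.prems(1)]
      lborel_PiM.product_nn_integral_insert_rev[OF insert.hyps insert.prems(2)]
      lborel_PiM.product_nn_integral_insert_rev[OF insert.hyps insert.prems(3)]
  proof (rule prekopa_leindler_real)
    interpret finite_product_sigma_finite "\<lambda>_. lborel :: real measure" I by standard (rule insert.hyps)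
    show "(\<lambda>y. \<integral>\<^sup>+ x. f (x(j := y)) \<partial>lebesgue_PiM I) \<in> borel_measurable borel"
      "(\<lambda>y. \<integral>\<^sup>+ x. g (x(j := y)) \<partial>lebesgue_PiM I) \<in> borel_measurable borel"
      "(\<lambda>y. \<integral>\<^sup>+ x. h (x(j := y)) \<partial>lebesgue_PiM I) \<in> borel_measurable borel"
      by measurable
    fix s t
    show "(\<integral>\<^sup>+ x. f (x(j := s)) \<partial>lebesgue_PiM I) * (\<integral>\<^sup>+ x. g (x(j := t)) \<partial>lebesgue_PiM I)
        \<le> (\<integral>\<^sup>+ x. h (x(j := (s + t) / 2)) \<partial>lebesgue_PiM I)\<^sup>2"
    proof (rule insert.IH)
      fix x y assume xy: "x \<in> space (lebesgue_PiM I)" "y \<in> space (lebesgue_PiM I)"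
      have "(\<lambda>i\<in>insert j I. ((x(j := s)) i + (y(j := t)) i) / 2) = (\<lambda>i\<in>I. (x i + y i) / 2)(j := (s + t) / 2)"
        using insert.hyps by (auto simp: restrict_def fun_eq_iff)
      then show "f (x(j := s)) * g (y(j := t)) \<le> (h ((\<lambda>i\<in>I. (x i + y i) / 2)(j := (s + t) / 2)))\<^sup>2"
        using insert.prems(4)[OF upd[OF xy(1), of s] upd[OF xy(2), of t]] by (simp only:)
    qed measurable
  qed
qed

abbreviation l2_dist :: "'i set \<Rightarrow> ('i \<Rightarrow> real) \<Rightarrow> ('i \<Rightarrow> real) \<Rightarrow> real" where
  "l2_dist I x y \<equiv> L2_set (\<lambda>i. x i - y i) I"

text \<open>One change of variables that serves translations, dilations and the reflection c = -1
  alike.\<close>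

lemma nn_integral_PiM_affine:
  fixes f :: "('i \<Rightarrow> real) \<Rightarrow> ennreal"
  assumes "finite I" and "f \<in> borel_measurable (lebesgue_PiM I)" and "c \<noteq> 0"
  shows "(\<integral>\<^sup>+x. f x \<partial>lebesgue_PiM I)
    = ennreal (\<bar>c\<bar> ^ card I) * (\<integral>\<^sup>+x. f (\<lambda>i\<in>I. t i + c * x i) \<partial>lebesgue_PiM I)"
  using assms(1,2)
proof (induction I arbitrary: f rule: finite_induct)
  case empty
  show ?case unfolding lborel_PiM.nn_integral_empty[OF zero_le] by (simp add: restrict_def)
next
  case (insert j I)
  note [measurable] = insert.prems(1)
  interpret finite_product_sigma_finite "\<lambda>_. lborel :: real measure" I by standard (rule insert.hyps)
  define F where "F = (\<lambda>x. \<integral>\<^sup>+y. f (x(j := t j + c * y)) \<partial>lborel)"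
  have F[measurable]: "F \<in> borel_measurable (lebesgue_PiM I)" unfolding F_def by measurable
  have "(\<integral>\<^sup>+x. f x \<partial>lebesgue_PiM (insert j I)) = (\<integral>\<^sup>+x. (\<integral>\<^sup>+y. f (x(j := y)) \<partial>lborel) \<partial>lebesgue_PiM I)"
    by (rule lborel_PiM.product_nn_integral_insert[OF insert.hyps insert.prems])
  also have "\<dots> = (\<integral>\<^sup>+x. ennreal \<bar>c\<bar> * F x \<partial>lebesgue_PiM I)"
  proof (rule nn_integral_cong)
    fix x assume "x \<in> space (lebesgue_PiM I)"
    then have "(\<lambda>y. f (x(j := y))) \<in> borel_measurable borel" by measurable
    then show "(\<integral>\<^sup>+y. f (x(j := y)) \<partial>lborel) = ennreal \<bar>c\<bar> * F x"
      unfolding F_def by (rule nn_integral_real_affine[OF _ \<open>c \<noteq> 0\<close>])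
  qed
  also have "\<dots> = ennreal \<bar>c\<bar> * (\<integral>\<^sup>+x. F x \<partial>lebesgue_PiM I)" by (rule nn_integral_cmult) measurable
  also have "\<dots> = ennreal \<bar>c\<bar> * (ennreal (\<bar>c\<bar> ^ card I) * (\<integral>\<^sup>+x. F (\<lambda>i\<in>I. t i + c * x i) \<partial>lebesgue_PiM I))"
    by (simp only: insert.IH[OF F])
  also have "\<dots> = ennreal (\<bar>c\<bar> ^ card (insert j I)) * (\<integral>\<^sup>+x. F (\<lambda>i\<in>I. t i + c * x i) \<partial>lebesgue_PiM I)"
    using insert.hyps by (simp add: ennreal_mult mult.assoc)
  also have "(\<integral>\<^sup>+x. F (\<lambda>i\<in>I. t i + c * x i) \<partial>lebesgue_PiM I)
      = (\<integral>\<^sup>+x. (\<integral>\<^sup>+y. f (\<lambda>i\<in>insert j I. t i + c * (x(j := y)) i) \<partial>lborel) \<partial>lebesgue_PiM I)"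
  proof -
    have "(\<lambda>i\<in>I. t i + c * x i)(j := t j + c * y) = (\<lambda>i\<in>insert j I. t i + c * (x(j := y)) i)" for x y
      using insert.hyps by (auto simp: fun_eq_iff)
    then show ?thesis unfolding F_def by (simp only:)
  qed
  also have "\<dots> = (\<integral>\<^sup>+x. f (\<lambda>i\<in>insert j I. t i + c * x i) \<partial>lebesgue_PiM (insert j I))"
    by (rule lborel_PiM.product_nn_integral_insert[OF insert.hyps, symmetric]) measurable
  finally show ?case .
qed

lemma emeasure_PiM_affine:
  fixes A :: "('i \<Rightarrow> real) set"
  assumes "finite I" and [measurable]: "A \<in> sets (lebesgue_PiM I)" and "c \<noteq> 0"
  shows "vol I A = ennreal (\<bar>c\<bar> ^ card I) *
    vol I {x \<in> space (lebesgue_PiM I). (\<lambda>i\<in>I. t i + c * x i) \<in> A}"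
proof -
  have "vol I A
      = ennreal (\<bar>c\<bar> ^ card I) * (\<integral>\<^sup>+x. indicator A (\<lambda>i\<in>I. t i + c * x i) \<partial>lebesgue_PiM I)"
    using nn_integral_PiM_affine[OF assms(1) _ assms(3), of "indicator A" t] by simp
  also have "(\<integral>\<^sup>+x. indicator A (\<lambda>i\<in>I. t i + c * x i) \<partial>lebesgue_PiM I)
      = (\<integral>\<^sup>+x. indicator {x \<in> space (lebesgue_PiM I). (\<lambda>i\<in>I. t i + c * x i) \<in> A} x \<partial>lebesgue_PiM I)"
    by (intro nn_integral_cong) (auto simp: indicator_def)
  also have "\<dots> = vol I {x \<in> space (lebesgue_PiM I). (\<lambda>i\<in>I. t i + c * x i) \<in> A}"
    by (rule nn_integral_indicator) measurable
  finally show ?thesis .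
qed

definition l2_ball :: "'i set \<Rightarrow> real \<Rightarrow> ('i \<Rightarrow> real) set" where
  "l2_ball I r = {x \<in> space (lebesgue_PiM I). L2_set x I \<le> r}"

lemma measurable_L2_set [measurable]:
  "(\<lambda>x. L2_set x I) \<in> borel_measurable (lebesgue_PiM I)"
  unfolding L2_set_def by measurable

lemma sets_l2_ball [measurable]: "l2_ball I r \<in> sets (lebesgue_PiM I)"
  unfolding l2_ball_def by measurable

lemma emeasure_l2_ball_scale:
  assumes "finite I" "r > 0"
  shows "vol I (l2_ball I r) = ennreal (r ^ card I) * vol I (l2_ball I 1)"
proof -
  have "L2_set (\<lambda>i\<in>I. r * x i) I = r * L2_set x I" for x
    using L2_set_right_distrib[of r x I] assms(2) by (simp cong: L2_set_cong)
  then have "{x \<in> space (lebesgue_PiM I). (\<lambda>i\<in>I. 0 + r * x i) \<in> l2_ball I r} = l2_ball I 1"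
    using assms(2) by (auto simp: l2_ball_def space_PiM)
  then show ?thesis
    using emeasure_PiM_affine[OF assms(1) sets_l2_ball[of I r], of r "\<lambda>_. 0"] assms(2) by simp
qed

lemma emeasure_l2_ball_translate:
  assumes "finite I"
  shows "vol I {x \<in> space (lebesgue_PiM I). l2_dist I x t \<le> r}
    = vol I (l2_ball I r)"
proof -
  have "L2_set (\<lambda>i\<in>I. x i - t i) I = l2_dist I x t" for x by (simp cong: L2_set_cong)
  then have "{x \<in> space (lebesgue_PiM I). l2_dist I x t \<le> r}
      = {x \<in> space (lebesgue_PiM I). (\<lambda>i\<in>I. - t i + 1 * x i) \<in> l2_ball I r}"
    by (auto simp: l2_ball_def space_PiM)
  then show ?thesis
    using emeasure_PiM_affine[OF assms sets_l2_ball[of I r], of 1 "\<lambda>i. - t i"] by simp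
qed

lemma emeasure_l2_ball_finite:
  assumes "finite I"
  shows "vol I (l2_ball I r) < \<infinity>"
proof -
  have "l2_ball I r \<subseteq> Pi\<^sub>E I (\<lambda>_. {- r..r})"
  proof
    fix x assume x: "x \<in> l2_ball I r"
    then have "\<bar>x i\<bar> \<le> r" if "i \<in> I" for i
      using member_le_L2_set[OF assms that, of "\<lambda>i. \<bar>x i\<bar>"] by (auto simp: l2_ball_def L2_set_def)
    then show "x \<in> Pi\<^sub>E I (\<lambda>_. {- r..r})" using x by (fastforce simp: l2_ball_def space_PiM)
  qed
  then have "vol I (l2_ball I r) \<le> vol I (Pi\<^sub>E I (\<lambda>_. {- r..r}))"
    by (intro emeasure_mono) (use assms in auto)
  also have "\<dots> = (\<Prod>i\<in>I. emeasure lborel {- r..r})"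
    using assms by (intro lborel_PiM.emeasure_PiM) auto
  also have "\<dots> < \<infinity>" by (auto simp: emeasure_lborel_Icc_eq ennreal_power power_0_left)
  finally show ?thesis .
qed

lemma emeasure_l2_ball_pos:
  assumes "finite I"
  shows "vol I (l2_ball I 1) > 0"
proof -
  have sub: "Pi\<^sub>E I (\<lambda>_. {0..1 / (real (card I) + 1)}) \<subseteq> l2_ball I 1"
  proof
    fix x assume x: "x \<in> Pi\<^sub>E I (\<lambda>_. {0..1 / (real (card I) + 1)})"
    have "L2_set x I \<le> (\<Sum>i\<in>I. x i)" using x by (intro L2_set_le_sum) auto
    also have "\<dots> \<le> (\<Sum>i\<in>I. 1 / (real (card I) + 1))" using x by (intro sum_mono) auto
    also have "\<dots> \<le> 1" by (simp add: field_simps)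
    finally show "x \<in> l2_ball I 1" using x by (auto simp: l2_ball_def space_PiM)
  qed
  have "0 < (\<Prod>i\<in>I. emeasure lborel {0..1 / (real (card I) + 1)})"
    by (auto simp: emeasure_lborel_Icc_eq ennreal_power)
  also have "\<dots> = vol I (Pi\<^sub>E I (\<lambda>_. {0..1 / (real (card I) + 1)}))"
    using assms by (intro lborel_PiM.emeasure_PiM[symmetric]) auto
  also have "\<dots> \<le> vol I (l2_ball I 1)" using sub by (intro emeasure_mono) auto
  finally show ?thesis .
qed

lemma ennreal_power2_le_imp_le:
  fixes a b :: ennreal
  assumes "a * a \<le> b\<^sup>2"
  shows "a \<le> b"
proof (cases "b = top")
  case False
  then obtain y where y: "b = ennreal y" "0 \<le> y" by (cases b) auto
  have "a \<noteq> top" using assms y by (auto simp: ennreal_power top_unique)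
  then obtain x where x: "a = ennreal x" "0 \<le> x" by (cases a) auto
  have "ennreal (x\<^sup>2) \<le> ennreal (y\<^sup>2)" using assms x y by (simp add: ennreal_power power2_eq_square ennreal_mult)
  then have "x\<^sup>2 \<le> y\<^sup>2" using y by (subst (asm) ennreal_le_iff) auto
  then have "x \<le> y" using y(2) by (rule power2_le_imp_le)
  then show ?thesis using x y by (simp add: ennreal_leI)
qed simp

text \<open>The midpoint of a point of K and a point of -K is half the difference of two points of
  K, so it lies in the ball of radius D / 2. Prekopa--Leindler for the indicators of K and -K bounds
  the square of the volume of K.\<close>

theorem isodiametric_inequality:
  assumes "finite I" and [measurable]: "K \<in> sets (lebesgue_PiM I)"
    and diam: "\<And>x y. x \<in> K \<Longrightarrow> y \<in> K \<Longrightarrow> l2_dist I x y \<le> D"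
  shows "vol I K \<le> vol I (l2_ball I (D / 2))"
proof (rule ennreal_power2_le_imp_le)
  define K' where "K' = {x \<in> space (lebesgue_PiM I). (\<lambda>i\<in>I. 0 + (- 1) * x i) \<in> K}"
  have [measurable]: "K' \<in> sets (lebesgue_PiM I)" unfolding K'_def by measurable
  have K': "vol I K' = vol I K"
    unfolding K'_def using emeasure_PiM_affine[OF assms(1,2), of "-1" "\<lambda>_. 0"] by simp
  have "(\<integral>\<^sup>+x. indicator K x \<partial>lebesgue_PiM I) * (\<integral>\<^sup>+x. indicator K' x \<partial>lebesgue_PiM I)
      \<le> (\<integral>\<^sup>+x. indicator (l2_ball I (D / 2)) x \<partial>lebesgue_PiM I)\<^sup>2"
  proof (rule prekopa_leindler[OF assms(1)])
    fix x y :: "'a \<Rightarrow> real"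
    assume xy: "x \<in> space (lebesgue_PiM I)" "y \<in> space (lebesgue_PiM I)"
    have "(\<lambda>i\<in>I. (x i + y i) / 2) \<in> l2_ball I (D / 2)" if "x \<in> K" "y \<in> K'"
    proof -
      have "L2_set (\<lambda>i\<in>I. (x i + y i) / 2) I = L2_set (\<lambda>i. (1 / 2) * (x i - (\<lambda>i\<in>I. 0 + (- 1) * y i) i)) I"
        by (intro L2_set_cong) auto
      also have "\<dots> = (1 / 2) * L2_set (\<lambda>i. x i - (\<lambda>i\<in>I. 0 + (- 1) * y i) i) I"
        by (rule L2_set_right_distrib[symmetric]) simp
      also have "\<dots> \<le> (1 / 2) * D"
        using diam[OF that(1), of "\<lambda>i\<in>I. 0 + (- 1) * y i"] that(2) unfolding K'_def by simp
      finally show ?thesis by (auto simp: l2_ball_def space_PiM)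
    qed
    then show "indicator K x * indicator K' y \<le> (indicator (l2_ball I (D / 2)) (\<lambda>i\<in>I. (x i + y i) / 2) :: ennreal)\<^sup>2"
      by (auto simp: indicator_def)
  qed measurable
  then show "vol I K * vol I K \<le> (vol I (l2_ball I (D / 2)))\<^sup>2"
    by (simp add: K')
qed

section \<open>Colourings of spheres\<close>

definition grid_cell :: "'i set \<Rightarrow> real \<Rightarrow> ('i \<Rightarrow> real) \<Rightarrow> 'i \<Rightarrow> int" where
  "grid_cell I \<delta> x = (\<lambda>i\<in>I. \<lfloor>x i / \<delta>\<rfloor>)"

text \<open>There are only countably many cells, so every union of cells is measurable, whatever
  \<open>T\<close> is. This is what makes an arbitrary colouring, read off cell by cell,
  measurable.\<close>

lemma sets_grid_cell:
  assumes "finite I"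
  shows "{x \<in> space (lebesgue_PiM I). grid_cell I \<delta> x \<in> T} \<in> sets (lebesgue_PiM I)"
proof -
  have c: "countable (T \<inter> Pi\<^sub>E I (\<lambda>_. UNIV))"
    using assms by (intro countable_Int2 countable_PiE) auto
  have "{x \<in> space (lebesgue_PiM I). grid_cell I \<delta> x \<in> T}
      = (\<Union>z\<in>T \<inter> Pi\<^sub>E I (\<lambda>_. UNIV). {x \<in> space (lebesgue_PiM I). \<forall>i\<in>I. \<lfloor>x i / \<delta>\<rfloor> = z i})"
  proof (intro equalityI subsetI)
    fix x assume "x \<in> {x \<in> space (lebesgue_PiM I). grid_cell I \<delta> x \<in> T}"
    then show "x \<in> (\<Union>z\<in>T \<inter> Pi\<^sub>E I (\<lambda>_. UNIV). {x \<in> space (lebesgue_PiM I). \<forall>i\<in>I. \<lfloor>x i / \<delta>\<rfloor> = z i})"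
      by (intro UN_I[of "grid_cell I \<delta> x"]) (auto simp: grid_cell_def)
  next
    fix x assume "x \<in> (\<Union>z\<in>T \<inter> Pi\<^sub>E I (\<lambda>_. UNIV). {x \<in> space (lebesgue_PiM I). \<forall>i\<in>I. \<lfloor>x i / \<delta>\<rfloor> = z i})"
    then obtain z where z: "z \<in> T" "z \<in> Pi\<^sub>E I (\<lambda>_. UNIV)" "x \<in> space (lebesgue_PiM I)" "\<forall>i\<in>I. \<lfloor>x i / \<delta>\<rfloor> = z i"
      by blast
    then have "grid_cell I \<delta> x = z"
      by (intro ext) (auto simp: grid_cell_def restrict_def PiE_def extensional_def)
    then show "x \<in> {x \<in> space (lebesgue_PiM I). grid_cell I \<delta> x \<in> T}" using z by auto
  qed
  also have "\<dots> \<in> sets (lebesgue_PiM I)"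
    by (intro sets.countable_UN'[OF c]) (use assms in auto)
  finally show ?thesis .
qed

lemma grid_cell_eq_imp_close:
  assumes "finite I" "\<delta> > 0" and eq: "grid_cell I \<delta> x = grid_cell I \<delta> y"
  shows "l2_dist I x y \<le> real (card I) * \<delta>"
proof -
  have "\<bar>x i - y i\<bar> \<le> \<delta>" if "i \<in> I" for i
  proof -
    have "\<lfloor>x i / \<delta>\<rfloor> = \<lfloor>y i / \<delta>\<rfloor>" using fun_cong[OF eq, of i] that by (simp add: grid_cell_def)
    then have "\<bar>x i / \<delta> - y i / \<delta>\<bar> < 1" by linarith
    then show ?thesis using assms(2) by (simp add: diff_divide_distrib[symmetric] abs_divide divide_simps)
  qed
  then have "(\<Sum>i\<in>I. \<bar>x i - y i\<bar>) \<le> (\<Sum>i\<in>I. \<delta>)" by (intro sum_mono)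
  then show ?thesis using L2_set_le_sum_abs[of "\<lambda>i. x i - y i" I] by simp
qed

lemma L2_set_dist_triangle:
  "l2_dist I x z \<le> l2_dist I x y + l2_dist I y z"
  using L2_set_triangle_ineq[of "\<lambda>i. x i - y i" "\<lambda>i. y i - z i" I] by simp

lemma L2_set_minus_commute: "l2_dist I x y = l2_dist I y x"
  by (simp add: L2_set_def power2_commute)

text \<open>Comparison through the vector a w: one difference is a chord shrunk by a, the other is
  purely radial.\<close>

lemma L2_set_scaled_dist:
  fixes u w :: "'i \<Rightarrow> real"
  assumes "0 \<le> a" "a \<le> 1" "L2_set w I = 1" "\<bar>a - b\<bar> \<le> \<eta>" "l2_dist I u w \<le> D"
  shows "L2_set (\<lambda>i. a * u i - b * w i) I \<le> D + \<eta>"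
proof -
  have "L2_set (\<lambda>i. a * u i - b * w i) I
      \<le> L2_set (\<lambda>i. a * u i - a * w i) I + L2_set (\<lambda>i. a * w i - b * w i) I"
    by (rule L2_set_dist_triangle)
  also have "L2_set (\<lambda>i. a * u i - a * w i) I = a * l2_dist I u w"
    using assms(1) by (simp add: L2_set_right_distrib algebra_simps)
  also have "L2_set (\<lambda>i. a * w i - b * w i) I = L2_set (\<lambda>i. \<bar>a - b\<bar> * w i) I"
    by (simp add: L2_set_def power_mult_distrib flip: left_diff_distrib)
  also have "\<dots> = \<bar>a - b\<bar> * L2_set w I"
    by (rule L2_set_right_distrib[symmetric]) simp
  also have "a * l2_dist I u w \<le> 1 * l2_dist I u w"
    using assms by (intro mult_right_mono) auto
  finally show ?thesis using assms by simp
qed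

text \<open>The colouring is extended radially to a shell, where each colour class has small volume by the
  isodiametric inequality. Colours are only read off at one representative per grid cell, so that the
  classes are measurable.\<close>

proposition sphere_colouring_lower_bound:
  fixes c :: "('i \<Rightarrow> real) \<Rightarrow> nat"
  assumes I: "finite I" "I \<noteq> {}" and \<eta>: "0 < \<eta>" "\<eta> < 1" and "0 \<le> D"
    and ck: "\<And>x. L2_set x I = 1 \<Longrightarrow> c x < k"
    and cD: "\<And>x y. L2_set x I = 1 \<Longrightarrow> L2_set y I = 1 \<Longrightarrow> c x = c y \<Longrightarrow> l2_dist I x y \<le> D"
  shows "\<eta> \<le> real k * (D / 2 + 2 * \<eta>) ^ card I"
proof -
  define M where "M = lebesgue_PiM I"
  define N where "N = card I"
  have N: "N \<ge> 1" using I by (simp add: N_def Suc_le_eq card_gt_0_iff)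
  \<comment> \<open>This side length makes the diameter of a cell at most \<eta>, by the crude
    estimate with the sum of the coordinate differences.\<close>
  define \<delta> where "\<delta> = \<eta> / N"
  have \<delta>: "\<delta> > 0" "real N * \<delta> = \<eta>" using \<eta> N by (auto simp: \<delta>_def)
  define v where "v = emeasure M (l2_ball I 1)"
  have v: "0 < v" "v < \<infinity>"
    unfolding v_def M_def using emeasure_l2_ball_pos[OF I(1)] emeasure_l2_ball_finite[OF I(1)] by auto
  define W where "W = l2_ball I 1 - l2_ball I (1 - \<eta>)"
  have W_sets[measurable]: "W \<in> sets M" unfolding W_def M_def by measurable
  have W: "1 - \<eta> < L2_set x I" "L2_set x I \<le> 1" if "x \<in> W" for x
    using that by (auto simp: W_def l2_ball_def)
  define R where "R = (\<lambda>z. SOME y. y \<in> W \<and> grid_cell I \<delta> y = z)"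
  have R: "R (grid_cell I \<delta> x) \<in> W" "grid_cell I \<delta> (R (grid_cell I \<delta> x)) = grid_cell I \<delta> x" if "x \<in> W" for x
    using someI[of "\<lambda>y. y \<in> W \<and> grid_cell I \<delta> y = grid_cell I \<delta> x" x] that by (auto simp: R_def)
  define dir :: "('i \<Rightarrow> real) \<Rightarrow> 'i \<Rightarrow> real" where "dir = (\<lambda>x i. inverse (L2_set x I) * x i)"
  have dir: "L2_set (dir x) I = 1" if "x \<in> W" for x
    using W[OF that] \<eta> unfolding dir_def by (subst L2_set_right_distrib[symmetric]) auto
  define K where "K = (\<lambda>j. {x \<in> W. c (dir (R (grid_cell I \<delta> x))) = j})"
  have K_sets: "K j \<in> sets M" for j
  proof -
    have "K j = W \<inter> {x \<in> space M. grid_cell I \<delta> x \<in> {z. c (dir (R z)) = j}}"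
      using sets.sets_into_space[OF W_sets] by (auto simp: K_def)
    also have "\<dots> \<in> sets M"
      using W_sets sets_grid_cell[OF I(1)] unfolding M_def by (rule sets.Int)
    finally show ?thesis .
  qed
  have "W \<subseteq> (\<Union>j<k. K j)" using R dir ck by (auto simp: K_def)
  then have "emeasure M W \<le> emeasure M (\<Union>j<k. K j)" by (intro emeasure_mono) (use K_sets in auto)
  also have "\<dots> \<le> (\<Sum>j<k. emeasure M (K j))" using K_sets by (intro emeasure_subadditive_finite) auto
  also have "\<dots> \<le> (\<Sum>j<k. ennreal ((D / 2 + 2 * \<eta>) ^ N) * v)"
  proof (rule sum_mono)
    fix j
    \<comment> \<open>Replacing x and y by representatives of their cells costs \<eta> each, and
      their different radii cost \<eta> once more; the fourth \<eta> is slack.\<close>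
    have "emeasure M (K j) \<le> emeasure M (l2_ball I ((D + 4 * \<eta>) / 2))"
      unfolding M_def
    proof (rule isodiametric_inequality[OF I(1)])
      show "K j \<in> sets (lebesgue_PiM I)" using K_sets by (simp add: M_def)
      fix x y assume xy: "x \<in> K j" "y \<in> K j"
      define a where "a = R (grid_cell I \<delta> x)"
      define b where "b = R (grid_cell I \<delta> y)"
      have ab: "a \<in> W" "b \<in> W" "grid_cell I \<delta> a = grid_cell I \<delta> x" "grid_cell I \<delta> b = grid_cell I \<delta> y"
        "c (dir a) = c (dir b)"
        using xy R by (auto simp: a_def b_def K_def)
      have "L2_set (\<lambda>i. L2_set a I * dir a i - L2_set b I * dir b i) I \<le> D + \<eta>"
        using W[OF ab(1)] W[OF ab(2)] ab cD dir by (intro L2_set_scaled_dist) auto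
      moreover have "L2_set a I \<noteq> 0" "L2_set b I \<noteq> 0"
        using W(1)[OF ab(1)] W(1)[OF ab(2)] \<eta> by auto
      then have "L2_set a I * dir a i = a i" "L2_set b I * dir b i = b i" for i
        by (simp_all add: dir_def)
      ultimately have "l2_dist I a b \<le> D + \<eta>" by simp
      moreover have "l2_dist I x a \<le> \<eta>" "l2_dist I b y \<le> \<eta>"
        using grid_cell_eq_imp_close[OF I(1) \<delta>(1)] ab \<delta>(2) unfolding N_def by metis+
      ultimately show "l2_dist I x y \<le> D + 4 * \<eta>"
        using L2_set_dist_triangle[of x y I a] L2_set_dist_triangle[of a y I b] \<eta> by linarith
    qed
    also have "(D + 4 * \<eta>) / 2 = D / 2 + 2 * \<eta>" by simp
    also have "emeasure M (l2_ball I (D / 2 + 2 * \<eta>)) = ennreal ((D / 2 + 2 * \<eta>) ^ N) * v"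
      unfolding M_def N_def v_def using \<eta> \<open>0 \<le> D\<close> by (intro emeasure_l2_ball_scale[OF I(1)]) auto
    finally show "emeasure M (K j) \<le> ennreal ((D / 2 + 2 * \<eta>) ^ N) * v" .
  qed
  also have "\<dots> = ennreal (real k * (D / 2 + 2 * \<eta>) ^ N) * v"
    using \<eta> \<open>0 \<le> D\<close> by (simp add: ennreal_mult ennreal_of_nat_eq_real_of_nat mult.assoc)
  finally have W_le: "emeasure M W \<le> ennreal (real k * (D / 2 + 2 * \<eta>) ^ N) * v" .
  \<comment> \<open>One factor 1 - \<eta> of the power is enough: the shell keeps at least the
    fraction \<eta> of the unit ball, which is the left-hand side of the claim.\<close>
  have inner: "emeasure M (l2_ball I (1 - \<eta>)) \<le> ennreal (1 - \<eta>) * v"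
  proof -
    have "emeasure M (l2_ball I (1 - \<eta>)) = ennreal ((1 - \<eta>) ^ N) * v"
      unfolding M_def N_def v_def using \<eta> by (intro emeasure_l2_ball_scale[OF I(1)]) auto
    also have "(1 - \<eta>) ^ N \<le> (1 - \<eta>) ^ 1" using \<eta> N by (intro power_decreasing) auto
    finally show ?thesis by (simp add: mult_right_mono ennreal_leI)
  qed
  have "v \<le> emeasure M (W \<union> l2_ball I (1 - \<eta>))"
    unfolding v_def by (intro emeasure_mono) (auto simp: W_def M_def)
  also have "\<dots> \<le> emeasure M W + emeasure M (l2_ball I (1 - \<eta>))"
    by (intro emeasure_subadditive) (auto simp: M_def[symmetric], simp add: M_def)
  also have "\<dots> \<le> ennreal (real k * (D / 2 + 2 * \<eta>) ^ N) * v + ennreal (1 - \<eta>) * v"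
    using W_le inner by (rule add_mono)
  finally have v_le: "v \<le> ennreal (real k * (D / 2 + 2 * \<eta>) ^ N + (1 - \<eta>)) * v"
    using \<eta> \<open>0 \<le> D\<close> by (simp add: distrib_right)
  define X where "X = real k * (D / 2 + 2 * \<eta>) ^ N + (1 - \<eta>)"
  have "X \<ge> 0" using \<eta> \<open>0 \<le> D\<close> by (simp add: X_def)
  obtain v' where v': "v = ennreal v'" "v' > 0"
    using v by (cases v) auto
  have "ennreal v' \<le> ennreal (X * v')"
    using v_le v' \<open>X \<ge> 0\<close> by (simp add: ennreal_mult flip: X_def)
  then have "v' \<le> X * v'" using v' \<open>X \<ge> 0\<close> by (subst (asm) ennreal_le_iff) auto
  then have "v' \<le> (real k * (D / 2 + 2 * \<eta>) ^ N + (1 - \<eta>)) * v'" by (simp add: X_def)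
  then have "1 \<le> real k * (D / 2 + 2 * \<eta>) ^ N + (1 - \<eta>)"
    using v'(2) by (simp add: mult_le_cancel_right1 mult_le_cancel_right2)
  then show ?thesis by (simp add: N_def)
qed

section \<open>Coverings of spheres by balls\<close>

lemma L2_set_power2: "(L2_set x I)\<^sup>2 = (\<Sum>i\<in>I. (x i)\<^sup>2)"
  by (simp add: L2_set_def sum_nonneg)

lemma L2_set_add_scaled_power2:
  "(L2_set (\<lambda>i. x i + s * p i) I)\<^sup>2 = (L2_set x I)\<^sup>2 + 2 * s * (\<Sum>i\<in>I. x i * p i) + s\<^sup>2 * (L2_set p I)\<^sup>2"
  unfolding L2_set_power2
  by (simp add: power2_eq_square algebra_simps sum.distrib sum_distrib_left)

text \<open>Completing the square shows that the cap lies in the ball of radius sqrt (\<rho>^2 -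
  \<tau>^2) about \<tau> p; this is exponentially smaller than the ball of radius \<rho>.\<close>

lemma emeasure_ball_cap_le:
  assumes I: "finite I" and p: "L2_set p I = 1" and "0 < \<tau>" "\<tau> < \<rho>"
  shows "vol I {x \<in> l2_ball I \<rho>. \<tau> \<le> (\<Sum>i\<in>I. x i * p i)}
    \<le> ennreal (sqrt (\<rho>\<^sup>2 - \<tau>\<^sup>2) ^ card I) * vol I (l2_ball I 1)"
proof -
  have "{x \<in> l2_ball I \<rho>. \<tau> \<le> (\<Sum>i\<in>I. x i * p i)}
      \<subseteq> {x \<in> space (lebesgue_PiM I). L2_set (\<lambda>i. x i - \<tau> * p i) I \<le> sqrt (\<rho>\<^sup>2 - \<tau>\<^sup>2)}"
  proof (intro subsetI CollectI conjI)
    fix x assume x: "x \<in> {x \<in> l2_ball I \<rho>. \<tau> \<le> (\<Sum>i\<in>I. x i * p i)}"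
    then show "x \<in> space (lebesgue_PiM I)" by (simp add: l2_ball_def)
    have "(L2_set (\<lambda>i. x i - \<tau> * p i) I)\<^sup>2 = (L2_set x I)\<^sup>2 - 2 * \<tau> * (\<Sum>i\<in>I. x i * p i) + \<tau>\<^sup>2"
      using L2_set_add_scaled_power2[of x "-\<tau>" p I] p by simp
    moreover have "(L2_set x I)\<^sup>2 \<le> \<rho>\<^sup>2" using x by (intro power_mono) (auto simp: l2_ball_def)
    moreover have "\<tau> * \<tau> \<le> \<tau> * (\<Sum>i\<in>I. x i * p i)" using x \<open>0 < \<tau>\<close> by (intro mult_left_mono) auto
    ultimately have "(L2_set (\<lambda>i. x i - \<tau> * p i) I)\<^sup>2 \<le> \<rho>\<^sup>2 - \<tau>\<^sup>2" by (simp add: power2_eq_square)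
    then show "L2_set (\<lambda>i. x i - \<tau> * p i) I \<le> sqrt (\<rho>\<^sup>2 - \<tau>\<^sup>2)" by (rule real_le_rsqrt)
  qed
  then have "vol I {x \<in> l2_ball I \<rho>. \<tau> \<le> (\<Sum>i\<in>I. x i * p i)}
      \<le> vol I {x \<in> space (lebesgue_PiM I). L2_set (\<lambda>i. x i - \<tau> * p i) I \<le> sqrt (\<rho>\<^sup>2 - \<tau>\<^sup>2)}"
    by (intro emeasure_mono) (simp_all add: L2_set_def)
  also have "\<dots> = vol I (l2_ball I (sqrt (\<rho>\<^sup>2 - \<tau>\<^sup>2)))"
    by (rule emeasure_l2_ball_translate[OF I])
  also have "\<dots> = ennreal (sqrt (\<rho>\<^sup>2 - \<tau>\<^sup>2) ^ card I) * vol I (l2_ball I 1)"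
  proof (rule emeasure_l2_ball_scale[OF I])
    have "\<tau>\<^sup>2 < \<rho>\<^sup>2" using assms(3,4) by (intro power_strict_mono) auto
    then show "sqrt (\<rho>\<^sup>2 - \<tau>\<^sup>2) > 0" by simp
  qed
  finally show ?thesis .
qed

text \<open>With \<open>a\<^sup>2 + b\<^sup>2 = 1\<close>, the sphere of radius \<open>b\<close> about the origin and the sphere of radius \<open>a\<close>
  about a unit vector \<open>p\<close> meet orthogonally, along a sphere of radius \<open>a b\<close> about \<open>b\<^sup>2 p\<close>. After a
  slight dilation, the lens between them contains a slab of the ball with that centre and radius,
  and in high dimension the slab fills half of the ball.\<close>

lemma emeasure_lens_ge:
  assumes I: "finite I" and p: "L2_set p I = 1" and ab: "0 < a" "0 < b" "a\<^sup>2 + b\<^sup>2 = 1"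
    and \<tau>: "0 < \<tau>" "\<tau> < a * b"
    and conc: "4 * sqrt ((a * b)\<^sup>2 - \<tau>\<^sup>2) ^ card I \<le> (a * b) ^ card I"
  shows "ennreal ((a * b) ^ card I / 2) * vol I (l2_ball I 1)
    \<le> vol I {x \<in> l2_ball I (b * sqrt (1 + 2 * \<tau>)). l2_dist I x p \<le> a * sqrt (1 + 2 * \<tau>)}"
proof -
  define M where "M = lebesgue_PiM I"
  define v where "v = emeasure M (l2_ball I 1)"
  define A where "A = (\<lambda>p. {x \<in> l2_ball I (a * b). \<tau> \<le> (\<Sum>i\<in>I. x i * p i)})"
  have A_sets[measurable]: "A p \<in> sets M" for p
  proof -
    have "A p = l2_ball I (a * b) \<inter> {x \<in> space M. \<tau> \<le> (\<Sum>i\<in>I. x i * p i)}"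
      by (auto simp: A_def l2_ball_def M_def)
    also have "\<dots> \<in> sets M" unfolding M_def by measurable
    finally show ?thesis .
  qed
  have A_le: "emeasure M (A p) \<le> ennreal ((a * b) ^ card I / 4) * v" if "L2_set p I = 1" for p
  proof -
    have "emeasure M (A p) \<le> ennreal (sqrt ((a * b)\<^sup>2 - \<tau>\<^sup>2) ^ card I) * v"
      unfolding A_def M_def v_def using \<tau> by (intro emeasure_ball_cap_le I that)
    also have "\<dots> \<le> ennreal ((a * b) ^ card I / 4) * v"
      using conc by (intro mult_right_mono ennreal_leI) auto
    finally show ?thesis .
  qed
  \<comment> \<open>The slab: two opposite caps are removed, each at most a quarter of the ball by
    \<open>conc\<close>, so half of the ball is left.\<close>
  define G where "G = l2_ball I (a * b) - (A p \<union> A (\<lambda>i. - p i))"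
  have G_sets[measurable]: "G \<in> sets M"
  proof -
    have "l2_ball I (a * b) \<in> sets M" by (simp add: M_def)
    then show ?thesis unfolding G_def by measurable
  qed
  have p': "L2_set (\<lambda>i. - p i) I = 1" using p by (simp add: L2_set_def)
  have "ennreal ((a * b) ^ card I) * v = emeasure M (l2_ball I (a * b))"
    unfolding M_def v_def using ab by (subst (2) emeasure_l2_ball_scale[OF I]) auto
  also have "\<dots> \<le> emeasure M (G \<union> (A p \<union> A (\<lambda>i. - p i)))"
    by (intro emeasure_mono sets.Un G_sets A_sets) (auto simp: G_def)
  also have "\<dots> \<le> emeasure M G + emeasure M (A p \<union> A (\<lambda>i. - p i))"
    by (intro emeasure_subadditive) auto
  also have "\<dots> \<le> emeasure M G + (emeasure M (A p) + emeasure M (A (\<lambda>i. - p i)))"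
    by (intro add_mono emeasure_subadditive order_refl) auto
  also have "\<dots> \<le> emeasure M G + (ennreal ((a * b) ^ card I / 4) * v + ennreal ((a * b) ^ card I / 4) * v)"
    by (intro add_mono A_le p p' order_refl)
  also have "ennreal ((a * b) ^ card I / 4) * v + ennreal ((a * b) ^ card I / 4) * v = ennreal ((a * b) ^ card I / 2) * v"
    using ab by (simp flip: distrib_right ennreal_plus)
  finally have le: "ennreal ((a * b) ^ card I) * v \<le> emeasure M G + ennreal ((a * b) ^ card I / 2) * v" .
  have "ennreal ((a * b) ^ card I) * v = ennreal ((a * b) ^ card I / 2) * v + ennreal ((a * b) ^ card I / 2) * v"
    using ab by (simp flip: distrib_right ennreal_plus)
  moreover have "ennreal ((a * b) ^ card I / 2) * v < top"
    using emeasure_l2_ball_finite[OF I] by (auto simp: v_def M_def ennreal_mult_less_top)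
  moreover have "x \<le> y" if "z \<le> y + x" "z = x + x" "x < top" for x y z :: ennreal
    using that ennreal_add_left_cancel_le[of x x y] by (auto simp: add.commute)
  ultimately have "ennreal ((a * b) ^ card I / 2) * v \<le> emeasure M G"
    using le by blast
  \<comment> \<open>The slab is moved from the origin to its place in the lens, with centre b^2
    p.\<close>
  also have "emeasure M G = emeasure M {x \<in> space M. (\<lambda>i\<in>I. - (b\<^sup>2 * p i) + 1 * x i) \<in> G}"
    unfolding M_def using emeasure_PiM_affine[OF I G_sets[unfolded M_def], of 1 "\<lambda>i. - (b\<^sup>2 * p i)"] by simp
  also have "\<dots> \<le> emeasure M {x \<in> l2_ball I (b * sqrt (1 + 2 * \<tau>)). l2_dist I x p \<le> a * sqrt (1 + 2 * \<tau>)}"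
  proof (rule emeasure_mono)
    show "{x \<in> l2_ball I (b * sqrt (1 + 2 * \<tau>)). l2_dist I x p \<le> a * sqrt (1 + 2 * \<tau>)} \<in> sets M"
    proof -
      have "{x \<in> l2_ball I (b * sqrt (1 + 2 * \<tau>)). l2_dist I x p \<le> a * sqrt (1 + 2 * \<tau>)}
        = l2_ball I (b * sqrt (1 + 2 * \<tau>)) \<inter> {x \<in> space M. l2_dist I x p \<le> a * sqrt (1 + 2 * \<tau>)}"
        by (auto simp: l2_ball_def M_def)
      also have "\<dots> \<in> sets M" unfolding M_def L2_set_def by measurable
      finally show ?thesis .
    qed
    show "{x \<in> space M. (\<lambda>i\<in>I. - (b\<^sup>2 * p i) + 1 * x i) \<in> G}
      \<subseteq> {x \<in> l2_ball I (b * sqrt (1 + 2 * \<tau>)). l2_dist I x p \<le> a * sqrt (1 + 2 * \<tau>)}"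
    proof
      fix x assume x: "x \<in> {x \<in> space M. (\<lambda>i\<in>I. - (b\<^sup>2 * p i) + 1 * x i) \<in> G}"
      define w where "w = (\<lambda>i\<in>I. - (b\<^sup>2 * p i) + 1 * x i)"
      have w: "w \<in> G" using x by (simp add: w_def)
      then have "L2_set w I \<le> a * b" by (simp add: G_def l2_ball_def)
      then have w1: "(L2_set w I)\<^sup>2 \<le> (a * b)\<^sup>2" by (intro power_mono) auto
      have "w \<notin> A p" "w \<notin> A (\<lambda>i. - p i)" "w \<in> l2_ball I (a * b)" using w by (auto simp: G_def)
      then have w2: "(\<Sum>i\<in>I. w i * p i) \<le> \<tau>" "- \<tau> \<le> (\<Sum>i\<in>I. w i * p i)"
        by (auto simp: A_def sum_negf)
      have "L2_set x I = L2_set (\<lambda>i. w i + b\<^sup>2 * p i) I" by (rule L2_set_cong) (auto simp: w_def)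
      then have "(L2_set x I)\<^sup>2 = (L2_set w I)\<^sup>2 + 2 * b\<^sup>2 * (\<Sum>i\<in>I. w i * p i) + (b\<^sup>2)\<^sup>2"
        using L2_set_add_scaled_power2[of w "b\<^sup>2" p I] p by simp
      also have "\<dots> \<le> (a * b)\<^sup>2 + 2 * b\<^sup>2 * \<tau> + (b\<^sup>2)\<^sup>2"
        using w1 w2 ab by (intro add_mono mult_left_mono) auto
      also have "\<dots> = b\<^sup>2 * (a\<^sup>2 + b\<^sup>2) + 2 * b\<^sup>2 * \<tau>" by (simp add: power2_eq_square algebra_simps)
      also have "\<dots> = b\<^sup>2 * (1 + 2 * \<tau>)" unfolding ab(3) by (simp add: algebra_simps)
      also have "\<dots> = (b * sqrt (1 + 2 * \<tau>))\<^sup>2" using \<tau> by (simp add: power_mult_distrib)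
      finally have c1: "L2_set x I \<le> b * sqrt (1 + 2 * \<tau>)" using ab \<tau> by (intro power2_le_imp_le[of "L2_set x I"]) auto
      \<comment> \<open>Seen from p the centre of the slab is - a^2 p, since b^2 - 1 = - a^2. The
        estimate above is repeated with a and b exchanged and the sign of the inner product
        reversed.\<close>
      have "x i - p i = w i + (- a\<^sup>2) * p i" if "i \<in> I" for i
      proof -
        have "a\<^sup>2 = 1 - b\<^sup>2" using ab(3) by simp
        then show ?thesis unfolding \<open>a\<^sup>2 = 1 - b\<^sup>2\<close> using that by (simp add: w_def algebra_simps)
      qed
      then have "l2_dist I x p = L2_set (\<lambda>i. w i + (- a\<^sup>2) * p i) I" by (rule L2_set_cong[OF refl])
      then have "(l2_dist I x p)\<^sup>2 = (L2_set w I)\<^sup>2 + 2 * a\<^sup>2 * (- (\<Sum>i\<in>I. w i * p i)) + (a\<^sup>2)\<^sup>2"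
        using L2_set_add_scaled_power2[of w "-a\<^sup>2" p I] p by simp
      also have "\<dots> \<le> (a * b)\<^sup>2 + 2 * a\<^sup>2 * \<tau> + (a\<^sup>2)\<^sup>2"
        using w1 w2 ab by (intro add_mono mult_left_mono) auto
      also have "\<dots> = a\<^sup>2 * (a\<^sup>2 + b\<^sup>2) + 2 * a\<^sup>2 * \<tau>" by (simp add: power2_eq_square algebra_simps)
      also have "\<dots> = a\<^sup>2 * (1 + 2 * \<tau>)" unfolding ab(3) by (simp add: algebra_simps)
      also have "\<dots> = (a * sqrt (1 + 2 * \<tau>))\<^sup>2" using \<tau> by (simp add: power_mult_distrib)
      finally have c2: "l2_dist I x p \<le> a * sqrt (1 + 2 * \<tau>)"
        using ab \<tau> by (intro power2_le_imp_le[of "l2_dist I x p"]) auto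
      show "x \<in> {x \<in> l2_ball I (b * sqrt (1 + 2 * \<tau>)). l2_dist I x p \<le> a * sqrt (1 + 2 * \<tau>)}"
        using x c1 c2 by (auto simp: l2_ball_def M_def)
    qed
  qed
  finally show ?thesis unfolding v_def M_def .
qed

text \<open>Averaging: the number of sets that contain a given point has integral at least q * card
  P times the measure of B, so its maximum over B is at least q * card P.\<close>

lemma exists_point_in_many_sets:
  assumes "finite P" and B: "B \<in> sets M" "0 < emeasure M B" "emeasure M B < \<infinity>"
    and S: "\<And>p. p \<in> P \<Longrightarrow> S p \<in> sets M" "\<And>p. p \<in> P \<Longrightarrow> S p \<subseteq> B"
    and q: "0 \<le> q" "\<And>p. p \<in> P \<Longrightarrow> ennreal q * emeasure M B \<le> emeasure M (S p)"
  shows "\<exists>c\<in>B. q * real (card P) \<le> real (card {p \<in> P. c \<in> S p})"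
proof -
  define cnt where "cnt = (\<lambda>c. card {p \<in> P. c \<in> S p})"
  have "B \<noteq> {}" using B by auto
  have cnt_le: "cnt c \<le> card P" for c unfolding cnt_def using assms(1) by (intro card_mono) auto
  have fin: "finite (cnt ` B)" by (rule finite_subset[of _ "{..card P}"]) (use cnt_le in auto)
  have "Max (cnt ` B) \<in> cnt ` B" using Max_in[OF fin] \<open>B \<noteq> {}\<close> by simp
  then obtain c where c: "c \<in> B" "cnt c = Max (cnt ` B)" by (metis imageE)
  have max: "cnt x \<le> cnt c" if "x \<in> B" for x using c Max_ge[OF fin] that by auto
  have "ennreal (q * real (card P)) * emeasure M B = (\<Sum>p\<in>P. ennreal q * emeasure M B)"
    using q(1) by (simp add: ennreal_mult ennreal_of_nat_eq_real_of_nat mult_ac)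
  also have "\<dots> \<le> (\<Sum>p\<in>P. emeasure M (S p))" using q by (intro sum_mono)
  also have "\<dots> = (\<integral>\<^sup>+x. (\<Sum>p\<in>P. indicator (S p) x) \<partial>M)"
    using S by (subst nn_integral_sum) auto
  also have "\<dots> \<le> (\<integral>\<^sup>+x. ennreal (real (cnt c)) * indicator B x \<partial>M)"
  proof (rule nn_integral_mono)
    fix x
    show "(\<Sum>p\<in>P. indicator (S p) x) \<le> ennreal (real (cnt c)) * indicator B x"
    proof (cases "x \<in> B")
      case True
      have "(\<Sum>p\<in>P. indicator (S p) x :: ennreal) = of_nat (cnt x)"
        unfolding cnt_def using assms(1) by (simp add: indicator_def sum.If_cases Int_def)
      also have "\<dots> \<le> of_nat (cnt c)" using max[OF True] by (rule of_nat_mono)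
      finally show ?thesis using True by (simp add: ennreal_of_nat_eq_real_of_nat)
    next
      case False
      then have "\<And>p. p \<in> P \<Longrightarrow> x \<notin> S p" using S by auto
      then show ?thesis by (simp add: indicator_def)
    qed
  qed
  also have "\<dots> = ennreal (real (cnt c)) * emeasure M B" using B by (simp add: nn_integral_cmult_indicator)
  finally have le: "ennreal (q * real (card P)) * emeasure M B \<le> ennreal (real (cnt c)) * emeasure M B" .
  obtain b where b: "emeasure M B = ennreal b" "b > 0" using B by (cases "emeasure M B") auto
  have "ennreal (q * real (card P) * b) \<le> ennreal (real (cnt c) * b)"
    using le b q(1) by (simp add: ennreal_mult)
  then have "q * real (card P) * b \<le> real (cnt c) * b" using b by (subst (asm) ennreal_le_iff) auto
  then have "q * real (card P) \<le> real (cnt c)" using b(2) by simp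
  then show ?thesis using c(1) unfolding cnt_def by blast
qed

text \<open>Each new point is chosen to hit at least the share q of the sets that are still missed,
  so after k points at most (1 - q)^k * card P sets are missed.\<close>

lemma greedy_hitting_set:
  assumes "finite P" and B: "B \<in> sets M" "0 < emeasure M B" "emeasure M B < \<infinity>"
    and S: "\<And>p. p \<in> P \<Longrightarrow> S p \<in> sets M" "\<And>p. p \<in> P \<Longrightarrow> S p \<subseteq> B"
    and q: "0 < q" "q \<le> 1" "\<And>p. p \<in> P \<Longrightarrow> ennreal q * emeasure M B \<le> emeasure M (S p)"
  obtains C where "finite C" "\<And>p. p \<in> P \<Longrightarrow> \<exists>c\<in>C. c \<in> S p" "real (card C) \<le> ln (real (card P) + 1) / q + 1"
proof -
  have *: "\<exists>C. finite C \<and> card C \<le> k \<and> real (card {p \<in> P. \<forall>c\<in>C. c \<notin> S p}) \<le> (1 - q) ^ k * real (card P)" for k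
  proof (induction k)
    case 0
    show ?case by (intro exI[of _ "{}"]) simp
  next
    case (Suc k)
    then obtain C where C: "finite C" "card C \<le> k" "real (card {p \<in> P. \<forall>c\<in>C. c \<notin> S p}) \<le> (1 - q) ^ k * real (card P)" by blast
    define Q where "Q = {p \<in> P. \<forall>c\<in>C. c \<notin> S p}"
    have Q: "finite Q" "Q \<subseteq> P" using assms(1) by (auto simp: Q_def)
    have "\<exists>c\<in>B. q * real (card Q) \<le> real (card {p \<in> Q. c \<in> S p})"
      by (rule exists_point_in_many_sets[OF Q(1) B]) (use Q S q in \<open>auto dest: subsetD\<close>)
    then obtain c where c: "q * real (card Q) \<le> real (card {p \<in> Q. c \<in> S p})" by blast
    have "{p \<in> P. \<forall>c\<in>insert c C. c \<notin> S p} = Q - {p \<in> Q. c \<in> S p}" by (auto simp: Q_def)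
    then have "real (card {p \<in> P. \<forall>c\<in>insert c C. c \<notin> S p}) = real (card Q) - real (card {p \<in> Q. c \<in> S p})"
      using Q by (simp add: card_Diff_subset of_nat_diff card_mono)
    also have "\<dots> \<le> (1 - q) * real (card Q)" using c by (simp add: algebra_simps)
    also have "\<dots> \<le> (1 - q) * ((1 - q) ^ k * real (card P))"
      using C(3) q by (intro mult_left_mono) (auto simp: Q_def)
    finally have "real (card {p \<in> P. \<forall>c\<in>insert c C. c \<notin> S p}) \<le> (1 - q) ^ Suc k * real (card P)" by (simp add: mult.assoc)
    moreover have "card (insert c C) \<le> Suc k" using C by (simp add: card_insert_if)
    ultimately show ?case using C(1) by (intro exI[of _ "insert c C"]) auto
  qed
  \<comment> \<open>At most exp (- q k) * card P sets are missed after k points; the summand 1 in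
    the logarithm brings this strictly below one.\<close>
  define k where "k = nat \<lceil>ln (real (card P) + 1) / q\<rceil>"
  have lnk: "0 \<le> ln (real (card P) + 1) / q" using q by simp
  have k: "ln (real (card P) + 1) / q \<le> real k" "real k \<le> ln (real (card P) + 1) / q + 1"
    using lnk unfolding k_def by linarith+
  obtain C where C: "finite C" "card C \<le> k" "real (card {p \<in> P. \<forall>c\<in>C. c \<notin> S p}) \<le> (1 - q) ^ k * real (card P)"
    using * by blast
  have "(1 - q) ^ k \<le> exp (- q) ^ k" using q exp_ge_add_one_self[of "-q"] by (intro power_mono) auto
  also have "\<dots> = exp (- (q * real k))" by (simp add: exp_of_nat_mult[symmetric] mult.commute)
  also have "\<dots> \<le> exp (- ln (real (card P) + 1))"
    using k(1) q by (simp add: pos_divide_le_eq mult.commute)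
  also have "\<dots> = 1 / (real (card P) + 1)" by (simp add: exp_minus inverse_eq_divide)
  finally have "(1 - q) ^ k * real (card P) \<le> 1 / (real (card P) + 1) * real (card P)" by (rule mult_right_mono) simp
  also have "\<dots> < 1" by (simp add: divide_simps)
  finally have "card {p \<in> P. \<forall>c\<in>C. c \<notin> S p} = 0" using C(3) by linarith
  then have "{p \<in> P. \<forall>c\<in>C. c \<notin> S p} = {}" using assms(1) by simp
  then show ?thesis using that[of C] C k(2) by fastforce
qed

text \<open>One point of the sphere is taken from each grid cell that meets it. The crude
  cardinality does no harm, because only its logarithm enters the covering bound.\<close>

lemma sphere_net:
  assumes I: "finite I" "I \<noteq> {}" and \<eta>: "0 < \<eta>"
  obtains P where "finite P" "\<And>p. p \<in> P \<Longrightarrow> L2_set p I = 1"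
    "real (card P) \<le> (2 * real (card I) / \<eta> + 3) ^ card I"
    "\<And>x. L2_set x I = 1 \<Longrightarrow> \<exists>p\<in>P. l2_dist I x p \<le> \<eta>"
proof -
  define N where "N = card I"
  have N: "N \<ge> 1" using I by (simp add: N_def Suc_le_eq card_gt_0_iff)
  define \<delta> where "\<delta> = \<eta> / N"
  have \<delta>: "\<delta> > 0" "real N * \<delta> = \<eta>" using \<eta> N by (auto simp: \<delta>_def)
  define S where "S = {x. L2_set x I = 1}"
  define Z where "Z = grid_cell I \<delta> ` S"
  define m where "m = \<lceil>1 / \<delta>\<rceil>"
  have m0: "m \<ge> 0" using \<delta>(1) by (simp add: m_def le_ceiling_iff) (smt (verit) divide_nonneg_nonneg)
  have sub: "Z \<subseteq> Pi\<^sub>E I (\<lambda>_. {- m..m})"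
  proof
    fix z assume "z \<in> Z"
    then obtain x where x: "L2_set x I = 1" "z = grid_cell I \<delta> x" by (auto simp: Z_def S_def)
    have "\<lfloor>x i / \<delta>\<rfloor> \<in> {- m..m}" if "i \<in> I" for i
    proof -
      have "\<bar>x i\<bar> \<le> 1" using member_le_L2_set[OF I(1) that, of "\<lambda>i. \<bar>x i\<bar>"] x(1) by (simp add: L2_set_def)
      then have "\<bar>x i / \<delta>\<bar> \<le> 1 / \<delta>" using \<delta>(1) by (simp add: abs_divide divide_right_mono)
      then show ?thesis unfolding m_def atLeastAtMost_iff by linarith
    qed
    then show "z \<in> Pi\<^sub>E I (\<lambda>_. {- m..m})" by (auto simp: x(2) grid_cell_def)
  qed
  have finbox: "finite (Pi\<^sub>E I (\<lambda>_. {- m..m}))" using I(1) by (intro finite_PiE) auto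
  have finZ: "finite Z" using finite_subset[OF sub finbox] .
  have "card Z \<le> card (Pi\<^sub>E I (\<lambda>_. {- m..m}))" using sub finbox by (intro card_mono)
  also have "\<dots> = nat (2 * m + 1) ^ N" using I(1) by (simp add: card_PiE N_def)
  finally have "real (card Z) \<le> real (nat (2 * m + 1) ^ N)" by (rule of_nat_mono)
  also have "\<dots> = real_of_int (2 * m + 1) ^ N" using m0 by simp
  also have "\<dots> \<le> (2 * real N / \<eta> + 3) ^ N"
  proof (rule power_mono)
    have "real_of_int m \<le> 1 / \<delta> + 1" unfolding m_def by linarith
    then show "real_of_int (2 * m + 1) \<le> 2 * real N / \<eta> + 3" by (simp add: \<delta>_def)
  qed (use m0 in auto)
  finally have cardZ: "real (card Z) \<le> (2 * real N / \<eta> + 3) ^ N" .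
  define R where "R = (\<lambda>z. SOME x. x \<in> S \<and> grid_cell I \<delta> x = z)"
  have R: "R z \<in> S" "grid_cell I \<delta> (R z) = z" if "z \<in> Z" for z
    using someI_ex[of "\<lambda>x. x \<in> S \<and> grid_cell I \<delta> x = z"] that by (auto simp: R_def Z_def)
  show thesis
  proof (rule that[of "R ` Z"])
    show "finite (R ` Z)" using finZ by simp
    show "L2_set p I = 1" if "p \<in> R ` Z" for p using that R by (auto simp: S_def)
    have "real (card (R ` Z)) \<le> real (card Z)" using card_image_le[OF finZ] by simp
    then show "real (card (R ` Z)) \<le> (2 * real (card I) / \<eta> + 3) ^ card I" using cardZ by (simp add: N_def)
    fix x assume "L2_set x I = 1"
    then have z: "grid_cell I \<delta> x \<in> Z" by (auto simp: Z_def S_def)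
    have "L2_set (\<lambda>i. x i - R (grid_cell I \<delta> x) i) I \<le> \<eta>"
      using grid_cell_eq_imp_close[OF I(1) \<delta>(1) R(2)[OF z, symmetric]] \<delta>(2) by (simp add: N_def)
    then show "\<exists>p\<in>R ` Z. l2_dist I x p \<le> \<eta>" using z by blast
  qed
qed

text \<open>A centre c serves a net point p when it lies in the lens of p inside the ball
  \<open>B\<close>. Each lens fills at least the share \<beta>^N / 2 of \<open>B\<close>, so the
  greedy choice needs about ln (card P) / \<beta>^N centres, and ln (card P) is at most quadratic in
  N. The gap between \<beta> and \<sigma> pays for the dilation of the lens and for the mesh of the
  net.\<close>

proposition sphere_covering:
  fixes \<beta> \<sigma> :: real
  assumes \<beta>: "0 < \<beta>" "\<beta> < \<sigma>" "\<sigma> < 1"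
  obtains A :: real and N0 :: nat where "A > 0"
    "\<And>I :: 'i set. finite I \<Longrightarrow> N0 \<le> card I \<Longrightarrow> \<exists>C. finite C \<and>
      real (card C) \<le> A * (real (card I))\<^sup>2 / \<beta> ^ card I \<and>
      (\<forall>x. L2_set x I = 1 \<longrightarrow> (\<exists>c\<in>C. l2_dist I x c < \<sigma>))"
proof -
  \<comment> \<open>The first bound gives \<beta> * s^2 < \<sigma> for the dilation factor s below,
    the second gives \<tau> < a * b.\<close>
  define \<tau> where "\<tau> = min ((\<sigma> / \<beta> - 1) / 4) (\<beta> * sqrt (1 - \<sigma>\<^sup>2) / 2)"
  have \<sigma>2: "\<sigma>\<^sup>2 < 1" using \<beta> by (simp add: power_less_one_iff)
  have \<tau>0: "\<tau> > 0" using \<beta> \<sigma>2 by (simp add: \<tau>_def)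
  define s where "s = sqrt (1 + 2 * \<tau>)"
  have s: "s > 1" "s\<^sup>2 = 1 + 2 * \<tau>" using \<tau>0 by (auto simp: s_def)
  have "\<tau> \<le> (\<sigma> / \<beta> - 1) / 4" unfolding \<tau>_def by (rule min.cobounded1)
  also have "(\<sigma> / \<beta> - 1) / 4 < (\<sigma> / \<beta> - 1) / 2"
    by (rule divide_strict_left_mono) (use \<beta> in auto)
  finally have "\<tau> < (\<sigma> / \<beta> - 1) / 2" .
  then have "\<beta> * (1 + 2 * \<tau>) < \<sigma>" using \<beta> by (simp add: field_simps)
  then have \<beta>s: "\<beta> * s\<^sup>2 < \<sigma>" by (simp add: s)
  \<comment> \<open>Chosen so that the slab, of volume proportional to (a b)^N / 2, is exactly the
    share \<beta>^N / 2 of the ball of radius b s.\<close>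
  define a where "a = \<beta> * s"
  have "a \<le> \<beta> * s\<^sup>2" unfolding a_def power2_eq_square using \<beta> s by (intro mult_left_mono) auto
  then have "a < \<sigma>" using \<beta>s by (rule le_less_trans)
  moreover have "\<beta> < a" using \<beta> s by (simp add: a_def)
  ultimately have a: "\<beta> < a" "a < \<sigma>" by simp_all
  have a2: "a\<^sup>2 < \<sigma>\<^sup>2" using a \<beta> by (intro power_strict_mono) auto
  define b where "b = sqrt (1 - a\<^sup>2)"
  have b: "b > sqrt (1 - \<sigma>\<^sup>2)" "b > 0" "a\<^sup>2 + b\<^sup>2 = 1" using a2 \<sigma>2 by (auto simp: b_def)
  have "\<tau> < \<beta> * sqrt (1 - \<sigma>\<^sup>2)" using \<beta> \<sigma>2 by (simp add: \<tau>_def min_less_iff_disj)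
  also have "\<dots> \<le> a * b" using a b \<beta> \<sigma>2 by (intro mult_mono) auto
  finally have \<tau>ab: "\<tau> < a * b" .
  have ab0: "a * b > 0" using a b \<beta> by simp
  define \<rho>' where "\<rho>' = sqrt ((a * b)\<^sup>2 - \<tau>\<^sup>2)"
  have "\<tau>\<^sup>2 < (a * b)\<^sup>2" using \<tau>ab \<tau>0 by (intro power_strict_mono) auto
  then have \<rho>': "0 \<le> \<rho>'" "\<rho>' < a * b"
  proof -
    show "0 \<le> \<rho>'" using \<open>\<tau>\<^sup>2 < (a * b)\<^sup>2\<close> by (simp add: \<rho>'_def)
    have "\<rho>' < sqrt ((a * b)\<^sup>2)" unfolding \<rho>'_def using \<tau>0 by (intro real_sqrt_less_mono) simp
    then show "\<rho>' < a * b" using ab0 by simp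
  qed
  \<comment> \<open>Half of the room between the dilated radius a * s = \<beta> * s^2 and \<sigma>
    is given to the mesh of the net.\<close>
  define \<eta> where "\<eta> = (\<sigma> - \<beta> * s\<^sup>2) / 2"
  have \<eta>: "\<eta> > 0" "a * s + \<eta> < \<sigma>" using \<beta>s by (auto simp: \<eta>_def a_def power2_eq_square field_simps)
  have "(\<lambda>N. (\<rho>' / (a * b)) ^ N) \<longlonglongrightarrow> 0" using \<rho>' ab0 by (intro LIMSEQ_realpow_zero) auto
  then have "\<forall>\<^sub>F N in sequentially. (\<rho>' / (a * b)) ^ N < 1 / 4" by (rule order_tendstoD) simp
  then obtain N1 where N1: "\<And>N. N \<ge> N1 \<Longrightarrow> (\<rho>' / (a * b)) ^ N < 1 / 4" by (auto simp: eventually_sequentially)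
  \<comment> \<open>The factor 2 comes from the share \<beta>^N / 2, the bracket from the logarithm
    of the size of the net, the summand 1 from rounding up.\<close>
  define A where "A = 2 * (2 / \<eta> + 4) + 1"
  have "A > 0" using \<eta> by (simp add: A_def add_pos_pos)
  show thesis
  proof (rule that[of A "max N1 1"])
    show "A > 0" by fact
    fix I :: "'i set" assume I: "finite I" "max N1 1 \<le> card I"
    define N where "N = card I"
    have N: "N \<ge> 1" "N \<ge> N1" using I by (auto simp: N_def)
    have "I \<noteq> {}" using I(2) by auto
    obtain P where P: "finite P" "\<And>p. p \<in> P \<Longrightarrow> L2_set p I = 1"
      "real (card P) \<le> (2 * real N / \<eta> + 3) ^ N"
      "\<And>x. L2_set x I = 1 \<Longrightarrow> \<exists>p\<in>P. l2_dist I x p \<le> \<eta>"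
      using sphere_net[OF I(1) \<open>I \<noteq> {}\<close> \<eta>(1)] unfolding N_def by metis
    define M where "M = lebesgue_PiM I"
    define B where "B = l2_ball I (b * s)"
    define S where "S = (\<lambda>p. {x \<in> B. l2_dist I x p \<le> a * s})"
    define v where "v = emeasure M (l2_ball I 1)"
    have v: "0 < v" "v < \<infinity>"
      unfolding v_def M_def using emeasure_l2_ball_pos[OF I(1)] emeasure_l2_ball_finite[OF I(1)] by auto
    define q where "q = \<beta> ^ N / 2"
    have q: "0 < q" "q \<le> 1"
      using \<beta> power_le_one[of \<beta> N] by (auto simp: q_def)
    have B_eq: "emeasure M B = ennreal ((b * s) ^ N) * v"
      unfolding B_def M_def v_def N_def using b s by (intro emeasure_l2_ball_scale[OF I(1)]) auto
    have "4 * \<rho>' ^ N \<le> (a * b) ^ N"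
    proof -
      have "\<rho>' ^ N = (\<rho>' / (a * b)) ^ N * (a * b) ^ N" using ab0 by (subst power_mult_distrib[symmetric]) auto
      also have "\<dots> \<le> 1 / 4 * (a * b) ^ N" using N1[OF N(2)] ab0 by (intro mult_right_mono) auto
      finally show ?thesis by simp
    qed
    then have lens: "ennreal ((a * b) ^ N / 2) * v \<le> emeasure M (S p)" if "p \<in> P" for p
      unfolding N_def v_def M_def S_def B_def s_def \<rho>'_def
      using a b \<beta> \<tau>0 \<tau>ab by (intro emeasure_lens_ge I P(2)[OF that]) auto
    obtain C where C: "finite C" "\<And>p. p \<in> P \<Longrightarrow> \<exists>c\<in>C. c \<in> S p" "real (card C) \<le> ln (real (card P) + 1) / q + 1"
    proof (rule greedy_hitting_set[OF P(1), of B M S q])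
      show "B \<in> sets M" by (simp add: B_def M_def)
      show "0 < emeasure M B" unfolding B_eq using b s v by (simp add: ennreal_zero_less_mult_iff)
      show "emeasure M B < \<infinity>" unfolding B_eq using v by (simp add: ennreal_mult_less_top)
      show "S p \<subseteq> B" for p by (auto simp: S_def)
      show "S p \<in> sets M" for p
      proof -
        have "S p = B \<inter> {x \<in> space M. l2_dist I x p \<le> a * s}"
          by (auto simp: S_def B_def l2_ball_def M_def)
        also have "\<dots> \<in> sets M" unfolding M_def B_def L2_set_def by measurable
        finally show ?thesis .
      qed
      show "ennreal q * emeasure M B \<le> emeasure M (S p)" if "p \<in> P" for p
      proof -
        have "ennreal q * emeasure M B = ennreal (q * (b * s) ^ N) * v"
          unfolding B_eq using q b s by (simp add: ennreal_mult mult.assoc)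
        also have "q * (b * s) ^ N = (a * b) ^ N / 2"
          by (simp add: q_def a_def power_mult_distrib mult_ac)
        finally show ?thesis using lens[OF that] by simp
      qed
    qed (use q in auto)
    define y where "y = 2 * real N / \<eta> + 3"
    have y: "y \<ge> 3" using \<eta> by (simp add: y_def)
    have yN: "1 \<le> y ^ N" using y by (intro one_le_power) auto
    have "ln (real (card P) + 1) \<le> ln ((y + 1) ^ N)"
    proof (rule ln_mono)
      have "y ^ N + 1 \<le> (y + 1) ^ N" using N(1)
      proof (induction N rule: dec_induct)
        case (step n)
        have "y ^ Suc n + 1 \<le> (y + 1) * (y ^ n + 1)" using y by (simp add: algebra_simps)
        also have "\<dots> \<le> (y + 1) * (y + 1) ^ n" using step.IH y by (intro mult_left_mono) auto
        finally show ?case by simp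
      qed simp
      then show "real (card P) + 1 \<le> (y + 1) ^ N" using P(3) by (simp add: y_def)
    qed auto
    also have "\<dots> = N * ln (y + 1)" using y by (simp add: ln_realpow)
    \<comment> \<open>Bounding the logarithm by its argument loses only a factor linear in N, which
      is harmless against the exponential.\<close>
    also have "\<dots> \<le> N * y" using ln_add_one_self_le_self[of y] y by (intro mult_left_mono) (auto simp: add.commute)
    also have "\<dots> \<le> N * ((2 / \<eta> + 4) * N)"
      using N(1) by (intro mult_left_mono) (auto simp: y_def algebra_simps)
    finally have ln_le: "ln (real (card P) + 1) \<le> (2 / \<eta> + 4) * (real N)\<^sup>2" by (simp add: power2_eq_square mult_ac)
    have b1: "1 \<le> (real N)\<^sup>2 / \<beta> ^ N"
    proof -
      have "\<beta> ^ N \<le> 1" using \<beta> by (intro power_le_one) auto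
      also have "1 \<le> (real N)\<^sup>2" using N(1) by (simp add: one_le_power)
      finally show ?thesis using \<beta> by (simp add: le_divide_eq)
    qed
    have "real (card C) \<le> (2 / \<eta> + 4) * (real N)\<^sup>2 / q + 1"
      using C(3) divide_right_mono[OF ln_le, of q] q by linarith
    also have "\<dots> = 2 * (2 / \<eta> + 4) * ((real N)\<^sup>2 / \<beta> ^ N) + 1" by (simp add: q_def)
    also have "\<dots> \<le> A * ((real N)\<^sup>2 / \<beta> ^ N)" using b1 by (simp add: A_def algebra_simps)
    finally have card_C: "real (card C) \<le> A * (real N)\<^sup>2 / \<beta> ^ N" by simp
    have "\<exists>c\<in>C. l2_dist I x c < \<sigma>" if x: "L2_set x I = 1" for x
    proof -
      obtain p where p: "p \<in> P" "l2_dist I x p \<le> \<eta>" using P(4)[OF x] by blast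
      obtain c where c: "c \<in> C" "l2_dist I c p \<le> a * s" using C(2)[OF p(1)] by (auto simp: S_def)
      have "l2_dist I x c \<le> \<eta> + a * s"
        using L2_set_dist_triangle[of x c I p] p(2) c(2) L2_set_minus_commute[of c p I] by linarith
      then show ?thesis using \<eta>(2) c(1) by (intro bexI[of _ c]) auto
    qed
    then show "\<exists>C. finite C \<and> real (card C) \<le> A * (real (card I))\<^sup>2 / \<beta> ^ card I \<and>
      (\<forall>x. L2_set x I = 1 \<longrightarrow> (\<exists>c\<in>C. l2_dist I x c < \<sigma>))"
      using C(1) card_C unfolding N_def by blast
  qed
qed

section \<open>Chromatic numbers and distances\<close>

lemma in_sphere_set_iff:
  "x \<in> sphere_set m \<longleftrightarrow> (\<Sum>i\<le>m. (x i)\<^sup>2) = 1 \<and> (\<forall>i>m. x i = 0)"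
  by (simp add: nsphere)

text \<open>The infimum is attained because \<open>enat\<close> is well-ordered; a finite bound
  excludes the empty set of colourings, whose infimum is infinite.\<close>

lemma chromatic_number_le_iff:
  "chromatic_number V E \<le> enat k \<longleftrightarrow>
    (\<exists>c :: 'a \<Rightarrow> nat. (\<forall>v\<in>V. c v < k) \<and> (\<forall>v\<in>V. \<forall>w\<in>V. E v w \<longrightarrow> c v \<noteq> c w))" (is "?L \<longleftrightarrow> ?R k")
proof
  assume ?L
  have "enat ` {k. ?R k} \<noteq> {}"
  proof
    assume "enat ` {k. ?R k} = {}"
    then have "chromatic_number V E = \<infinity>" unfolding chromatic_number_def by (simp add: Inf_enat_def)
    then show False using \<open>?L\<close> by simp
  qed
  then obtain z where "z \<in> enat ` {k. ?R k}" by (meson ex_in_conv)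
  then have "Inf (enat ` {k. ?R k}) \<in> enat ` {k. ?R k}" by (rule wellorder_InfI)
  then obtain l where l: "?R l" "chromatic_number V E = enat l" by (auto simp: chromatic_number_def)
  then have "l \<le> k" using \<open>?L\<close> by simp
  then show "?R k" using l(1) by (meson order_less_le_trans)
next
  assume "?R k"
  then show ?L unfolding chromatic_number_def by (intro INF_lower) simp
qed

lemma chromatic_number_hom_le:
  assumes f: "\<And>v. v \<in> V \<Longrightarrow> f v \<in> W" and E: "\<And>v w. v \<in> V \<Longrightarrow> w \<in> V \<Longrightarrow> E v w \<Longrightarrow> F (f v) (f w)"
  shows "chromatic_number V E \<le> chromatic_number W F"
proof (cases "chromatic_number W F")
  case (enat k)
  then obtain c :: "'b \<Rightarrow> nat" where "\<forall>v\<in>W. c v < k" "\<forall>v\<in>W. \<forall>w\<in>W. F v w \<longrightarrow> c v \<noteq> c w"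
    using chromatic_number_le_iff[of W F k] by auto
  then have "chromatic_number V E \<le> enat k"
    unfolding chromatic_number_le_iff using f E by (intro exI[of _ "c \<circ> f"]) auto
  then show ?thesis using enat by simp
qed simp

lemma chi_antimono: "s \<le> s' \<Longrightarrow> chi M d s' \<le> chi M d s"
  unfolding chi_def by (rule chromatic_number_hom_le[of _ "\<lambda>x. x"]) (auto simp: Bor_adj_def)

text \<open>Selections from the correspondence in both directions are graph homomorphisms from scale
  u to scale u - \<delta>. As u - \<delta> > 0, the images of adjacent points have positive distance
  and are therefore distinct.\<close>

lemma chi_interleaving_dist_le_GH:
  assumes "correspondence M N R" and zero: "\<And>x. x \<in> M \<Longrightarrow> d x x = 0" "\<And>y. y \<in> N \<Longrightarrow> e y y = 0"
    and \<delta>: "0 \<le> \<delta>" "\<And>x y x' y'. (x, y) \<in> R \<Longrightarrow> (x', y') \<in> R \<Longrightarrow> \<bar>d x x' - e y y'\<bar> \<le> \<delta>"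
  shows "chi_interleaving_dist M d N e \<le> ereal \<delta>"
proof -
  have R: "R \<subseteq> M \<times> N" "fst ` R = M" "snd ` R = N" using assms(1) by (auto simp: correspondence_def)
  have "\<forall>x\<in>M. \<exists>y. (x, y) \<in> R" using R(2) by force
  then obtain f where f: "\<And>x. x \<in> M \<Longrightarrow> (x, f x) \<in> R" by metis
  have "\<forall>y\<in>N. \<exists>x. (x, y) \<in> R" using R(3) by force
  then obtain g where g: "\<And>y. y \<in> N \<Longrightarrow> (g y, y) \<in> R" by metis
  have fN: "f x \<in> N" if "x \<in> M" for x using f[OF that] R(1) by auto
  have gM: "g y \<in> M" if "y \<in> N" for y using g[OF that] R(1) by auto
  have "chi M d u \<le> chi N e (u - \<delta>)" if "u > \<delta>" for u
    unfolding chi_def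
  proof (rule chromatic_number_hom_le[of _ f])
    fix v w assume vw: "v \<in> M" "w \<in> M" "Bor_adj d u v w"
    have "\<bar>d v w - e (f v) (f w)\<bar> \<le> \<delta>" using \<delta>(2) f vw by blast
    then have "u - \<delta> \<le> e (f v) (f w)" using vw by (auto simp: Bor_adj_def)
    then show "Bor_adj e (u - \<delta>) (f v) (f w)"
      using zero(2)[OF fN[OF vw(1)]] that by (auto simp: Bor_adj_def)
  qed (rule fN)
  moreover have "chi N e u \<le> chi M d (u - \<delta>)" if "u > \<delta>" for u
    unfolding chi_def
  proof (rule chromatic_number_hom_le[of _ g])
    fix v w assume vw: "v \<in> N" "w \<in> N" "Bor_adj e u v w"
    have "\<bar>d (g v) (g w) - e v w\<bar> \<le> \<delta>" using \<delta>(2) g vw by blast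
    then have "u - \<delta> \<le> d (g v) (g w)" using vw by (auto simp: Bor_adj_def)
    then show "Bor_adj d (u - \<delta>) (g v) (g w)"
      using zero(1)[OF gM[OF vw(1)]] that by (auto simp: Bor_adj_def)
  qed (rule gM)
  ultimately show ?thesis
    unfolding chi_interleaving_dist_def using \<delta>(1) by (intro INF_lower) auto
qed

lemma chi_interleaving_dist_half_le_GH_dist:
  assumes "M \<noteq> {}" and zero: "\<And>x. x \<in> M \<Longrightarrow> d x x = 0" "\<And>y. y \<in> N \<Longrightarrow> e y y = 0"
  shows "chi_interleaving_dist M d N e / 2 \<le> GH_dist M d N e"
proof -
  have "chi_interleaving_dist M d N e \<le> distortion d e R" if R: "correspondence M N R" for R
  proof -
    have le: "ereal \<bar>d x x' - e y y'\<bar> \<le> distortion d e R" if "(x, y) \<in> R" "(x', y') \<in> R" for x y x' y'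
      unfolding distortion_def by (rule SUP_upper2[of "((x, y), (x', y'))"]) (use that in auto)
    \<comment> \<open>A pair in R shows that the distortion is nonnegative; over an empty R the
      supremum would be minus infinity.\<close>
    obtain x y where xy: "(x, y) \<in> R" using R \<open>M \<noteq> {}\<close> by (force simp: correspondence_def)
    have nn: "0 \<le> distortion d e R" using le[OF xy xy] by (rule order_trans[rotated]) simp
    show ?thesis
    proof (cases "distortion d e R")
      case (real \<delta>)
      show ?thesis unfolding real
        by (rule chi_interleaving_dist_le_GH[OF R]) (use zero le nn real in auto)
    qed (use nn in auto)
  qed
  then have "chi_interleaving_dist M d N e \<le> (INF R \<in> {R. correspondence M N R}. distortion d e R)"
    by (intro INF_greatest) auto
  then show ?thesis unfolding GH_dist_def by (intro ereal_divide_right_mono) auto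
qed

section \<open>Exponential bounds for the chromatic numbers of Borsuk graphs of spheres\<close>

abbreviation chi_sphere :: "nat \<Rightarrow> real \<Rightarrow> enat" where
  "chi_sphere m \<equiv> chi (sphere_set m) (geodesic_dist m)"

lemma geodesic_dist_self: "x \<in> sphere_set m \<Longrightarrow> geodesic_dist m x x = 0"
  by (simp add: in_sphere_set_iff geodesic_dist_def power2_eq_square)

lemma L2_set_dist_power2:
  "(l2_dist I x y)\<^sup>2 = (\<Sum>i\<in>I. (x i)\<^sup>2) + (\<Sum>i\<in>I. (y i)\<^sup>2) - 2 * (\<Sum>i\<in>I. x i * y i)"
  unfolding L2_set_power2
  by (simp add: power2_eq_square algebra_simps sum.distrib sum_distrib_left sum_subtractf)

lemma sphere_inner_bounds:
  assumes "x \<in> sphere_set m" "y \<in> sphere_set m"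
  shows "\<bar>\<Sum>i\<le>m. x i * y i\<bar> \<le> 1"
proof -
  have "\<bar>\<Sum>i\<le>m. x i * y i\<bar> \<le> (\<Sum>i\<le>m. \<bar>x i\<bar> * \<bar>y i\<bar>)"
    by (rule order_trans[OF sum_abs]) (simp add: abs_mult)
  also have "\<dots> \<le> L2_set x {..m} * L2_set y {..m}" by (rule L2_set_mult_ineq)
  also have "\<dots> = 1" using assms by (simp add: L2_set_def in_sphere_set_iff)
  finally show ?thesis .
qed

text \<open>A chord is twice the sine of half its angle: both sides say that the inner product is at
  most 1 - 2 (sin s)^2.\<close>

lemma geodesic_dist_ge_iff_chord:
  assumes "x \<in> sphere_set m" "y \<in> sphere_set m" "0 \<le> s" "s \<le> pi / 2"
  shows "2 * s \<le> geodesic_dist m x y \<longleftrightarrow> 2 * sin s \<le> l2_dist {..m} x y"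
proof -
  define t where "t = (\<Sum>i\<le>m. x i * y i)"
  have t: "\<bar>t\<bar> \<le> 1" unfolding t_def by (rule sphere_inner_bounds[OF assms(1,2)])
  have "2 * s \<le> geodesic_dist m x y \<longleftrightarrow> cos (arccos t) \<le> cos (2 * s)"
    unfolding geodesic_dist_def t_def[symmetric] using t assms(3,4) arccos_lbound[of t] arccos_ubound[of t]
    by (intro cos_mono_le_eq[symmetric]) auto
  also have "\<dots> \<longleftrightarrow> t \<le> 1 - 2 * (sin s)\<^sup>2" using t by (simp add: cos_double_sin)
  also have "\<dots> \<longleftrightarrow> (2 * sin s)\<^sup>2 \<le> (l2_dist {..m} x y)\<^sup>2"
    using assms(1,2) by (auto simp: L2_set_dist_power2 t_def in_sphere_set_iff power_mult_distrib)
  also have "\<dots> \<longleftrightarrow> 2 * sin s \<le> l2_dist {..m} x y"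
    unfolding abs_le_square_iff[symmetric] using sin_ge_zero[of s] assms(3,4) pi_gt_zero by simp
  finally show ?thesis .
qed

lemma chi_sphere_lower_bound:
  assumes s: "0 < s" "s \<le> pi / 2" and \<eta>: "0 < \<eta>" "\<eta> < 1"
    and k: "chi_sphere m (2 * s) \<le> enat k"
  shows "\<eta> \<le> real k * (sin s + 2 * \<eta>) ^ Suc m"
proof -
  obtain c :: "(nat \<Rightarrow> real) \<Rightarrow> nat" where c: "\<And>x. x \<in> sphere_set m \<Longrightarrow> c x < k"
    "\<And>x y. x \<in> sphere_set m \<Longrightarrow> y \<in> sphere_set m \<Longrightarrow> Bor_adj (geodesic_dist m) (2 * s) x y \<Longrightarrow> c x \<noteq> c y"
    using k unfolding chi_def chromatic_number_le_iff by blast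
  \<comment> \<open>The colouring bound speaks of all functions of unit norm on {..m}, while points
    of \<open>sphere_set m\<close> also vanish above m; \<open>e\<close> cuts off the remaining
    values.\<close>
  define e where "e = (\<lambda>(x :: nat \<Rightarrow> real) i. if i \<le> m then x i else 0)"
  have e: "e x \<in> sphere_set m" if "L2_set x {..m} = 1" for x
  proof -
    have "(\<Sum>i\<le>m. (e x i)\<^sup>2) = (L2_set x {..m})\<^sup>2" by (simp add: L2_set_power2 e_def)
    then show ?thesis using that by (simp add: in_sphere_set_iff e_def)
  qed
  have s0: "sin s > 0" using s pi_gt_zero by (intro sin_gt_zero) auto
  have "\<eta> \<le> real k * (2 * sin s / 2 + 2 * \<eta>) ^ card {..m}"
  proof (rule sphere_colouring_lower_bound[where c = "\<lambda>x. c (e x)"])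
    show "c (e x) < k" if "L2_set x {..m} = 1" for x using c e that by blast
    fix x y assume xy: "L2_set x {..m} = 1" "L2_set y {..m} = 1" "c (e x) = c (e y)"
    have eq: "L2_set (\<lambda>i. e x i - e y i) {..m} = l2_dist {..m} x y"
      by (rule L2_set_cong) (auto simp: e_def)
    have "\<not> Bor_adj (geodesic_dist m) (2 * s) (e x) (e y)" using c(2) e xy by blast
    then have "e x = e y \<or> \<not> 2 * s \<le> geodesic_dist m (e x) (e y)" by (auto simp: Bor_adj_def)
    then show "l2_dist {..m} x y \<le> 2 * sin s"
    proof
      assume "e x = e y"
      then have "L2_set (\<lambda>i. e x i - e y i) {..m} = 0" by (simp add: L2_set_def)
      then show ?thesis using s0 eq by simp
    next
      assume "\<not> 2 * s \<le> geodesic_dist m (e x) (e y)"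
      then show ?thesis using geodesic_dist_ge_iff_chord[OF e[OF xy(1)] e[OF xy(2)], of s] s eq by auto
    qed
  qed (use \<eta> s0 in auto)
  then show ?thesis by simp
qed

text \<open>Points are coloured by a covering centre near them; points with the same centre have a
  chord below 2 * \<sigma>, too short for adjacency at scale 2 * s.\<close>

lemma chi_sphere_upper_bound:
  assumes \<beta>: "0 < \<beta>" "\<beta> < \<sigma>" "\<sigma> < 1" and s: "0 \<le> s" "s \<le> pi / 2" "\<sigma> \<le> sin s"
  obtains A :: real and m0 :: nat where "A > 0"
    "\<And>m. m \<ge> m0 \<Longrightarrow> \<exists>k. chi_sphere m (2 * s) \<le> enat k \<and>
      real k \<le> A * (real (Suc m))\<^sup>2 / \<beta> ^ Suc m"
proof -
  obtain A :: real and N0 where "A > 0" and cov: "\<And>I :: nat set. finite I \<Longrightarrow> N0 \<le> card I \<Longrightarrow> \<exists>C. finite C \<and>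
      real (card C) \<le> A * (real (card I))\<^sup>2 / \<beta> ^ card I \<and>
      (\<forall>x. L2_set x I = 1 \<longrightarrow> (\<exists>c\<in>C. l2_dist I x c < \<sigma>))"
    using sphere_covering[OF \<beta>, where 'i = nat] by blast
  show thesis
  proof (rule that[OF \<open>A > 0\<close>, of N0])
    fix m assume "m \<ge> N0"
    then obtain C :: "(nat \<Rightarrow> real) set" where C: "finite C" "real (card C) \<le> A * (real (Suc m))\<^sup>2 / \<beta> ^ Suc m"
      "\<And>x. L2_set x {..m} = 1 \<Longrightarrow> \<exists>c\<in>C. l2_dist {..m} x c < \<sigma>"
      using cov[of "{..m}"] by auto
    obtain h where h: "bij_betw h C {0..<card C}" using ex_bij_betw_finite_nat[OF C(1)] by blast
    have "\<forall>x. L2_set x {..m} = 1 \<longrightarrow> (\<exists>c. c \<in> C \<and> l2_dist {..m} x c < \<sigma>)" using C(3) by blast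
    then obtain g where g: "\<And>x. L2_set x {..m} = 1 \<Longrightarrow> g x \<in> C \<and> l2_dist {..m} x (g x) < \<sigma>" by metis
    have unit: "L2_set x {..m} = 1" if "x \<in> sphere_set m" for x
      using that by (simp add: L2_set_def in_sphere_set_iff)
    have "chi_sphere m (2 * s) \<le> enat (card C)"
      unfolding chi_def chromatic_number_le_iff
    proof (intro exI[of _ "\<lambda>x. h (g x)"] conjI ballI impI)
      fix x assume "x \<in> sphere_set m"
      then show "h (g x) < card C" using bij_betw_apply[OF h, of "g x"] g unit by auto
    next
      fix x y assume xy: "x \<in> sphere_set m" "y \<in> sphere_set m" "Bor_adj (geodesic_dist m) (2 * s) x y"
      show "h (g x) \<noteq> h (g y)"
      proof
        assume "h (g x) = h (g y)"
        then have eq: "g x = g y" using h g[OF unit[OF xy(1)]] g[OF unit[OF xy(2)]]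
          by (auto simp: bij_betw_def dest: inj_onD)
        have "2 * sin s \<le> l2_dist {..m} x y"
          using xy geodesic_dist_ge_iff_chord[OF xy(1,2) s(1,2)] by (auto simp: Bor_adj_def)
        also have "\<dots> \<le> l2_dist {..m} x (g x) + L2_set (\<lambda>i. g x i - y i) {..m}"
          by (rule L2_set_dist_triangle)
        also have "\<dots> < \<sigma> + \<sigma>"
          using g[OF unit[OF xy(1)]] g[OF unit[OF xy(2)]] L2_set_minus_commute[of y "g y" "{..m}"] eq
          by (intro add_strict_mono) auto
        finally show False using s(3) by simp
      qed
    qed
    then show "\<exists>k. chi_sphere m (2 * s) \<le> enat k \<and>
      real k \<le> A * (real (Suc m))\<^sup>2 / \<beta> ^ Suc m" using C(2) by blast
  qed
qed

section \<open>The Borsuk--Ulam theorem\<close>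

declare add_bit_eq_xor [simp del]

lemma bit_add_self [simp]: "(x :: bit) + x = 0" "(x :: bit) + (x + y) = y"
proof -
  show *: "x + x = 0" for x :: bit by (cases x) (simp_all add: add_bit_eq_xor)
  show "x + (x + y) = y" by (simp add: * flip: add.assoc)
qed

text \<open>Mod 2 cochains are functions on lists of vertices; \<open>coboundary \<phi> \<sigma>\<close> sums \<open>\<phi>\<close> over the lists
  obtained by deleting one entry of \<open>\<sigma>\<close>.\<close>

fun coboundary :: "('a list \<Rightarrow> bit) \<Rightarrow> 'a list \<Rightarrow> bit" where
  "coboundary \<phi> [] = 0"
| "coboundary \<phi> (x # xs) = \<phi> xs + coboundary (\<lambda>\<rho>. \<phi> (x # \<rho>)) xs"

lemma coboundary_cong:
  assumes "\<And>\<tau>. Suc (length \<tau>) = length \<sigma> \<Longrightarrow> set \<tau> \<subseteq> set \<sigma> \<Longrightarrow> \<phi> \<tau> = \<psi> \<tau>"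
  shows "coboundary \<phi> \<sigma> = coboundary \<psi> \<sigma>"
  using assms
proof (induction \<sigma> arbitrary: \<phi> \<psi>)
  case (Cons x xs)
  have "coboundary (\<lambda>\<rho>. \<phi> (x # \<rho>)) xs = coboundary (\<lambda>\<rho>. \<psi> (x # \<rho>)) xs"
    by (rule Cons.IH) (rule Cons.prems, auto)
  moreover have "\<phi> xs = \<psi> xs" by (rule Cons.prems) auto
  ultimately show ?case by simp
qed simp

lemma coboundary_add: "coboundary (\<lambda>\<rho>. \<phi> \<rho> + \<psi> \<rho>) \<sigma> = coboundary \<phi> \<sigma> + coboundary \<psi> \<sigma>"
  by (induction \<sigma> arbitrary: \<phi> \<psi>) (simp_all add: algebra_simps)

lemma coboundary_zero [simp]: "coboundary (\<lambda>_. 0) \<sigma> = 0"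
  by (induction \<sigma>) simp_all

lemma coboundary_coboundary [simp]: "coboundary (coboundary \<phi>) \<sigma> = 0"
proof (induction \<sigma> arbitrary: \<phi>)
  case (Cons x xs)
  have "coboundary (\<lambda>\<rho>. coboundary \<phi> (x # \<rho>)) xs
      = coboundary \<phi> xs + coboundary (coboundary (\<lambda>\<rho>. \<phi> (x # \<rho>))) xs"
    by (simp add: coboundary_add[of \<phi>])
  then show ?case using Cons.IH[of "\<lambda>\<rho>. \<phi> (x # \<rho>)"] by simp
qed simp

lemma coboundary_map: "coboundary (\<lambda>\<rho>. \<phi> (map f \<rho>)) \<sigma> = coboundary \<phi> (map f \<sigma>)"
proof (induction \<sigma> arbitrary: \<phi>)
  case (Cons x xs)
  show ?case using Cons.IH[of "\<lambda>\<rho>. \<phi> (f x # \<rho>)"] by simp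
qed simp

text \<open>For a cochain that ignores the order of the vertices, the coboundary ignores it as well,
  so labels may be sorted.\<close>

lemma coboundary_mset:
  "coboundary (\<lambda>\<rho>. \<phi> (mset \<rho>)) \<sigma> = (\<Sum>x\<in>#mset \<sigma>. \<phi> (mset \<sigma> - {#x#}))"
proof (induction \<sigma> arbitrary: \<phi>)
  case (Cons a xs)
  have "coboundary (\<lambda>\<rho>. \<phi> (add_mset a (mset \<rho>))) xs = (\<Sum>x\<in>#mset xs. \<phi> (add_mset a (mset xs - {#x#})))"
    using Cons.IH[of "\<lambda>M. \<phi> (add_mset a M)"] by simp
  also have "\<dots> = (\<Sum>x\<in>#mset xs. \<phi> (add_mset a (mset xs) - {#x#}))"
    by (intro arg_cong[of _ _ sum_mset] image_mset_cong) auto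
  finally show ?case by simp
qed simp

section \<open>Alternating label sequences\<close>

fun alternating :: "bool \<Rightarrow> (nat \<times> bool) list \<Rightarrow> bool" where
  "alternating b [] \<longleftrightarrow> True"
| "alternating b (x # xs) \<longleftrightarrow> snd x = b \<and> alternating (\<not> b) xs"

text \<open>The left side counts mod 2 the deletions from L that leave a list alternating from b. If
  L alternates from b, only deleting the last entry works; if it alternates from the other sign,
  only deleting the first; otherwise the possible deletions come in pairs, the two neighbours of
  equal sign.\<close>

lemma coboundary_alternating:
  "coboundary (\<lambda>\<rho>. of_bool (alternating b \<rho>)) L = of_bool (alternating True L) + of_bool (alternating False L)"
proof (induction L arbitrary: b)
  case (Cons x xs)
  show ?case
  proof (cases "snd x = b")
    case True
    then have "coboundary (\<lambda>\<rho>. of_bool (alternating b \<rho>)) (x # xs)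
        = of_bool (alternating b xs) + (of_bool (alternating True xs) + of_bool (alternating False xs))"
      by (simp add: Cons.IH)
    then show ?thesis using True by (cases b) (simp_all add: add.left_commute)
  next
    case False
    then show ?thesis by (cases b) simp_all
  qed
qed simp

text \<open>Fan's alternating simplices, as a property of their labels. The strict order rejects
  repeated indices, so degenerate simplices are never counted.\<close>

definition fan_alternating :: "bool \<Rightarrow> (nat \<times> bool) multiset \<Rightarrow> bool" where
  "fan_alternating b M \<longleftrightarrow> (\<exists>L. mset L = M \<and> sorted_wrt (\<lambda>x y. fst x < fst y) L \<and> alternating b L)"

lemma sorted_wrt_fst_unique:
  assumes "sorted_wrt (\<lambda>x y. fst x < (fst y :: nat)) L" "sorted_wrt (\<lambda>x y. fst x < fst y) L'" "mset L = mset L'"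
  shows "L = L'"
  using assms
proof (induction L arbitrary: L')
  case (Cons x xs)
  then obtain y ys where L': "L' = y # ys" by (cases L') auto
  have "x = y"
  proof (rule ccontr)
    assume "x \<noteq> y"
    have "set (x # xs) = set (y # ys)" using Cons.prems(3) L' by (metis mset_eq_setD)
    then have "x \<in> set ys" "y \<in> set xs" using \<open>x \<noteq> y\<close> by auto
    then show False using Cons.prems(1,2) L' by fastforce
  qed
  then show ?case using Cons.prems L' Cons.IH[of ys] by simp
qed simp

lemma fan_alternating_mset:
  assumes "sorted_wrt (\<lambda>x y. fst x < fst y) L"
  shows "fan_alternating b (mset L) \<longleftrightarrow> alternating b L"
  using assms sorted_wrt_fst_unique unfolding fan_alternating_def by metis

lemma not_fan_alternating_dup: "\<not> fan_alternating b (add_mset z (add_mset z M))"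
proof
  assume "fan_alternating b (add_mset z (add_mset z M))"
  then obtain L where L: "mset L = add_mset z (add_mset z M)" "sorted_wrt (\<lambda>x y. fst x < fst y) L"
    by (auto simp: fan_alternating_def)
  have "distinct L" using L(2) by (induction L) auto
  then have "count (mset L) z \<le> 1" using distinct_count_atmost_1[of L] by (cases z) simp
  then show False using L(1) by simp
qed

text \<open>With distinct indices the labels can be sorted and the identity for lists applies.
  Otherwise \<open>comp\<close> makes some label occur twice: only deleting one of its two copies
  can leave an alternating multiset, these two terms cancel, and the right side vanishes
  too.\<close>

lemma coboundary_fan_alternating:
  assumes comp: "\<And>u w. u \<in> set K \<Longrightarrow> w \<in> set K \<Longrightarrow> fst u = fst w \<Longrightarrow> u = w"
  shows "coboundary (\<lambda>\<rho>. of_bool (fan_alternating b (mset \<rho>))) K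
    = of_bool (fan_alternating True (mset K)) + of_bool (fan_alternating False (mset K))"
proof (cases "distinct (map fst K)")
  case True
  define L where "L = sort_key fst K"
  have mL: "mset L = mset K" by (simp add: L_def)
  have "distinct (map fst L)"
    using True mL by (metis distinct_map mset_eq_imp_distinct_iff mset_map)
  moreover have "sorted (map fst L)" by (simp add: L_def)
  ultimately have "sorted_wrt (<) (map fst L)" by (simp add: strict_sorted_iff)
  then have srt: "sorted_wrt (\<lambda>x y. fst x < fst y) L" by (simp add: sorted_wrt_map)
  have sub: "coboundary (\<lambda>\<rho>. of_bool (fan_alternating b (mset \<rho>))) L = coboundary (\<lambda>\<rho>. of_bool (alternating b \<rho>)) L" for b
  proof -
    have "coboundary (\<lambda>\<rho>. of_bool (fan_alternating b (mset (ys @ \<rho>)))) L = coboundary (\<lambda>\<rho>. of_bool (alternating b (ys @ \<rho>))) L"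
      if "sorted_wrt (\<lambda>x y. fst x < fst y) (ys @ L)" for ys L
      using that
    proof (induction L arbitrary: ys)
      case (Cons x xs)
      have "sorted_wrt (\<lambda>x y. fst x < fst y) (ys @ xs)" using Cons.prems by (auto simp: sorted_wrt_append)
      then have "fan_alternating b (mset (ys @ xs)) \<longleftrightarrow> alternating b (ys @ xs)" by (rule fan_alternating_mset)
      moreover have "coboundary (\<lambda>\<rho>. of_bool (fan_alternating b (mset ((ys @ [x]) @ \<rho>)))) xs
          = coboundary (\<lambda>\<rho>. of_bool (alternating b ((ys @ [x]) @ \<rho>))) xs"
        by (rule Cons.IH) (use Cons.prems in simp)
      ultimately show ?case by simp
    qed simp
    from this[of "[]" L] srt show ?thesis by simp
  qed
  have "coboundary (\<lambda>\<rho>. of_bool (fan_alternating b (mset \<rho>))) K = coboundary (\<lambda>\<rho>. of_bool (fan_alternating b (mset \<rho>))) L"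
    using coboundary_mset[of "\<lambda>M. of_bool (fan_alternating b M)"] mL by simp
  also have "\<dots> = of_bool (alternating True L) + of_bool (alternating False L)"
    unfolding sub by (rule coboundary_alternating)
  finally show ?thesis using fan_alternating_mset[OF srt] mL by simp
next
  case False
  then obtain xs ys zs y where dec: "map fst K = xs @ [y] @ ys @ [y] @ zs"
    using not_distinct_decomp by blast
  obtain k1 r1 where K1: "K = k1 @ r1" "map fst r1 = [y] @ ys @ [y] @ zs"
    using dec by (auto simp: map_eq_append_conv)
  obtain u r2 where K2: "r1 = u # r2" "fst u = y" "map fst r2 = ys @ [y] @ zs" using K1(2) by auto
  obtain k2 r3 where K3: "r2 = k2 @ r3" "map fst r3 = [y] @ zs" using K2(3) by (auto simp: map_eq_append_conv)
  obtain w r4 where K4: "r3 = w # r4" "fst w = y" using K3(2) by auto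
  have "u = w" using comp[of u w] K1 K2 K3 K4 by auto
  then have M: "mset K = add_mset u (add_mset u (mset (k1 @ k2 @ r4)))" using K1(1) K2(1) K3(1) K4(1) by simp
  define M' where "M' = mset (k1 @ k2 @ r4)"
  have MK: "mset K = add_mset u (add_mset u M')" using M by (simp add: M'_def)
  have "coboundary (\<lambda>\<rho>. of_bool (fan_alternating b (mset \<rho>))) K
      = (\<Sum>x\<in>#M'. of_bool (fan_alternating b (add_mset u (add_mset u M') - {#x#})))"
    using coboundary_mset[of "\<lambda>M. of_bool (fan_alternating b M)" K] by (simp add: MK)
  also have "\<dots> = (\<Sum>x\<in>#M'. 0)"
  proof (intro arg_cong[of _ _ sum_mset] image_mset_cong)
    fix x assume "x \<in># M'"
    then obtain M'' where "M' = add_mset x M''" by (metis insert_DiffM)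
    then have "add_mset u (add_mset u M') - {#x#} = add_mset u (add_mset u M'')"
      by simp
    then show "of_bool (fan_alternating b (add_mset u (add_mset u M') - {#x#})) = (0 :: bit)"
      using not_fan_alternating_dup by simp
  qed
  also have "\<dots> = 0" by simp
  finally show ?thesis using not_fan_alternating_dup by (simp add: MK)
qed

lemma alternating_flip:
  "alternating b (map (apsnd Not) L) \<longleftrightarrow> alternating (\<not> b) L"
  by (induction L arbitrary: b) auto

lemma fan_alternating_flip:
  "fan_alternating b (image_mset (apsnd Not) M) \<longleftrightarrow> fan_alternating (\<not> b) M"
proof -
  have *: "fan_alternating b' (image_mset (apsnd Not) M')" if "fan_alternating (\<not> b') M'" for b' M'
  proof -
    obtain L where L: "mset L = M'" "sorted_wrt (\<lambda>x y. fst x < fst y) L" "alternating (\<not> b') L"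
      using \<open>fan_alternating (\<not> b') M'\<close> by (auto simp: fan_alternating_def)
    then show ?thesis unfolding fan_alternating_def
      by (intro exI[of _ "map (apsnd Not) L"]) (auto simp: alternating_flip sorted_wrt_map)
  qed
  have "image_mset (apsnd Not) (image_mset (apsnd Not) M) = M"
    by (simp add: multiset.map_comp o_def apsnd_def map_prod_def case_prod_unfold)
  then show ?thesis using *[of b M] *[of "\<not> b" "image_mset (apsnd Not) M"] by auto
qed

lemma not_fan_alternating_size:
  assumes "\<And>u. u \<in># M \<Longrightarrow> fst u \<le> m" "Suc m < size M"
  shows "\<not> fan_alternating b M"
proof
  assume "fan_alternating b M"
  then obtain L where L: "mset L = M" "sorted_wrt (\<lambda>x y. fst x < fst y) L"
    by (auto simp: fan_alternating_def)
  have "sorted_wrt (<) (map fst L)" using L(2) by (simp add: sorted_wrt_map)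
  then have "distinct (map fst L)" by (simp add: strict_sorted_iff)
  then have "length L = card (set (map fst L))" by (metis distinct_card length_map)
  also have "\<dots> \<le> card {..m}" using assms(1) L(1) by (intro card_mono) auto
  finally show False using assms(2) L(1) by (metis card_atMost not_le size_mset)
qed

section \<open>Cochains under barycentric subdivision\<close>

definition barycenter :: "(nat \<Rightarrow> real) list \<Rightarrow> nat \<Rightarrow> real" where
  "barycenter \<sigma> i = (\<Sum>x\<leftarrow>\<sigma>. x i) / real (length \<sigma>)"

text \<open>The pull-back of a cochain along barycentric subdivision; the first argument is the length of
  the list.\<close>

primrec subdivide_aux :: "nat \<Rightarrow> ((nat \<Rightarrow> real) list \<Rightarrow> bit) \<Rightarrow> (nat \<Rightarrow> real) list \<Rightarrow> bit" where
  "subdivide_aux 0 \<phi> \<sigma> = \<phi> []"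
| "subdivide_aux (Suc n) \<phi> \<sigma> = coboundary (subdivide_aux n (\<lambda>\<rho>. \<phi> (barycenter \<sigma> # \<rho>))) \<sigma>"

definition subdivide :: "((nat \<Rightarrow> real) list \<Rightarrow> bit) \<Rightarrow> (nat \<Rightarrow> real) list \<Rightarrow> bit" where
  "subdivide \<phi> \<sigma> = subdivide_aux (length \<sigma>) \<phi> \<sigma>"

lemma subdivide_aux_add:
  "subdivide_aux n (\<lambda>\<rho>. \<phi> \<rho> + \<psi> \<rho>) \<sigma> = subdivide_aux n \<phi> \<sigma> + subdivide_aux n \<psi> \<sigma>"
proof (induction n arbitrary: \<phi> \<psi> \<sigma>)
  case (Suc n)
  have "subdivide_aux n (\<lambda>\<rho>. \<phi> (barycenter \<sigma> # \<rho>) + \<psi> (barycenter \<sigma> # \<rho>))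
     = (\<lambda>\<tau>. subdivide_aux n (\<lambda>\<rho>. \<phi> (barycenter \<sigma> # \<rho>)) \<tau> + subdivide_aux n (\<lambda>\<rho>. \<psi> (barycenter \<sigma> # \<rho>)) \<tau>)"
    by (rule ext) (rule Suc.IH)
  then show ?case by (simp add: coboundary_add)
qed simp

lemma subdivide_add: "subdivide (\<lambda>\<rho>. \<phi> \<rho> + \<psi> \<rho>) \<sigma> = subdivide \<phi> \<sigma> + subdivide \<psi> \<sigma>"
  by (simp add: subdivide_def subdivide_aux_add)

text \<open>Faces of the subdivided simplex that contain its barycenter are interior and cancel: by
  induction they contribute a coboundary of a coboundary. At n = 0 both sides are 0, so the
  truncated n - 1 is harmless.\<close>

lemma subdivide_aux_coboundary:
  "length \<sigma> = n \<Longrightarrow> subdivide_aux n (coboundary \<phi>) \<sigma> = coboundary (subdivide_aux (n - 1) \<phi>) \<sigma>"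
proof (induction n arbitrary: \<phi> \<sigma>)
  case (Suc n)
  define \<psi> where "\<psi> = (\<lambda>\<rho>. \<phi> (barycenter \<sigma> # \<rho>))"
  have "subdivide_aux (Suc n) (coboundary \<phi>) \<sigma>
      = coboundary (subdivide_aux n (\<lambda>\<rho>. \<phi> \<rho> + coboundary \<psi> \<rho>)) \<sigma>"
    by (simp add: \<psi>_def)
  also have "\<dots> = coboundary (\<lambda>\<tau>. subdivide_aux n \<phi> \<tau> + coboundary (subdivide_aux (n - 1) \<psi>) \<tau>) \<sigma>"
    using Suc.prems by (intro coboundary_cong) (simp add: subdivide_aux_add Suc.IH)
  also have "\<dots> = coboundary (subdivide_aux n \<phi>) \<sigma>" by (simp add: coboundary_add)
  finally show ?case by simp
qed simp

lemma subdivide_coboundary: "subdivide (coboundary \<phi>) = coboundary (subdivide \<phi>)"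
proof
  fix \<sigma>
  show "subdivide (coboundary \<phi>) \<sigma> = coboundary (subdivide \<phi>) \<sigma>"
    unfolding subdivide_def[of "coboundary \<phi>"] subdivide_aux_coboundary[OF refl]
    by (rule coboundary_cong, drule sym) (simp add: subdivide_def)
qed

definition close_points :: "real \<Rightarrow> (nat \<Rightarrow> real) set \<Rightarrow> bool" where
  "close_points d S \<longleftrightarrow> (\<forall>x\<in>S. \<forall>y\<in>S. \<forall>i. \<bar>x i - y i\<bar> \<le> d)"

definition barycenters :: "(nat \<Rightarrow> real) set \<Rightarrow> (nat \<Rightarrow> real) set" where
  "barycenters S = {barycenter \<tau> |\<tau>. \<tau> \<noteq> [] \<and> set \<tau> \<subseteq> S}"

lemma abs_sum_list_le: "\<bar>\<Sum>x\<leftarrow>xs. f x\<bar> \<le> (\<Sum>x\<leftarrow>xs. \<bar>f x :: real\<bar>)"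
  by (induction xs) auto

lemma sum_list_map_le_const: "(\<And>x. x \<in> set xs \<Longrightarrow> f x \<le> (c :: real)) \<Longrightarrow> (\<Sum>x\<leftarrow>xs. f x) \<le> real (length xs) * c"
  by (induction xs) (force simp: algebra_simps)+

lemma barycenter_dist:
  assumes "\<sigma> \<noteq> []"
  shows "barycenter \<sigma> i - c = (\<Sum>x\<leftarrow>\<sigma>. x i - c) / real (length \<sigma>)"
proof -
  have "(\<Sum>x\<leftarrow>\<sigma>. x i - c) = (\<Sum>x\<leftarrow>\<sigma>. x i) - real (length \<sigma>) * c"
    by (induction \<sigma>) (auto simp: algebra_simps)
  then show ?thesis using assms by (simp add: barycenter_def field_simps)
qed

text \<open>In the mean of the n + 1 differences from a vertex, the term of that vertex itself
  vanishes, which leaves the factor n / (n + 1). Averaging extends the bound from vertices to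
  barycenters of faces.\<close>

lemma barycenter_close:
  assumes d: "close_points d (set \<sigma>)" and len: "length \<sigma> = Suc n" and x: "x \<in> barycenters (set \<sigma>)"
  shows "\<bar>barycenter \<sigma> i - x i\<bar> \<le> real n / real (Suc n) * d"
proof -
  have vertex: "\<bar>barycenter \<sigma> i - v i\<bar> \<le> real n / real (Suc n) * d" if v: "v \<in> set \<sigma>" for v
  proof -
    obtain xs ys where \<sigma>: "\<sigma> = xs @ v # ys" using split_list[OF v] by blast
    have "\<bar>\<Sum>x\<leftarrow>\<sigma>. x i - v i\<bar> = \<bar>\<Sum>x\<leftarrow>xs @ ys. x i - v i\<bar>" by (simp add: \<sigma>)
    also have "\<dots> \<le> (\<Sum>x\<leftarrow>xs @ ys. \<bar>x i - v i\<bar>)" by (rule abs_sum_list_le)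
    also have "\<dots> \<le> real (length (xs @ ys)) * d"
      by (rule sum_list_map_le_const) (use d in \<open>auto simp: close_points_def \<sigma>\<close>)
    also have "length (xs @ ys) = n" using len \<sigma> by simp
    finally have "\<bar>\<Sum>x\<leftarrow>\<sigma>. x i - v i\<bar> / real (Suc n) \<le> real n * d / real (Suc n)"
      by (rule divide_right_mono) simp
    moreover have "\<sigma> \<noteq> []" using len by auto
    ultimately show ?thesis using len by (simp add: barycenter_dist abs_divide)
  qed
  obtain \<tau> where \<tau>: "x = barycenter \<tau>" "\<tau> \<noteq> []" "set \<tau> \<subseteq> set \<sigma>" using x by (auto simp: barycenters_def)
  have "\<bar>barycenter \<tau> i - barycenter \<sigma> i\<bar> = \<bar>\<Sum>v\<leftarrow>\<tau>. v i - barycenter \<sigma> i\<bar> / real (length \<tau>)"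
    using \<tau>(2) by (simp add: barycenter_dist abs_divide)
  also have "\<dots> \<le> (\<Sum>v\<leftarrow>\<tau>. \<bar>v i - barycenter \<sigma> i\<bar>) / real (length \<tau>)"
    by (intro divide_right_mono abs_sum_list_le) simp
  also have "\<dots> \<le> (real (length \<tau>) * (real n / real (Suc n) * d)) / real (length \<tau>)"
    using vertex \<tau>(3) by (intro divide_right_mono sum_list_map_le_const) (auto simp: abs_minus_commute)
  also have "\<dots> = real n / real (Suc n) * d" using \<tau>(2) by simp
  finally show ?thesis by (simp add: \<tau>(1) abs_minus_commute)
qed

text \<open>Subdivision evaluates a cochain only on simplices of smaller mesh, so agreement there is
  enough. The fixed \<open>N\<close> gives one contraction factor for all dimensions that occur in
  the recursion.\<close>

lemma subdivide_aux_cong: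
  assumes "length \<sigma> = n" "close_points d (set \<sigma>)" "n \<le> Suc N" "0 \<le> d"
    and "\<And>\<rho>. length \<rho> = n \<Longrightarrow> set \<rho> \<subseteq> barycenters (set \<sigma>) \<Longrightarrow>
      close_points (real N / real (Suc N) * d) (set \<rho>) \<Longrightarrow> \<phi> \<rho> = \<psi> \<rho>"
  shows "subdivide_aux n \<phi> \<sigma> = subdivide_aux n \<psi> \<sigma>"
  using assms
proof (induction n arbitrary: \<sigma> \<phi> \<psi>)
  case 0
  then show ?case by (simp add: close_points_def)
next
  case (Suc n)
  have "coboundary (subdivide_aux n (\<lambda>\<rho>. \<phi> (barycenter \<sigma> # \<rho>))) \<sigma>
      = coboundary (subdivide_aux n (\<lambda>\<rho>. \<psi> (barycenter \<sigma> # \<rho>))) \<sigma>"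
  proof (rule coboundary_cong)
    fix \<tau> :: "(nat \<Rightarrow> real) list" assume \<tau>: "Suc (length \<tau>) = length \<sigma>" "set \<tau> \<subseteq> set \<sigma>"
    show "subdivide_aux n (\<lambda>\<rho>. \<phi> (barycenter \<sigma> # \<rho>)) \<tau> = subdivide_aux n (\<lambda>\<rho>. \<psi> (barycenter \<sigma> # \<rho>)) \<tau>"
    proof (rule Suc.IH)
      show "close_points d (set \<tau>)" using Suc.prems(2) \<tau>(2) by (auto simp: close_points_def)
      fix \<rho> assume \<rho>: "length \<rho> = n" "set \<rho> \<subseteq> barycenters (set \<tau>)"
        "close_points (real N / real (Suc N) * d) (set \<rho>)"
      have sub: "set \<rho> \<subseteq> barycenters (set \<sigma>)" using \<rho>(2) \<tau>(2) by (fastforce simp: barycenters_def)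
      have "\<sigma> \<noteq> []" using Suc.prems(1) by auto
      then have b: "barycenter \<sigma> \<in> barycenters (set \<sigma>)" by (auto simp: barycenters_def)
      have "real n / real (Suc n) \<le> real N / real (Suc N)"
        using Suc.prems(3) by (simp add: divide_simps algebra_simps)
      then have "real n / real (Suc n) * d \<le> real N / real (Suc N) * d"
        using Suc.prems(4) by (rule mult_right_mono)
      then have bx: "\<bar>barycenter \<sigma> i - x i\<bar> \<le> real N / real (Suc N) * d" if "x \<in> barycenters (set \<sigma>)" for x i
        using barycenter_close[OF Suc.prems(2,1) that, of i] by linarith
      have "close_points (real N / real (Suc N) * d) (set (barycenter \<sigma> # \<rho>))"
        unfolding close_points_def
      proof (intro ballI allI)
        fix x y i assume xy: "x \<in> set (barycenter \<sigma> # \<rho>)" "y \<in> set (barycenter \<sigma> # \<rho>)"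
        then consider "x = barycenter \<sigma>" | "y = barycenter \<sigma>" | "x \<in> set \<rho>" "y \<in> set \<rho>" by auto
        then show "\<bar>x i - y i\<bar> \<le> real N / real (Suc N) * d"
        proof cases
          case 1
          have "y \<in> barycenters (set \<sigma>)" using xy(2) sub b by auto
          then show ?thesis using bx 1 by blast
        next
          case 2
          have "x \<in> barycenters (set \<sigma>)" using xy(1) sub b by auto
          then show ?thesis using bx 2 abs_minus_commute by metis
        next
          case 3
          then show ?thesis using \<rho>(3) unfolding close_points_def by blast
        qed
      qed
      then show "\<phi> (barycenter \<sigma> # \<rho>) = \<psi> (barycenter \<sigma> # \<rho>)"
        using Suc.prems(5)[of "barycenter \<sigma> # \<rho>"] \<rho>(1) sub b by simp
    qed (use Suc.prems \<tau> in auto)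
  qed
  then show ?case by simp
qed

text \<open>A cochain identity valid only for small simplices becomes usable on large ones after
  enough subdivisions. The set \<open>C\<close>, closed under barycenters, is where the subdivided
  vertices stay.\<close>

lemma subdivide_pow_cong:
  assumes C: "\<And>S. S \<subseteq> C \<Longrightarrow> barycenters S \<subseteq> C"
    and "set \<sigma> \<subseteq> C" "close_points d (set \<sigma>)" "length \<sigma> \<le> Suc N" "0 \<le> d"
    and "\<And>\<rho>. length \<rho> = length \<sigma> \<Longrightarrow> set \<rho> \<subseteq> C \<Longrightarrow>
      close_points ((real N / real (Suc N)) ^ k * d) (set \<rho>) \<Longrightarrow> \<phi> \<rho> = \<psi> \<rho>"
  shows "(subdivide ^^ k) \<phi> \<sigma> = (subdivide ^^ k) \<psi> \<sigma>"
  using assms(2-)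
proof (induction k arbitrary: \<sigma> d)
  case (Suc k)
  have "subdivide ((subdivide ^^ k) \<phi>) \<sigma> = subdivide ((subdivide ^^ k) \<psi>) \<sigma>"
    unfolding subdivide_def[of "(subdivide ^^ k) _"]
  proof (rule subdivide_aux_cong[OF refl Suc.prems(2,3,4)])
    fix \<rho> assume \<rho>: "length \<rho> = length \<sigma>" "set \<rho> \<subseteq> barycenters (set \<sigma>)"
      "close_points (real N / real (Suc N) * d) (set \<rho>)"
    show "(subdivide ^^ k) \<phi> \<rho> = (subdivide ^^ k) \<psi> \<rho>"
    proof (rule Suc.IH[OF _ \<rho>(3)])
      show "set \<rho> \<subseteq> C" using \<rho>(2) C[OF Suc.prems(1)] by auto
      fix \<rho>' assume "length \<rho>' = length \<rho>" "set \<rho>' \<subseteq> C"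
        "close_points ((real N / real (Suc N)) ^ k * (real N / real (Suc N) * d)) (set \<rho>')"
      then show "\<phi> \<rho>' = \<psi> \<rho>'" using Suc.prems(5)[of \<rho>'] \<rho>(1) by (simp add: mult_ac)
    qed (use Suc.prems \<rho> in auto)
  qed
  then show ?case by simp
qed simp

lemma subdivide_pow_add:
  "(subdivide ^^ k) (\<lambda>\<rho>. \<phi> \<rho> + \<psi> \<rho>) = (\<lambda>\<sigma>. (subdivide ^^ k) \<phi> \<sigma> + (subdivide ^^ k) \<psi> \<sigma>)"
proof (induction k)
  case (Suc k)
  show ?case by (rule ext) (simp add: Suc.IH subdivide_add)
qed simp

lemma subdivide_pow_coboundary:
  "(subdivide ^^ k) (coboundary \<phi>) = coboundary ((subdivide ^^ k) \<phi>)"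
  by (induction k) (simp_all add: subdivide_coboundary)

lemma barycenter_antipode: "barycenter (map antipode \<sigma>) = antipode (barycenter \<sigma>)"
proof
  fix i
  have "(\<Sum>x\<leftarrow>map antipode \<sigma>. x i) = - (\<Sum>x\<leftarrow>\<sigma>. x i)" by (induction \<sigma>) (auto simp: antipode_def)
  then show "barycenter (map antipode \<sigma>) i = antipode (barycenter \<sigma>) i"
    by (simp add: barycenter_def antipode_def)
qed

lemma subdivide_aux_antipode:
  "subdivide_aux n (\<lambda>\<rho>. \<phi> (map antipode \<rho>)) \<sigma> = subdivide_aux n \<phi> (map antipode \<sigma>)"
proof (induction n arbitrary: \<phi> \<sigma>)
  case (Suc n)
  have "subdivide_aux n (\<lambda>\<rho>. \<phi> (map antipode (barycenter \<sigma> # \<rho>)))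
     = (\<lambda>\<tau>. subdivide_aux n (\<lambda>\<rho>. \<phi> (barycenter (map antipode \<sigma>) # \<rho>)) (map antipode \<tau>))"
    using Suc.IH[of "\<lambda>\<rho>. \<phi> (antipode (barycenter \<sigma>) # \<rho>)"] by (auto simp: barycenter_antipode)
  then show ?case by (simp add: coboundary_map)
qed simp

lemma subdivide_pow_antipode:
  "(subdivide ^^ k) (\<lambda>\<rho>. \<phi> (map antipode \<rho>)) \<sigma> = (subdivide ^^ k) \<phi> (map antipode \<sigma>)"
proof (induction k arbitrary: \<sigma>)
  case (Suc k)
  have "(subdivide ^^ k) (\<lambda>\<rho>. \<phi> (map antipode \<rho>)) = (\<lambda>\<sigma>. (subdivide ^^ k) \<phi> (map antipode \<sigma>))"
    using Suc.IH by auto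
  then show ?case by (simp add: subdivide_def[of _ \<sigma>] subdivide_def[of _ "map antipode \<sigma>"] subdivide_aux_antipode)
qed simp

lemma subdivide_pow_singleton: "(subdivide ^^ k) \<phi> [x] = \<phi> [x]"
proof (induction k)
  case (Suc k)
  have "barycenter [x] = x" by (auto simp: barycenter_def)
  then show ?case using Suc.IH by (simp add: subdivide_def)
qed simp

section \<open>The cross-polytope as a mod 2 cycle\<close>

definition unit_vec :: "nat \<Rightarrow> nat \<Rightarrow> real" where
  "unit_vec k = (\<lambda>i. if i = k then 1 else 0)"

text \<open>The sum of a cochain over the facets of the \<open>k\<close>-dimensional cross-polytope.\<close>

primrec octahedral_sum :: "nat \<Rightarrow> ((nat \<Rightarrow> real) list \<Rightarrow> bit) \<Rightarrow> bit" where
  "octahedral_sum 0 \<phi> = \<phi> []"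
| "octahedral_sum (Suc k) \<phi> = octahedral_sum k (\<lambda>\<rho>. \<phi> (unit_vec k # \<rho>)) +
     octahedral_sum k (\<lambda>\<rho>. \<phi> (antipode (unit_vec k) # \<rho>))"

lemma octahedral_sum_add:
  "octahedral_sum k (\<lambda>\<rho>. \<phi> \<rho> + \<psi> \<rho>) = octahedral_sum k \<phi> + octahedral_sum k \<psi>"
  by (induction k arbitrary: \<phi> \<psi>) (simp_all add: algebra_simps)

lemma octahedral_sum_zero [simp]: "octahedral_sum k (\<lambda>_. 0) = 0"
  by (induction k) simp_all

text \<open>The facets form a cycle: the face opposite to \<open>unit_vec k\<close> is also opposite
  to its antipode and is counted twice, and the remaining faces cancel by induction.\<close>

lemma octahedral_sum_coboundary [simp]: "octahedral_sum k (coboundary \<phi>) = 0"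
proof (induction k arbitrary: \<phi>)
  case (Suc k)
  then show ?case using octahedral_sum_add[of k \<phi>] by simp
qed simp

lemma antipode_antipode [simp]: "antipode (antipode x) = x"
  by (simp add: antipode_def)

lemma octahedral_sum_antipode:
  "octahedral_sum k (\<lambda>\<rho>. \<phi> (map antipode \<rho>)) = octahedral_sum k \<phi>"
proof (induction k arbitrary: \<phi>)
  case (Suc k)
  show ?case
    using Suc.IH[of "\<lambda>\<rho>. \<phi> (unit_vec k # \<rho>)"] Suc.IH[of "\<lambda>\<rho>. \<phi> (antipode (unit_vec k) # \<rho>)"]
    by (simp add: add.commute)
qed simp

definition octahedral_face :: "(nat \<Rightarrow> real) \<Rightarrow> nat \<Rightarrow> (nat \<Rightarrow> real) set" where
  "octahedral_face s k = {x. (\<forall>i. 0 \<le> s i * x i) \<and> (\<Sum>i<k. s i * x i) = 1 \<and> (\<forall>i\<ge>k. x i = 0)}"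

lemma octahedral_sum_cong:
  assumes "\<And>s \<rho>. (\<forall>i. \<bar>s i\<bar> = 1) \<Longrightarrow> length \<rho> = k \<Longrightarrow> set \<rho> \<subseteq> {x. \<exists>i<k. x = (\<lambda>j. s i * unit_vec i j)} \<Longrightarrow> \<phi> \<rho> = \<psi> \<rho>"
  shows "octahedral_sum k \<phi> = octahedral_sum k \<psi>"
  using assms
proof (induction k arbitrary: \<phi> \<psi>)
  case 0
  show ?case using 0[of "\<lambda>_. 1" "[]"] by simp
next
  case (Suc k)
  have *: "octahedral_sum k (\<lambda>\<rho>. \<phi> ((\<lambda>j. t * unit_vec k j) # \<rho>)) = octahedral_sum k (\<lambda>\<rho>. \<psi> ((\<lambda>j. t * unit_vec k j) # \<rho>))"
    if t: "\<bar>t\<bar> = 1" for t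
  proof (rule Suc.IH)
    fix s :: "nat \<Rightarrow> real" and \<rho> :: "(nat \<Rightarrow> real) list"
    assume s: "\<forall>i. \<bar>s i\<bar> = 1" and \<rho>: "length \<rho> = k" "set \<rho> \<subseteq> {x. \<exists>i<k. x = (\<lambda>j. s i * unit_vec i j)}"
    have "(\<lambda>j. s i * unit_vec i j) = (\<lambda>j. (s(k := t)) i * unit_vec i j)" if "i < k" for i using that by auto
    then have sub: "set \<rho> \<subseteq> {x. \<exists>i<Suc k. x = (\<lambda>j. (s(k := t)) i * unit_vec i j)}"
      using \<rho>(2) by (fastforce simp: less_Suc_eq)
    show "\<phi> ((\<lambda>j. t * unit_vec k j) # \<rho>) = \<psi> ((\<lambda>j. t * unit_vec k j) # \<rho>)"
      by (rule Suc.prems[of "s(k := t)"]) (use s t \<rho> sub in auto)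
  qed
  show ?case using *[of 1] *[of "-1"] by (simp add: antipode_def)
qed

lemma signed_unit_vec_in_face:
  assumes "\<forall>i. \<bar>s i\<bar> = (1 :: real)" "i < k"
  shows "(\<lambda>j. s i * unit_vec i j) \<in> octahedral_face s k"
proof -
  have "s i * s i = 1" using assms(1) by (metis abs_mult_self_eq mult_1)
  then show ?thesis using assms(2) by (auto simp: octahedral_face_def unit_vec_def if_distrib cong: if_cong)
qed

lemma sum_list_sum_swap: "(\<Sum>x\<leftarrow>xs. \<Sum>i\<in>A. f x i) = (\<Sum>i\<in>A. \<Sum>x\<leftarrow>xs. (f x i :: real))"
  by (induction xs) (auto simp: sum.distrib)

lemma barycenters_octahedral_face:
  assumes "S \<subseteq> octahedral_face s k"
  shows "barycenters S \<subseteq> octahedral_face s k"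
proof
  fix x assume "x \<in> barycenters S"
  then obtain \<tau> where \<tau>: "x = barycenter \<tau>" "\<tau> \<noteq> []" "set \<tau> \<subseteq> octahedral_face s k"
    using assms by (auto simp: barycenters_def)
  have sx: "s i * x i = (\<Sum>v\<leftarrow>\<tau>. s i * v i) / real (length \<tau>)" for i
    by (simp add: \<tau>(1) barycenter_def sum_list_const_mult)
  have "0 \<le> s i * x i" for i
    unfolding sx using \<tau>(3) by (intro divide_nonneg_nonneg sum_list_nonneg) (auto simp: octahedral_face_def)
  moreover have "(\<Sum>i<k. s i * x i) = 1"
  proof -
    have "(\<Sum>i<k. s i * x i) = (\<Sum>v\<leftarrow>\<tau>. \<Sum>i<k. s i * v i) / real (length \<tau>)"
      unfolding sx sum_list_sum_swap by (simp add: sum_divide_distrib)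
    also have "(\<Sum>v\<leftarrow>\<tau>. \<Sum>i<k. s i * v i) = (\<Sum>v\<leftarrow>\<tau>. 1)"
      using \<tau>(3) by (intro arg_cong[of _ _ sum_list] map_cong) (auto simp: octahedral_face_def)
    also have "\<dots> = real (length \<tau>)" by (simp add: sum_list_triv)
    finally show ?thesis using \<tau>(2) by simp
  qed
  moreover have "x i = 0" if "i \<ge> k" for i
  proof -
    have "(\<Sum>v\<leftarrow>\<tau>. v i) = (\<Sum>v\<leftarrow>\<tau>. 0)"
      using \<tau>(3) that by (intro arg_cong[of _ _ sum_list] map_cong) (auto simp: octahedral_face_def)
    then show ?thesis by (simp add: \<tau>(1) barycenter_def)
  qed
  ultimately show "x \<in> octahedral_face s k" by (simp add: octahedral_face_def)
qed

definition cross_polytope :: "nat \<Rightarrow> (nat \<Rightarrow> real) set" where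
  "cross_polytope k = {x. (\<Sum>i<k. \<bar>x i\<bar>) = 1 \<and> (\<forall>i\<ge>k. x i = 0)}"

lemma octahedral_face_subset_cross_polytope:
  assumes "\<forall>i. \<bar>s i\<bar> = 1"
  shows "octahedral_face s k \<subseteq> cross_polytope k"
proof
  fix x assume x: "x \<in> octahedral_face s k"
  have "\<bar>x i\<bar> = s i * x i" for i
    using assms x abs_of_nonneg[of "s i * x i"] by (auto simp: octahedral_face_def abs_mult)
  then show "x \<in> cross_polytope k" using x by (simp add: octahedral_face_def cross_polytope_def)
qed

lemma abs_le_1_cross_polytope: "x \<in> cross_polytope k \<Longrightarrow> \<bar>x i\<bar> \<le> 1"
  using member_le_sum[of i "{..<k}" "\<lambda>i. \<bar>x i\<bar>"] by (cases "i < k") (auto simp: cross_polytope_def)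

text \<open>Fan's count: the parity of the number of alternating simplices in the \<open>j\<close>-dimensional
  hemisphere does not depend on \<open>j\<close>. It is odd for \<open>j = 0\<close>, and there are not enough labels for an
  alternating simplex of dimension \<open>m + 1\<close>.\<close>

lemma no_antisymmetric_labelling:
  fixes lab :: "(nat \<Rightarrow> real) \<Rightarrow> nat \<times> bool" and m :: nat
  defines "P \<equiv> cross_polytope (m + 2)"
  assumes bound: "\<And>x. x \<in> P \<Longrightarrow> fst (lab x) \<le> m"
    and odd: "\<And>x. x \<in> P \<Longrightarrow> lab (antipode x) = apsnd Not (lab x)"
    and "\<epsilon> > 0"
    and close: "\<And>x y. x \<in> P \<Longrightarrow> y \<in> P \<Longrightarrow> (\<forall>i. \<bar>x i - y i\<bar> \<le> \<epsilon>) \<Longrightarrow> fst (lab x) = fst (lab y) \<Longrightarrow> lab x = lab y"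
  shows False
proof -
  \<comment> \<open>The contraction factor for lists of at most m + 2 vertices; \<open>k0\<close>
    subdivisions bring the initial diameter 2 below \<epsilon>.\<close>
  define q where "q = real (m + 1) / real (Suc (m + 1))"
  have "(\<lambda>k. q ^ k) \<longlonglongrightarrow> 0" by (rule LIMSEQ_realpow_zero) (auto simp: q_def)
  then have "\<forall>\<^sub>F k in sequentially. q ^ k < \<epsilon> / 2" by (rule order_tendstoD) (use \<open>\<epsilon> > 0\<close> in simp)
  then obtain k0 where k0: "q ^ k0 * 2 \<le> \<epsilon>"
    by (auto simp: eventually_sequentially) (meson less_eq_real_def order_refl)
  define S where "S = (subdivide ^^ k0)"
  define p where "p = (\<lambda>b \<sigma>. of_bool (fan_alternating b (mset (map lab \<sigma>))) :: bit)"
  have cob_p: "coboundary (p True) \<sigma> = p True \<sigma> + p False \<sigma>"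
    if \<sigma>: "set \<sigma> \<subseteq> P" "close_points \<epsilon> (set \<sigma>)" for \<sigma>
  proof -
    have "coboundary (p True) \<sigma> = coboundary (\<lambda>\<rho>. of_bool (fan_alternating True (mset \<rho>))) (map lab \<sigma>)"
      unfolding p_def by (rule coboundary_map)
    also have "\<dots> = p True \<sigma> + p False \<sigma>"
      unfolding p_def
    proof (rule coboundary_fan_alternating)
      fix u w assume "u \<in> set (map lab \<sigma>)" "w \<in> set (map lab \<sigma>)" "fst u = fst w"
      then obtain x y where "x \<in> set \<sigma>" "y \<in> set \<sigma>" "u = lab x" "w = lab y" "fst (lab x) = fst (lab y)" by auto
      then show "u = w" using close \<sigma> by (auto simp: close_points_def subset_iff)
    qed
    finally show ?thesis .
  qed
  have agree: "octahedral_sum j (\<lambda>\<rho>. S \<phi> (unit_vec j # \<rho>)) = octahedral_sum j (\<lambda>\<rho>. S \<psi> (unit_vec j # \<rho>))"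
    if j: "j \<le> m + 1" and \<phi>\<psi>: "\<And>\<rho>. length \<rho> = Suc j \<Longrightarrow> set \<rho> \<subseteq> P \<Longrightarrow> close_points \<epsilon> (set \<rho>) \<Longrightarrow> \<phi> \<rho> = \<psi> \<rho>" for j \<phi> \<psi>
  proof (rule octahedral_sum_cong)
    fix s :: "nat \<Rightarrow> real" and \<rho> :: "(nat \<Rightarrow> real) list"
    assume s: "\<forall>i. \<bar>s i\<bar> = 1" and \<rho>: "length \<rho> = j" "set \<rho> \<subseteq> {x. \<exists>i<j. x = (\<lambda>l. s i * unit_vec i l)}"
    \<comment> \<open>The cone from \<open>unit_vec j\<close> over a facet of the equator is a face
      of the full-dimensional facet with the signs \<open>s'\<close>; that facet is closed under
      barycenters, so all subdivision points stay in \<open>P\<close>.\<close>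
    define s' where "s' = s(j := 1)"
    have s': "\<forall>i. \<bar>s' i\<bar> = 1" using s by (simp add: s'_def)
    define C where "C = octahedral_face s' (m + 2)"
    have CP: "C \<subseteq> P" unfolding C_def P_def using octahedral_face_subset_cross_polytope[OF s'] .
    have vert: "(\<lambda>l. s' i * unit_vec i l) \<in> C" if "i \<le> j" for i
      unfolding C_def by (rule signed_unit_vec_in_face[OF s']) (use that j in auto)
    have "unit_vec j \<in> C" using vert[of j] by (simp add: s'_def)
    moreover have "set \<rho> \<subseteq> C"
    proof
      fix x assume "x \<in> set \<rho>"
      then obtain i where "i < j" "x = (\<lambda>l. s i * unit_vec i l)" using \<rho>(2) by blast
      then show "x \<in> C" using vert[of i] by (simp add: s'_def)
    qed
    ultimately have sub: "set (unit_vec j # \<rho>) \<subseteq> C" by simp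
    show "S \<phi> (unit_vec j # \<rho>) = S \<psi> (unit_vec j # \<rho>)"
      unfolding S_def
    proof (rule subdivide_pow_cong[OF _ sub])
      show "barycenters T \<subseteq> C" if "T \<subseteq> C" for T
        using that barycenters_octahedral_face unfolding C_def by blast
      show "close_points 2 (set (unit_vec j # \<rho>))"
        unfolding close_points_def
      proof (intro ballI allI)
        fix x y i assume "x \<in> set (unit_vec j # \<rho>)" "y \<in> set (unit_vec j # \<rho>)"
        then have "x \<in> P" "y \<in> P" using sub CP by blast+
        then have "\<bar>x i\<bar> \<le> 1" "\<bar>y i\<bar> \<le> 1" unfolding P_def by (auto intro: abs_le_1_cross_polytope)
        then show "\<bar>x i - y i\<bar> \<le> 2" by linarith
      qed
      show "length (unit_vec j # \<rho>) \<le> Suc (m + 1)" using j \<rho>(1) by simp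
      fix \<rho>' assume \<rho>': "length \<rho>' = length (unit_vec j # \<rho>)" "set \<rho>' \<subseteq> C"
        "close_points ((real (m + 1) / real (Suc (m + 1))) ^ k0 * 2) (set \<rho>')"
      then have "close_points \<epsilon> (set \<rho>')"
        using k0 unfolding q_def[symmetric] close_points_def by (meson order_trans)
      then show "\<phi> \<rho>' = \<psi> \<rho>'" using \<phi>\<psi> \<rho>' \<rho>(1) CP by auto
    qed simp
  qed
  \<comment> \<open>The parity of the alternating j-simplices, of either sign, in the subdivided
    upper hemisphere of the j-sphere; the hemisphere is a cone with apex
    \<open>unit_vec j\<close>.\<close>
  define A where "A = (\<lambda>j. octahedral_sum j (\<lambda>\<rho>. S (\<lambda>\<sigma>. p True \<sigma> + p False \<sigma>) (unit_vec j # \<rho>)))"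
  have step: "A (Suc j) = A j" if j: "Suc j \<le> m + 1" for j
  proof -
    \<comment> \<open>The count is the coboundary of \<open>p True\<close>, and subdivision commutes
      with coboundaries. Summed over the cones, the terms that contain the apex cancel because the
      base is a cycle, and only the sum over the base, the j-sphere, remains.\<close>
    have "A (Suc j) = octahedral_sum (Suc j) (\<lambda>\<rho>. S (coboundary (p True)) (unit_vec (Suc j) # \<rho>))"
      unfolding A_def using j by (intro agree cob_p[symmetric])
    also have "\<dots> = octahedral_sum (Suc j) (\<lambda>\<rho>. S (p True) \<rho> + coboundary (\<lambda>\<tau>. S (p True) (unit_vec (Suc j) # \<tau>)) \<rho>)"
      unfolding S_def by (simp only: subdivide_pow_coboundary coboundary.simps)
    also have "\<dots> = octahedral_sum (Suc j) (S (p True))"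
      unfolding octahedral_sum_add octahedral_sum_coboundary by simp
    also have "\<dots> = octahedral_sum j (\<lambda>\<rho>. S (p True) (unit_vec j # \<rho>)) +
        octahedral_sum j (\<lambda>\<rho>. S (p True) (antipode (unit_vec j) # \<rho>))"
      by simp
    \<comment> \<open>The lower hemisphere is the antipodal image of the upper one, and the antipode
      exchanges the two kinds of alternating simplices.\<close>
    also have "octahedral_sum j (\<lambda>\<rho>. S (p True) (antipode (unit_vec j) # \<rho>))
        = octahedral_sum j (\<lambda>\<rho>. S (p True) (map antipode (unit_vec j # \<rho>)))"
      using octahedral_sum_antipode[of j "\<lambda>\<rho>. S (p True) (antipode (unit_vec j) # \<rho>)"] by simp
    also have "\<dots> = octahedral_sum j (\<lambda>\<rho>. S (\<lambda>\<tau>. p True (map antipode \<tau>)) (unit_vec j # \<rho>))"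
      unfolding S_def subdivide_pow_antipode ..
    also have "\<dots> = octahedral_sum j (\<lambda>\<rho>. S (p False) (unit_vec j # \<rho>))"
    proof (rule agree)
      fix \<rho> :: "(nat \<Rightarrow> real) list" assume "set \<rho> \<subseteq> P"
      then have "map lab (map antipode \<rho>) = map (apsnd Not) (map lab \<rho>)" using odd by auto
      then have "mset (map lab (map antipode \<rho>)) = image_mset (apsnd Not) (mset (map lab \<rho>))"
        by (metis mset_map)
      then show "p True (map antipode \<rho>) = p False \<rho>"
        unfolding p_def by (simp only: fan_alternating_flip) simp
    qed (use j in simp)
    also have "octahedral_sum j (\<lambda>\<rho>. S (p True) (unit_vec j # \<rho>)) + \<dots> = A j"
      unfolding A_def S_def subdivide_pow_add octahedral_sum_add ..
    finally show ?thesis .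
  qed
  have "A j = A 0" if "j \<le> m + 1" for j using that
  proof (induction j)
    case (Suc j)
    have "A (Suc j) = A j" using Suc.prems by (rule step)
    also have "\<dots> = A 0" using Suc.prems by (intro Suc.IH) linarith
    finally show ?case .
  qed (rule refl)
  from this[OF order_refl] have "A (m + 1) = A 0" .
  moreover have "A 0 = 1"
  proof -
    have "A 0 = p True [unit_vec 0] + p False [unit_vec 0]"
      by (simp add: A_def S_def subdivide_pow_singleton)
    moreover have "fan_alternating b {#u#} \<longleftrightarrow> snd u = b" for b u
      using fan_alternating_mset[of "[u]" b] by simp
    ultimately show ?thesis by (cases "snd (lab (unit_vec 0))") (simp_all add: p_def)
  qed
  moreover have "A (m + 1) = 0"
  proof -
    have "A (m + 1) = octahedral_sum (m + 1) (\<lambda>\<rho>. S (\<lambda>_. 0) (unit_vec (m + 1) # \<rho>))"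
      unfolding A_def
    proof (rule agree)
      fix \<rho> :: "(nat \<Rightarrow> real) list" assume \<rho>: "length \<rho> = Suc (m + 1)" "set \<rho> \<subseteq> P"
      \<comment> \<open>Here there are m + 2 vertices, but only the m + 1 indices 0 to m.\<close>
      have "\<not> fan_alternating b (mset (map lab \<rho>))" for b
        by (rule not_fan_alternating_size[of _ m]) (use \<rho> bound in auto)
      then show "p True \<rho> + p False \<rho> = 0" by (simp add: p_def)
    qed simp
    \<comment> \<open>Additivity gives S 0 = S 0 + S 0, and a bit added to itself is 0.\<close>
    also have "S (\<lambda>_. 0) = (\<lambda>\<sigma>. S (\<lambda>_. 0) \<sigma> + S (\<lambda>_. 0) \<sigma>)"
      unfolding S_def using subdivide_pow_add[of k0 "\<lambda>_. 0" "\<lambda>_. 0"] by simp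
    also have "\<dots> = (\<lambda>_. 0)" by simp
    finally show ?thesis by (simp only: octahedral_sum_zero)
  qed
  ultimately show False by simp
qed

section \<open>From antisymmetric labellings to continuous odd maps\<close>

lemma compact_cross_polytope: "compact (cross_polytope k)"
proof -
  have "compactin (product_topology (\<lambda>i::nat. euclideanreal) UNIV) (Pi\<^sub>E UNIV (\<lambda>_. {-1..1}))"
    by (simp add: compactin_PiE)
  then have "compact (Pi\<^sub>E UNIV (\<lambda>_. {-1..1}) :: (nat \<Rightarrow> real) set)"
    by (simp add: euclidean_product_topology)
  moreover have "cross_polytope k \<subseteq> Pi\<^sub>E UNIV (\<lambda>_. {-1..1})"
    using abs_le_1_cross_polytope by (fastforce simp: abs_le_iff)
  moreover have "closed (cross_polytope k)"
  proof -
    have "closed {x :: nat \<Rightarrow> real. (\<Sum>i<k. \<bar>x i\<bar>) = 1}"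
      by (intro closed_Collect_eq continuous_intros continuous_on_product_coordinates)
    moreover have "closed {x :: nat \<Rightarrow> real. \<forall>i. k \<le> i \<longrightarrow> x i = 0}"
      by (intro closed_Collect_all closed_Collect_imp closed_Collect_eq continuous_intros open_Collect_const continuous_on_product_coordinates)
    ultimately have "closed ({x. (\<Sum>i<k. \<bar>x i\<bar>) = 1} \<inter> {x :: nat \<Rightarrow> real. \<forall>i. k \<le> i \<longrightarrow> x i = 0})" by (rule closed_Int)
    then show ?thesis by (simp add: cross_polytope_def Collect_conj_eq)
  qed
  ultimately show ?thesis using compact_Int_closed by (metis inf.absorb_iff2)
qed

text \<open>The metric on functions weights the coordinates by (1/2)^n, and these weights sum to
  2.\<close>

lemma dist_fun_le_sup:
  fixes x y :: "nat \<Rightarrow> real"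
  assumes "\<And>i. \<bar>x i - y i\<bar> \<le> e"
  shows "dist x y \<le> 2 * e"
proof -
  have s: "summable (\<lambda>n. (1/2)^n * min (dist (x (from_nat n)) (y (from_nat n))) 1)"
    by (rule summable_comparison_test'[of "\<lambda>n. (1/2)^n"]) (auto simp add: summable_geometric_iff)
  have "dist x y \<le> (\<Sum>n. (1/2)^n * e)"
    unfolding dist_fun_def
  proof (rule suminf_le[OF _ s])
    fix n
    have "min (dist (x (from_nat n)) (y (from_nat n))) 1 \<le> e"
      using assms[of "from_nat n"] by (simp add: dist_real_def min_le_iff_disj)
    then show "(1/2)^n * min (dist (x (from_nat n)) (y (from_nat n))) 1 \<le> (1/2)^n * e"
      by (rule mult_left_mono) simp
  qed (auto intro: summable_mult2 simp: summable_geometric_iff)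
  also have "\<dots> = (\<Sum>n. (1/2)^n) * e" by (rule suminf_mult2[symmetric]) (simp add: summable_geometric_iff)
  also have "(\<Sum>n. (1/2)^n) = (2 :: real)" using suminf_geometric[of "1/2 :: real"] by simp
  finally show ?thesis .
qed

lemma nsphere_eq_top_of_set: "nsphere n = top_of_set (sphere_set n)"
  by (simp add: nsphere euclidean_product_topology)

lemma continuous_map_nsphere_iff:
  "continuous_map (nsphere n) (nsphere m) f \<longleftrightarrow> continuous_on (sphere_set n) f \<and> f \<in> sphere_set n \<rightarrow> sphere_set m"
proof -
  have "continuous_map (top_of_set (sphere_set n)) (top_of_set (sphere_set m)) f
      \<longleftrightarrow> continuous_on (sphere_set n) f \<and> f \<in> sphere_set n \<rightarrow> sphere_set m"
    by (auto simp: continuous_map_in_subtopology image_subset_iff_funcset)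
  then show ?thesis by (simp only: nsphere_eq_top_of_set[symmetric])
qed

text \<open>If m < n, radial projection makes f an odd map from the (m + 1)-dimensional boundary of
  a cross-polytope to the m-sphere. Labelling a point by the first coordinate of its image of size
  at least c, together with the sign of this coordinate, contradicts the combinatorial lemma: nearby
  points have images that differ by less than c in each coordinate, so equal indices force equal
  signs.\<close>

theorem Borsuk_Ulam:
  assumes f: "continuous_map (nsphere n) (nsphere m) f"
    and odd: "\<And>x. x \<in> sphere_set n \<Longrightarrow> f (antipode x) = antipode (f x)"
  shows "n \<le> m"
proof (rule ccontr)
  assume "\<not> n \<le> m"
  define P where "P = cross_polytope (m + 2)"
  define r where "r = (\<lambda>x :: nat \<Rightarrow> real. sqrt (\<Sum>i\<le>m+1. (x i)\<^sup>2))"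
  define \<nu> where "\<nu> = (\<lambda>(x :: nat \<Rightarrow> real) i. x i / r x)"
  have r: "r x > 0" if "x \<in> P" for x
  proof -
    have "0 \<le> (\<Sum>i\<le>m+1. (x i)\<^sup>2)" by (intro sum_nonneg) auto
    moreover have "(\<Sum>i\<le>m+1. (x i)\<^sup>2) \<noteq> 0"
    proof
      assume "(\<Sum>i\<le>m+1. (x i)\<^sup>2) = 0"
      then have "\<forall>i\<in>{..m+1}. (x i)\<^sup>2 = 0" by (subst (asm) sum_nonneg_eq_0_iff) auto
      then have "(\<Sum>i<m+2. \<bar>x i\<bar>) = 0" by simp
      then show False using that by (simp add: P_def cross_polytope_def)
    qed
    ultimately show ?thesis unfolding r_def real_sqrt_gt_0_iff by linarith
  qed
  have \<nu>_sphere: "\<nu> x \<in> sphere_set n" if "x \<in> P" for x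
  proof -
    have x0: "x i = 0" if "i > m + 1" for i using \<open>x \<in> P\<close> that by (simp add: P_def cross_polytope_def)
    have "(\<Sum>i\<le>n. (\<nu> x i)\<^sup>2) = (\<Sum>i\<le>n. (x i)\<^sup>2) / (r x)\<^sup>2"
      by (simp add: \<nu>_def power_divide sum_divide_distrib)
    also have "(\<Sum>i\<le>n. (x i)\<^sup>2) = (\<Sum>i\<le>m+1. (x i)\<^sup>2)"
      by (rule sum.mono_neutral_right) (use x0 \<open>\<not> n \<le> m\<close> in auto)
    also have "\<dots> = (r x)\<^sup>2" by (simp add: r_def sum_nonneg)
    finally show ?thesis using r[OF that] x0 \<open>\<not> n \<le> m\<close> by (simp add: in_sphere_set_iff \<nu>_def)
  qed
  have \<nu>_anti: "\<nu> (antipode x) = antipode (\<nu> x)" for x by (simp add: \<nu>_def r_def antipode_def)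
  have cont_r: "continuous_on P r" unfolding r_def
    by (intro continuous_intros continuous_on_subset[OF continuous_on_product_coordinates] subset_UNIV)
  have cont_\<nu>: "continuous_on P \<nu>"
  proof (rule continuous_on_coordinatewise_then_product)
    fix i
    show "continuous_on P (\<lambda>x. \<nu> x i)" unfolding \<nu>_def
      using r by (intro continuous_on_divide cont_r continuous_on_subset[OF continuous_on_product_coordinates] subset_UNIV) force
  qed
  define g where "g = (\<lambda>x. f (\<nu> x))"
  have g_sphere: "g x \<in> sphere_set m" if "x \<in> P" for x
    using f \<nu>_sphere[OF that] unfolding g_def continuous_map_nsphere_iff by blast
  have g_anti: "g (antipode x) = antipode (g x)" if "x \<in> P" for x
    using odd \<nu>_sphere[OF that] by (simp add: g_def \<nu>_anti)
  have cont_g: "continuous_on P g"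
    unfolding g_def
    by (rule continuous_on_compose2[of "sphere_set n" f P \<nu>])
      (use f cont_\<nu> \<nu>_sphere in \<open>auto simp only: continuous_map_nsphere_iff\<close>)
  \<comment> \<open>A unit vector with m + 1 coordinates has one of absolute value at least
    c.\<close>
  define c where "c = sqrt (1 / (real m + 1))"
  have c0: "c > 0" by (simp add: c_def)
  have big: "\<exists>i\<le>m. c \<le> \<bar>y i\<bar>" if y: "y \<in> sphere_set m" for y
  proof (rule ccontr)
    assume "\<not> (\<exists>i\<le>m. c \<le> \<bar>y i\<bar>)"
    then have "\<bar>y i\<bar> < c" if "i \<le> m" for i using that by (meson not_le)
    then have "\<bar>y i\<bar>\<^sup>2 < c\<^sup>2" if "i \<le> m" for i
      using that by (intro power_strict_mono) auto
    then have "(\<Sum>i\<le>m. (y i)\<^sup>2) < (\<Sum>i\<le>m. c\<^sup>2)" by (intro sum_strict_mono) auto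
    also have "\<dots> = 1" by (simp add: c_def)
    finally show False using y by (simp add: in_sphere_set_iff)
  qed
  have "\<exists>\<epsilon>>0. \<forall>x\<in>P. \<forall>y\<in>P. \<forall>i\<in>{..m}. dist x y < \<epsilon> \<longrightarrow> \<bar>g x i - g y i\<bar> < c"
  proof -
    have "\<exists>\<epsilon>>0. \<forall>x\<in>P. \<forall>y\<in>P. dist x y < \<epsilon> \<longrightarrow> \<bar>g x i - g y i\<bar> < c" for i
    proof -
      have "continuous_on P (\<lambda>x. g x i)"
        using continuous_on_product_then_coordinatewise[OF cont_g] by simp
      then have "uniformly_continuous_on P (\<lambda>x. g x i)"
        using compact_cross_polytope unfolding P_def by (rule compact_uniformly_continuous)
      then show ?thesis unfolding uniformly_continuous_on_def dist_real_def using c0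
        by (metis abs_minus_commute dist_commute)
    qed
    then obtain \<epsilon> where \<epsilon>: "\<And>i. \<epsilon> i > 0" "\<And>i x y. x \<in> P \<Longrightarrow> y \<in> P \<Longrightarrow> dist x y < \<epsilon> i \<Longrightarrow> \<bar>g x i - g y i\<bar> < c"
      by metis
    show ?thesis
      by (rule exI[of _ "Min (\<epsilon> ` {..m})"]) (use \<epsilon> in auto)
  qed
  then obtain \<epsilon> where \<epsilon>: "\<epsilon> > 0" "\<And>x y i. x \<in> P \<Longrightarrow> y \<in> P \<Longrightarrow> i \<le> m \<Longrightarrow> dist x y < \<epsilon> \<Longrightarrow> \<bar>g x i - g y i\<bar> < c"
    by blast
  define I where "I = (\<lambda>x. LEAST i. c \<le> \<bar>g x i\<bar>)"
  have I: "I x \<le> m" "c \<le> \<bar>g x (I x)\<bar>" if x: "x \<in> P" for x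
  proof -
    obtain i where i: "i \<le> m" "c \<le> \<bar>g x i\<bar>" using big[OF g_sphere[OF x]] by blast
    show "c \<le> \<bar>g x (I x)\<bar>" unfolding I_def using i(2) by (rule LeastI)
    show "I x \<le> m" unfolding I_def using Least_le[of "\<lambda>i. c \<le> \<bar>g x i\<bar>" i] i by simp
  qed
  show False
  proof (rule no_antisymmetric_labelling[of m "\<lambda>x. (I x, 0 < g x (I x))" "\<epsilon> / 3", folded P_def])
    fix x assume x: "x \<in> P"
    show "fst (I x, 0 < g x (I x)) \<le> m" using I[OF x] by simp
    have g_val: "g (antipode x) i = - g x i" for i using g_anti[OF x] by (simp add: antipode_def)
    then have "I (antipode x) = I x" by (simp add: I_def)
    moreover have "g x (I x) \<noteq> 0" using I(2)[OF x] c0 by auto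
    ultimately show "(I (antipode x), 0 < g (antipode x) (I (antipode x))) = apsnd Not (I x, 0 < g x (I x))"
      using g_val by auto
  next
    show "\<epsilon> / 3 > 0" using \<epsilon>(1) by simp
    fix x y assume xy: "x \<in> P" "y \<in> P" "\<forall>i. \<bar>x i - y i\<bar> \<le> \<epsilon> / 3"
      "fst (I x, 0 < g x (I x)) = fst (I y, 0 < g y (I y))"
    have "dist x y \<le> 2 * (\<epsilon> / 3)" using xy(3) by (intro dist_fun_le_sup) blast
    then have "dist x y < \<epsilon>" using \<epsilon>(1) by simp
    then have "\<bar>g x (I x) - g y (I x)\<bar> < c" using \<epsilon>(2) xy I by blast
    then show "(I x, 0 < g x (I x)) = (I y, 0 < g y (I y))"
      using I(2)[OF xy(1)] I(2)[OF xy(2)] xy(4) c0 by auto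
  qed
qed

section \<open>Vietoris--Rips complexes of spheres\<close>

lemma continuous_map_from_realization:
  assumes "\<And>\<sigma>. \<sigma> \<in> K \<Longrightarrow> continuous_map (subtopology (powertop_real UNIV) (closed_simplex K \<sigma>)) Y u"
  shows "continuous_map (realization K) Y u"
  unfolding continuous_map_def topspace_realization
proof (intro conjI allI impI)
  show "u \<in> realization_points K \<rightarrow> topspace Y"
  proof
    fix t assume t: "t \<in> realization_points K"
    define \<sigma> where "\<sigma> = {v. t v \<noteq> 0}"
    have "\<sigma> \<in> K" "t \<in> closed_simplex K \<sigma>" using t by (auto simp: realization_points_def closed_simplex_def \<sigma>_def)
    then show "u t \<in> topspace Y" using assms[OF \<open>\<sigma> \<in> K\<close>] by (auto simp: continuous_map_def)
  qed
  fix U assume U: "openin Y U"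
  show "openin (realization K) {x \<in> realization_points K. u x \<in> U}"
    unfolding openin_realization
  proof (intro conjI ballI)
    fix \<sigma> assume "\<sigma> \<in> K"
    then have "openin (subtopology (powertop_real UNIV) (closed_simplex K \<sigma>)) {x \<in> closed_simplex K \<sigma>. u x \<in> U}"
      using assms[of \<sigma>] U by (auto simp: continuous_map_def)
    moreover have "{x \<in> closed_simplex K \<sigma>. u x \<in> U} = {x \<in> realization_points K. u x \<in> U} \<inter> closed_simplex K \<sigma>"
      by (auto simp: closed_simplex_def)
    ultimately show "openin (subtopology (powertop_real UNIV) (closed_simplex K \<sigma>))
        ({x \<in> realization_points K. u x \<in> U} \<inter> closed_simplex K \<sigma>)" by simp
  qed auto
qed

text \<open>On a single closed simplex the weak topology is the coordinatewise one; this is why the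
  image has to lie in one simplex and why maps are later pasted from pieces.\<close>

lemma continuous_map_into_realization:
  assumes F: "continuous_map X (powertop_real UNIV) F" and "\<sigma> \<in> K"
    and sub: "\<And>x. x \<in> topspace X \<Longrightarrow> F x \<in> closed_simplex K \<sigma>"
  shows "continuous_map X (realization K) F"
  unfolding continuous_map_def topspace_realization
proof (intro conjI allI impI)
  show "F \<in> topspace X \<rightarrow> realization_points K" using sub by (auto simp: closed_simplex_def)
  fix U assume "openin (realization K) U"
  then have o: "openin (subtopology (powertop_real UNIV) (closed_simplex K \<sigma>)) (U \<inter> closed_simplex K \<sigma>)"
    using \<open>\<sigma> \<in> K\<close> by (auto simp: openin_realization)
  have "continuous_map X (subtopology (powertop_real UNIV) (closed_simplex K \<sigma>)) F"
    using F sub by (auto simp: continuous_map_in_subtopology)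
  then have "openin X {x \<in> topspace X. F x \<in> U \<inter> closed_simplex K \<sigma>}"
    using o by (auto simp: continuous_map_def)
  moreover have "{x \<in> topspace X. F x \<in> U \<inter> closed_simplex K \<sigma>} = {x \<in> topspace X. F x \<in> U}"
    using sub by auto
  ultimately show "openin X {x \<in> topspace X. F x \<in> U}" by simp
qed

section \<open>Scales below pi / 2\<close>

definition weighted_sum :: "((nat \<Rightarrow> real) \<Rightarrow> real) \<Rightarrow> nat \<Rightarrow> real" where
  "weighted_sum t i = (\<Sum>v | t v \<noteq> 0. t v * v i)"

lemma weighted_sum_eq:
  assumes "finite \<sigma>" "{v. t v \<noteq> 0} \<subseteq> \<sigma>"
  shows "weighted_sum t i = (\<Sum>v\<in>\<sigma>. t v * v i)"
  unfolding weighted_sum_def by (rule sum.mono_neutral_left) (use assms in auto)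

lemma weighted_sum_antipode: "weighted_sum (VR_antipode t) = antipode (weighted_sum t)"
proof
  fix i
  have "(\<Sum>v | t (antipode v) \<noteq> 0. t (antipode v) * v i) = (\<Sum>v | t v \<noteq> 0. t v * antipode v i)"
    by (rule sum.reindex_bij_witness[of _ antipode antipode]) auto
  then show "weighted_sum (VR_antipode t) i = antipode (weighted_sum t) i"
    by (simp add: weighted_sum_def VR_antipode_def antipode_def sum_negf)
qed

text \<open>Any two vertices of the support have a positive inner product, so the weighted sum has a
  positive inner product with each of them.\<close>

lemma weighted_sum_nonzero:
  assumes t: "t \<in> realization_points (VR_complex (sphere_set m) (geodesic_dist m) r)" and r: "r < pi / 2"
  shows "0 < (\<Sum>i\<le>m. (weighted_sum t i)\<^sup>2)" "\<And>i. i > m \<Longrightarrow> weighted_sum t i = 0"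
proof -
  define \<sigma> where "\<sigma> = {v. t v \<noteq> 0}"
  have \<sigma>: "\<sigma> \<noteq> {}" "finite \<sigma>" "\<sigma> \<subseteq> sphere_set m" "\<And>x y. x \<in> \<sigma> \<Longrightarrow> y \<in> \<sigma> \<Longrightarrow> geodesic_dist m x y \<le> r"
    using t by (auto simp: realization_points_def VR_complex_def \<sigma>_def)
  have pos: "0 < t v" if "v \<in> \<sigma>" for v
    using t that by (auto simp: realization_points_def \<sigma>_def order_less_le)
  have inner: "0 < (\<Sum>i\<le>m. v i * w i)" if "v \<in> \<sigma>" "w \<in> \<sigma>" for v w
  proof -
    define c where "c = (\<Sum>i\<le>m. v i * w i)"
    have c: "\<bar>c\<bar> \<le> 1" unfolding c_def using that \<sigma>(3) by (intro sphere_inner_bounds) auto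
    have "arccos c < pi / 2" using \<sigma>(4)[OF that] r by (simp add: geodesic_dist_def c_def)
    moreover have "0 \<le> arccos c" using c arccos_lbound[of c] by (simp add: abs_le_iff)
    then have "- (pi / 2) < arccos c" using pi_gt_zero by linarith
    ultimately have "0 < cos (arccos c)" by (intro cos_gt_zero_pi)
    then show ?thesis using c by (simp add: c_def)
  qed
  obtain w where w: "w \<in> \<sigma>" using \<sigma>(1) by blast
  have "(\<Sum>i\<le>m. weighted_sum t i * w i) = (\<Sum>v\<in>\<sigma>. t v * (\<Sum>i\<le>m. v i * w i))"
    unfolding weighted_sum_def \<sigma>_def[symmetric] sum_distrib_right sum_distrib_left
    by (subst sum.swap) (simp add: mult.assoc)
  also have "\<dots> > 0" by (rule sum_pos[OF \<sigma>(2,1)]) (rule mult_pos_pos[OF pos inner[OF _ w]])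
  finally have "(\<Sum>i\<le>m. weighted_sum t i * w i) \<noteq> 0" by simp
  then obtain i where i: "i \<le> m" "weighted_sum t i \<noteq> 0" by (metis (no_types, lifting) atMost_iff mult_zero_left sum.neutral)
  then show "0 < (\<Sum>i\<le>m. (weighted_sum t i)\<^sup>2)" by (intro sum_pos2[of _ i]) auto
  show "weighted_sum t i = 0" if "i > m" for i
    unfolding weighted_sum_def \<sigma>_def[symmetric] using \<sigma>(3) that by (intro sum.neutral) (auto simp: in_sphere_set_iff)
qed

lemma exists_odd_map_VR_to_sphere:
  assumes r: "r < pi / 2"
  obtains u where "continuous_map (VR_sphere m r) (nsphere m) u" "\<And>t. u (VR_antipode t) = antipode (u t)"
proof -
  define K where "K = VR_complex (sphere_set m) (geodesic_dist m) r"
  define N where "N = (\<lambda>t. sqrt (\<Sum>i\<le>m. (weighted_sum t i)\<^sup>2))"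
  define u where "u = (\<lambda>t i. weighted_sum t i / N t)"
  have N: "N t > 0" if "t \<in> realization_points K" for t
    using weighted_sum_nonzero(1)[OF that[unfolded K_def] r] by (simp add: N_def)
  have u_sphere: "u t \<in> sphere_set m" if t: "t \<in> realization_points K" for t
  proof -
    have "(\<Sum>i\<le>m. (u t i)\<^sup>2) = (\<Sum>i\<le>m. (weighted_sum t i)\<^sup>2) / (N t)\<^sup>2"
      by (simp add: u_def power_divide sum_divide_distrib)
    also have "(\<Sum>i\<le>m. (weighted_sum t i)\<^sup>2) = (N t)\<^sup>2" by (simp add: N_def sum_nonneg)
    finally show ?thesis
      using N[OF t] weighted_sum_nonzero(2)[OF t[unfolded K_def] r] by (simp add: in_sphere_set_iff u_def)
  qed
  have "continuous_map (realization K) (nsphere m) u"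
  proof (rule continuous_map_from_realization)
    fix \<sigma> assume "\<sigma> \<in> K"
    then have fin: "finite \<sigma>" by (simp add: K_def VR_complex_def)
    define C where "C = closed_simplex K \<sigma>"
    have CK: "t \<in> realization_points K" if "t \<in> C" for t using that by (simp add: C_def closed_simplex_def)
    \<comment> \<open>On one closed simplex the support-dependent sum is a sum over the fixed finite
      set \<sigma>, hence continuous.\<close>
    have ws: "continuous_on C (\<lambda>t. weighted_sum t i)" for i
    proof (rule continuous_on_cong[THEN iffD1, OF refl])
      show "continuous_on C (\<lambda>t. \<Sum>v\<in>\<sigma>. t v * v i)"
        by (intro continuous_intros continuous_on_subset[OF continuous_on_product_coordinates] subset_UNIV)
      show "(\<Sum>v\<in>\<sigma>. t v * v i) = weighted_sum t i" if "t \<in> C" for t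
        using that by (intro weighted_sum_eq[OF fin, symmetric]) (auto simp: C_def closed_simplex_def)
    qed
    have cN: "continuous_on C N" unfolding N_def by (intro continuous_intros ws)
    have "continuous_on C u"
    proof (rule continuous_on_coordinatewise_then_product)
      fix i show "continuous_on C (\<lambda>t. u t i)" unfolding u_def
        using N CK by (intro continuous_on_divide ws cN) force
    qed
    then have "continuous_map (top_of_set C) (top_of_set (sphere_set m)) u"
      using u_sphere CK by (auto simp: continuous_map_in_subtopology)
    then show "continuous_map (subtopology (powertop_real UNIV) (closed_simplex K \<sigma>)) (nsphere m) u"
      by (simp only: nsphere_eq_top_of_set[symmetric] C_def euclidean_product_topology)
  qed
  moreover have "u (VR_antipode t) = antipode (u t)" for t
    by (simp add: u_def N_def weighted_sum_antipode) (simp add: antipode_def)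
  ultimately show ?thesis using that[of u] by (simp add: VR_sphere_def K_def)
qed

text \<open>If every admissible k were below n, the supremum would be at most n - 1. For n = 0 this
  would fail: the supremum of the empty set in \<open>enat\<close> is 0.\<close>

lemma le_coind_imp_ex_odd_map:
  assumes "enat n \<le> coind X a" "0 < n"
  obtains k f where "n \<le> k" "continuous_map (nsphere k) X f" "\<And>x. x \<in> sphere_set k \<Longrightarrow> f (antipode x) = a (f x)"
proof -
  have "\<exists>k\<ge>n. \<exists>f. continuous_map (nsphere k) X f \<and> (\<forall>x\<in>sphere_set k. f (antipode x) = a (f x))"
  proof (rule ccontr)
    assume neg: "\<not> ?thesis"
    have "coind X a \<le> enat (n - 1)" unfolding coind_def
    proof (rule SUP_least)
      fix k assume "k \<in> {k. \<exists>f. continuous_map (nsphere k) X f \<and> (\<forall>x\<in>sphere_set k. f (antipode x) = a (f x))}"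
      then have "\<not> n \<le> k" using neg by blast
      then show "enat k \<le> enat (n - 1)" by simp
    qed
    then have "enat n \<le> enat (n - 1)" using assms(1) by (rule order_trans[rotated])
    then show False using assms(2) by simp
  qed
  then show ?thesis using that by blast
qed

lemma c_VR_ge:
  assumes "m < n"
  shows "ereal (pi / 2) \<le> c_VR m n"
  unfolding c_VR_def
proof (rule INF_greatest)
  fix r assume "r \<in> {r. 0 \<le> r \<and> enat n \<le> coind (VR_sphere m r) VR_antipode}"
  then have co: "enat n \<le> coind (VR_sphere m r) VR_antipode" by simp
  show "ereal (pi / 2) \<le> ereal r"
  proof (rule ccontr)
    assume "\<not> ereal (pi / 2) \<le> ereal r"
    then have r: "r < pi / 2" by simp
    obtain k f where f: "n \<le> k" "continuous_map (nsphere k) (VR_sphere m r) f"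
      "\<And>x. x \<in> sphere_set k \<Longrightarrow> f (antipode x) = VR_antipode (f x)"
      by (rule le_coind_imp_ex_odd_map[OF co]) (use assms in auto)
    obtain u where u: "continuous_map (VR_sphere m r) (nsphere m) u" "\<And>t. u (VR_antipode t) = antipode (u t)"
      using exists_odd_map_VR_to_sphere[OF r] by blast
    have "k \<le> m"
      by (rule Borsuk_Ulam[of k m "u \<circ> f"]) (use f u continuous_map_compose in auto)
    then show False using f(1) assms by simp
  qed
qed

section \<open>Scales above pi / 2\<close>

text \<open>For any choice of signs the points s i * v i have pairwise inner products at least - sin
  \<epsilon>, so they span a simplex. These simplices realise the boundary of a cross-polytope, and
  x is sent to the point with weight (x i)^2 at the vertex with the sign of x i.\<close>

lemma coind_VR_sphere_ge:
  fixes v :: "nat \<Rightarrow> nat \<Rightarrow> real"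
  assumes v: "\<And>i. i \<le> n \<Longrightarrow> v i \<in> sphere_set m" and \<epsilon>: "0 \<le> \<epsilon>" "\<epsilon> \<le> pi / 2"
    and orth: "\<And>i j. i \<le> n \<Longrightarrow> j \<le> n \<Longrightarrow> i \<noteq> j \<Longrightarrow> \<bar>\<Sum>l\<le>m. v i l * v j l\<bar> \<le> sin \<epsilon>"
  shows "enat n \<le> coind (VR_sphere m (pi / 2 + \<epsilon>)) VR_antipode"
proof -
  define K where "K = VR_complex (sphere_set m) (geodesic_dist m) (pi / 2 + \<epsilon>)"
  define vt where "vt = (\<lambda>s i. (\<lambda>l. s i * v i l) :: nat \<Rightarrow> real)"
  \<comment> \<open>Squares serve as barycentric coordinates because they sum to 1 on the sphere.
    Summing over i, rather than assigning a weight per vertex, stays correct if vertices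
    coincide.\<close>
  define F where "F = (\<lambda>s x w. \<Sum>i\<le>n. if w = vt s i then (x i)\<^sup>2 else (0::real))"
  define Sg where "Sg = Pi\<^sub>E {..n} (\<lambda>_. {-1, 1 :: real})"
  define \<Sigma> where "\<Sigma> = (\<lambda>s. vt s ` {..n})"
  have \<Sigma>K: "\<sigma> \<in> K" if s: "s \<in> Sg" and \<sigma>: "\<sigma> \<subseteq> \<Sigma> s" "\<sigma> \<noteq> {}" for s \<sigma>
  proof -
    have s1: "s i * s i = 1" "\<bar>s i\<bar> = 1" if "i \<le> n" for i
    proof -
      have "s i = - 1 \<or> s i = 1" using s that by (auto simp: Sg_def)
      then show "s i * s i = 1" "\<bar>s i\<bar> = 1" by auto
    qed
    have vt: "vt s i \<in> sphere_set m" if "i \<le> n" for i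
      using v[OF that] s1[OF that] by (auto simp: vt_def in_sphere_set_iff power_mult_distrib power2_eq_square[of "s i"])
    have "geodesic_dist m (vt s i) (vt s j) \<le> pi / 2 + \<epsilon>" if ij: "i \<le> n" "j \<le> n" for i j
    proof (cases "i = j")
      case True
      then show ?thesis using vt[OF ij(1)] \<epsilon> pi_gt_zero by (simp add: geodesic_dist_self)
    next
      case False
      define c where "c = (\<Sum>l\<le>m. vt s i l * vt s j l)"
      have "c = s i * s j * (\<Sum>l\<le>m. v i l * v j l)"
        by (simp add: c_def vt_def sum_distrib_left mult_ac)
      then have "\<bar>c\<bar> \<le> sin \<epsilon>" using orth[OF ij False] s1[OF ij(1)] s1[OF ij(2)] by (simp add: abs_mult)
      then have c: "cos (pi / 2 + \<epsilon>) \<le> c" "\<bar>c\<bar> \<le> 1"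
        using order_trans[OF _ sin_le_one[of \<epsilon>], of "\<bar>c\<bar>"] by (auto simp: cos_add)
      have "arccos c \<le> arccos (cos (pi / 2 + \<epsilon>))" using c by (intro arccos_le_arccos) auto
      also have "\<dots> = pi / 2 + \<epsilon>" using \<epsilon> pi_gt_zero by (intro arccos_cos) auto
      finally show ?thesis by (simp add: geodesic_dist_def c_def)
    qed
    then have "\<And>x y. x \<in> \<Sigma> s \<Longrightarrow> y \<in> \<Sigma> s \<Longrightarrow> geodesic_dist m x y \<le> pi / 2 + \<epsilon>"
      by (auto simp: \<Sigma>_def)
    moreover have "\<Sigma> s \<subseteq> sphere_set m" using vt by (auto simp: \<Sigma>_def)
    moreover have "finite \<sigma>" using \<sigma>(1) by (rule finite_subset) (simp add: \<Sigma>_def)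
    ultimately show ?thesis using \<sigma> unfolding K_def VR_complex_def by blast
  qed
  have F_simplex: "F s x \<in> closed_simplex K (\<Sigma> s)" if s: "s \<in> Sg" and x: "x \<in> sphere_set n" for s x
  proof -
    have supp: "{w. F s x w \<noteq> 0} \<subseteq> \<Sigma> s"
    proof
      fix w assume "w \<in> {w. F s x w \<noteq> 0}"
      then have "\<exists>i\<le>n. w = vt s i" unfolding F_def by (auto intro: ccontr)
      then show "w \<in> \<Sigma> s" by (auto simp: \<Sigma>_def)
    qed
    have "(\<Sum>w | F s x w \<noteq> 0. F s x w) = (\<Sum>w\<in>\<Sigma> s. F s x w)"
      by (rule sum.mono_neutral_left) (use supp in \<open>auto simp: \<Sigma>_def\<close>)
    also have "\<dots> = (\<Sum>i\<le>n. \<Sum>w\<in>\<Sigma> s. if w = vt s i then (x i)\<^sup>2 else 0)"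
      unfolding F_def by (rule sum.swap)
    also have "\<dots> = (\<Sum>i\<le>n. (x i)\<^sup>2)" by (rule sum.cong) (auto simp: \<Sigma>_def)
    also have "\<dots> = 1" using x by (simp add: in_sphere_set_iff)
    finally have sum1: "(\<Sum>w | F s x w \<noteq> 0. F s x w) = 1" .
    then have "{w. F s x w \<noteq> 0} \<noteq> {}" by (metis sum.empty zero_neq_one)
    then have "{w. F s x w \<noteq> 0} \<in> K" using \<Sigma>K[OF s supp] by simp
    moreover have "0 \<le> F s x w" for w unfolding F_def by (intro sum_nonneg) auto
    ultimately show ?thesis using sum1 supp by (simp add: closed_simplex_def realization_points_def)
  qed
  define \<sigma> where "\<sigma> = (\<lambda>x :: nat \<Rightarrow> real. \<lambda>i\<in>{..n}. if 0 \<le> x i then 1 else - 1 :: real)"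
  define f where "f = (\<lambda>x. F (\<sigma> x) x)"
  define Orth where "Orth = (\<lambda>s :: nat \<Rightarrow> real. {x \<in> sphere_set n. \<forall>i\<le>n. 0 \<le> s i * x i})"
  have "continuous_map (nsphere n) (realization K) f"
  proof (rule pasting_lemma_closed[of Sg _ Orth])
    show "finite Sg" unfolding Sg_def by (intro finite_PiE) auto
  next
    fix s assume "s \<in> Sg"
    have "closed {x :: nat \<Rightarrow> real. \<forall>i. i \<le> n \<longrightarrow> 0 \<le> s i * x i}"
      by (intro closed_Collect_all closed_Collect_imp closed_Collect_le continuous_intros open_Collect_const continuous_on_product_coordinates)
    then have "closedin (top_of_set (sphere_set n)) (sphere_set n \<inter> {x. \<forall>i. i \<le> n \<longrightarrow> 0 \<le> s i * x i})"
      by (rule closedin_closed_Int)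
    moreover have "sphere_set n \<inter> {x. \<forall>i. i \<le> n \<longrightarrow> 0 \<le> s i * x i} = Orth s" by (auto simp: Orth_def)
    ultimately show "closedin (nsphere n) (Orth s)" by (simp only: nsphere_eq_top_of_set[symmetric])
  next
    fix s assume s: "s \<in> Sg"
    show "continuous_map (subtopology (nsphere n) (Orth s)) (realization K) (F s)"
    proof (rule continuous_map_into_realization[of _ _ "\<Sigma> s"])
      show "\<Sigma> s \<in> K" by (rule \<Sigma>K[OF s]) (auto simp: \<Sigma>_def)
      show "F s x \<in> closed_simplex K (\<Sigma> s)" if "x \<in> topspace (subtopology (nsphere n) (Orth s))" for x
        using that by (intro F_simplex[OF s]) simp
      show "continuous_map (subtopology (nsphere n) (Orth s)) (powertop_real UNIV) (F s)"
      proof (rule continuous_map_from_subtopology)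
        have "continuous_map (nsphere n) euclideanreal (\<lambda>x. F s x w)" for w
        proof -
          have "continuous_map (nsphere n) euclideanreal (\<lambda>x. if w = vt s i then (x i)\<^sup>2 else 0)" for i
            by (cases "w = vt s i") (auto intro: continuous_map_real_pow continuous_map_nsphere_projection)
          then show ?thesis unfolding F_def by (intro continuous_map_sum) auto
        qed
        then show "continuous_map (nsphere n) (powertop_real UNIV) (F s)"
          by (simp add: continuous_map_componentwise_UNIV)
      qed
    qed
  next
    \<comment> \<open>On the common part of two orthants, differing signs occur only at coordinates
      that vanish and hence carry no weight.\<close>
    fix s s' x assume s: "s \<in> Sg" "s' \<in> Sg" and x: "x \<in> topspace (nsphere n) \<inter> Orth s \<inter> Orth s'"
    show "F s x = F s' x" unfolding F_def
    proof (intro ext sum.cong refl)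
      fix w i assume "i \<in> {..n}"
      then have "0 \<le> s i * x i" "0 \<le> s' i * x i" "s i = -1 \<or> s i = 1" "s' i = -1 \<or> s' i = 1"
        using x s by (auto simp: Orth_def Sg_def PiE_iff)
      then have "x i = 0 \<or> s i = s' i" by auto
      then show "(if w = vt s i then (x i)\<^sup>2 else 0) = (if w = vt s' i then (x i)\<^sup>2 else 0)"
        by (auto simp: vt_def)
    qed
  next
    fix x assume "x \<in> topspace (nsphere n)"
    then show "\<exists>s. s \<in> Sg \<and> x \<in> Orth s \<and> f x = F s x"
      by (intro exI[of _ "\<sigma> x"]) (auto simp: Sg_def Orth_def f_def \<sigma>_def)
  qed
  moreover have "f (antipode x) = VR_antipode (f x)" for x
    unfolding f_def F_def VR_antipode_def
  proof (intro ext sum.cong refl)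
    fix w i assume "i \<in> {..n}"
    \<comment> \<open>The convention that 0 has the sign 1 breaks antisymmetry only where the weight
      is 0.\<close>
    then have "x i = 0 \<or> \<sigma> (antipode x) i = - \<sigma> x i" by (auto simp: \<sigma>_def antipode_def)
    moreover have "antipode w = vt (\<sigma> x) i \<longleftrightarrow> w = antipode (vt (\<sigma> x) i)"
      using antipode_antipode by metis
    moreover have "antipode (vt (\<sigma> x) i) = (\<lambda>l. - \<sigma> x i * v i l)"
      by (simp add: antipode_def vt_def)
    ultimately show "(if w = vt (\<sigma> (antipode x)) i then (antipode x i)\<^sup>2 else 0) = (if antipode w = vt (\<sigma> x) i then (x i)\<^sup>2 else 0)"
      by (auto simp: antipode_def vt_def)
  qed
  ultimately show ?thesis
    unfolding coind_def VR_sphere_def K_def by (intro SUP_upper) auto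
qed

text \<open>The cap of points with inner product above sin \<epsilon> with v lies in the open ball
  of radius cos \<epsilon> about sin \<epsilon> times v.\<close>

lemma chord_lt_of_inner_gt:
  assumes p: "p \<in> sphere_set m" "p' \<in> sphere_set m" and v: "L2_set v {..m} = 1" and \<epsilon>: "0 < \<epsilon>" "\<epsilon> < pi / 2"
    and "sin \<epsilon> < (\<Sum>l\<le>m. p l * v l)" "sin \<epsilon> < (\<Sum>l\<le>m. p' l * v l)"
  shows "L2_set (\<lambda>i. p i - p' i) {..m} < 2 * cos \<epsilon>"
proof -
  have s0: "0 < sin \<epsilon>" and c0: "0 < cos \<epsilon>" using \<epsilon> by (auto intro: sin_gt_zero cos_gt_zero)
  have *: "L2_set (\<lambda>i. q i - sin \<epsilon> * v i) {..m} < cos \<epsilon>"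
    if q: "q \<in> sphere_set m" "sin \<epsilon> < (\<Sum>l\<le>m. q l * v l)" for q
  proof (rule power2_less_imp_less)
    have "(L2_set (\<lambda>i. q i - sin \<epsilon> * v i) {..m})\<^sup>2 = 1 - 2 * sin \<epsilon> * (\<Sum>l\<le>m. q l * v l) + (sin \<epsilon>)\<^sup>2"
      using L2_set_add_scaled_power2[of q "- sin \<epsilon>" v "{..m}"] v q(1)
      by (simp add: L2_set_power2 in_sphere_set_iff)
    also have "\<dots> < 1 - 2 * sin \<epsilon> * sin \<epsilon> + (sin \<epsilon>)\<^sup>2" using s0 q(2) by simp
    also have "\<dots> = (cos \<epsilon>)\<^sup>2" unfolding cos_squared_eq by (simp add: power2_eq_square)
    finally show "(L2_set (\<lambda>i. q i - sin \<epsilon> * v i) {..m})\<^sup>2 < (cos \<epsilon>)\<^sup>2" .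
  qed (use c0 in simp)
  have "L2_set (\<lambda>i. p i - p' i) {..m}
      \<le> L2_set (\<lambda>i. p i - sin \<epsilon> * v i) {..m} + L2_set (\<lambda>i. sin \<epsilon> * v i - p' i) {..m}"
    by (rule L2_set_dist_triangle)
  also have "\<dots> < cos \<epsilon> + cos \<epsilon>"
    using *[OF p(1)] *[OF p(2)] assms(6,7) L2_set_minus_commute[of "\<lambda>i. sin \<epsilon> * v i" p' "{..m}"]
    by (intro add_strict_mono) auto
  finally show ?thesis by simp
qed

text \<open>A maximal family of almost orthogonal vectors is large: the caps around the vectors and their
  antipodes would otherwise give a colouring that violates the lower bound.\<close>

lemma exists_almost_orthogonal:
  assumes \<epsilon>: "0 < \<epsilon>" "\<epsilon> < pi / 2" and \<eta>: "0 < \<eta>" "\<eta> < 1"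
    and small: "real (2 * n) * (cos \<epsilon> + 2 * \<eta>) ^ Suc m < \<eta>"
  shows "k \<le> Suc n \<Longrightarrow> \<exists>v :: nat \<Rightarrow> nat \<Rightarrow> real. (\<forall>i<k. v i \<in> sphere_set m) \<and>
    (\<forall>i<k. \<forall>j<k. i \<noteq> j \<longrightarrow> \<bar>\<Sum>l\<le>m. v i l * v j l\<bar> \<le> sin \<epsilon>)"
proof (induction k)
  case (Suc k)
  then obtain v :: "nat \<Rightarrow> nat \<Rightarrow> real" where v: "\<And>i. i < k \<Longrightarrow> v i \<in> sphere_set m"
    "\<And>i j. i < k \<Longrightarrow> j < k \<Longrightarrow> i \<noteq> j \<Longrightarrow> \<bar>\<Sum>l\<le>m. v i l * v j l\<bar> \<le> sin \<epsilon>"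
    by auto
  have c0: "0 < cos \<epsilon>" using \<epsilon> by (auto intro: cos_gt_zero)
  have "\<exists>p\<in>sphere_set m. \<forall>i<k. \<bar>\<Sum>l\<le>m. p l * v i l\<bar> \<le> sin \<epsilon>"
  proof (rule ccontr)
    assume "\<not> ?thesis"
    then have "\<forall>p. \<exists>i. p \<in> sphere_set m \<longrightarrow> i < k \<and> sin \<epsilon> < \<bar>\<Sum>l\<le>m. p l * v i l\<bar>" by (meson not_le)
    then obtain I where I: "\<And>p. p \<in> sphere_set m \<Longrightarrow> I p < k"
      "\<And>p. p \<in> sphere_set m \<Longrightarrow> sin \<epsilon> < \<bar>\<Sum>l\<le>m. p l * v (I p) l\<bar>" by metis
    define ip where "ip = (\<lambda>p. \<Sum>l\<le>m. p l * v (I p) l)"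
    \<comment> \<open>The colour records which vector is near and on which side: two caps per
      vector, so 2 * k colours. Each cap has chords below 2 * cos \<epsilon> = 2 * sin (pi / 2 -
      \<epsilon>).\<close>
    define c where "c = (\<lambda>p. 2 * I p + (if 0 < ip p then 0 else 1))"
    have "chi_sphere m (2 * (pi / 2 - \<epsilon>)) \<le> enat (2 * k)"
      unfolding chi_def chromatic_number_le_iff
    proof (intro exI[of _ c] conjI ballI impI)
      show "c p < 2 * k" if "p \<in> sphere_set m" for p using I(1)[OF that] by (simp add: c_def)
      fix p p' assume p: "p \<in> sphere_set m" "p' \<in> sphere_set m"
        "Bor_adj (geodesic_dist m) (2 * (pi / 2 - \<epsilon>)) p p'"
      show "c p \<noteq> c p'"
      proof
        assume eq: "c p = c p'"
        have I_eq: "I p = I p'" and pos_eq: "0 < ip p \<longleftrightarrow> 0 < ip p'"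
          using eq unfolding c_def by (simp_all split: if_splits) presburger+
        define w where "w = (if 0 < ip p then v (I p) else (\<lambda>l. - v (I p) l))"
        have w: "L2_set w {..m} = 1"
          using v(1)[OF I(1)[OF p(1)]] by (simp add: w_def L2_set_def in_sphere_set_iff)
        have 1: "sin \<epsilon> < (\<Sum>l\<le>m. p l * w l)"
          using I(2)[OF p(1)] by (auto simp: w_def ip_def sum_negf)
        have 2: "sin \<epsilon> < (\<Sum>l\<le>m. p' l * w l)"
          using I(2)[OF p(2)] pos_eq by (auto simp: w_def ip_def sum_negf I_eq)
        have "L2_set (\<lambda>i. p i - p' i) {..m} < 2 * cos \<epsilon>"
          by (rule chord_lt_of_inner_gt[OF p(1,2) w \<epsilon> 1 2])
        moreover have "2 * sin (pi / 2 - \<epsilon>) \<le> L2_set (\<lambda>i. p i - p' i) {..m}"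
          using p(3) geodesic_dist_ge_iff_chord[OF p(1,2), of "pi / 2 - \<epsilon>"] \<epsilon> by (auto simp: Bor_adj_def)
        ultimately show False by (simp add: sin_diff)
      qed
    qed
    then have "\<eta> \<le> real (2 * k) * (sin (pi / 2 - \<epsilon>) + 2 * \<eta>) ^ Suc m"
      using \<epsilon> \<eta> by (intro chi_sphere_lower_bound) auto
    also have "sin (pi / 2 - \<epsilon>) = cos \<epsilon>" by (simp add: sin_diff)
    also have "real (2 * k) * (cos \<epsilon> + 2 * \<eta>) ^ Suc m \<le> real (2 * n) * (cos \<epsilon> + 2 * \<eta>) ^ Suc m"
      using Suc.prems c0 \<eta> by (intro mult_right_mono) auto
    finally show False using small by simp
  qed
  then obtain p where p: "p \<in> sphere_set m" "\<And>i. i < k \<Longrightarrow> \<bar>\<Sum>l\<le>m. p l * v i l\<bar> \<le> sin \<epsilon>" by blast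
  show ?case
  proof (intro exI[of _ "v(k := p)"] conjI allI impI)
    show "(v(k := p)) i \<in> sphere_set m" if "i < Suc k" for i using that p v(1) by (auto simp: less_Suc_eq)
    fix i j assume "i < Suc k" "j < Suc k" "i \<noteq> j"
    then consider "i < k" "j < k" | "i = k" "j < k" | "i < k" "j = k" by linarith
    then show "\<bar>\<Sum>l\<le>m. (v(k := p)) i l * (v(k := p)) j l\<bar> \<le> sin \<epsilon>"
      using v(2) p(2) \<open>i \<noteq> j\<close> by cases (auto simp: mult.commute)
  qed
qed simp

section \<open>Elementary limits\<close>

lemma eventually_le_of_ratio:
  fixes m n :: "nat \<Rightarrow> nat"
  assumes "filterlim m at_top sequentially" "(\<lambda>j. real (n j) / real (m j)) \<longlonglongrightarrow> L"
  shows "\<forall>\<^sub>F j in sequentially. real (n j) \<le> (L + 1) * real (m j)"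
proof -
  have "\<forall>\<^sub>F j in sequentially. real (n j) / real (m j) < L + 1"
    using assms(2) by (rule order_tendstoD) simp
  moreover have "\<forall>\<^sub>F j in sequentially. 1 \<le> m j"
    using assms(1) by (simp add: filterlim_at_top)
  ultimately show ?thesis
    by eventually_elim (simp add: divide_simps)
qed

text \<open>With s = sqrt q, each term is the square of N * s^N.\<close>

lemma poly_times_geometric_tendsto_0:
  fixes q :: real
  assumes "0 \<le> q" "q < 1"
  shows "(\<lambda>N. (real N)\<^sup>2 * q ^ N) \<longlonglongrightarrow> 0"
proof -
  define s where "s = sqrt q"
  have s: "0 \<le> s" "s < 1" "s * s = q" using assms by (auto simp: s_def real_sqrt_less_iff[of q 1, simplified])
  have "(\<lambda>N. real N * s ^ N) \<longlonglongrightarrow> 0" using s powser_times_n_limit_0[of s] by simp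
  then have "(\<lambda>N. (real N * s ^ N) * (real N * s ^ N)) \<longlonglongrightarrow> 0 * 0" by (intro tendsto_mult)
  moreover have "(real N * s ^ N) * (real N * s ^ N) = (real N)\<^sup>2 * q ^ N" for N
    by (simp add: s(3)[symmetric] power_mult_distrib power2_eq_square mult_ac)
  ultimately show ?thesis by simp
qed

section \<open>Asymptotics\<close>

text \<open>The extreme value theorem on the closed interval gives a maximiser. It is interior
  because the function is 0 at both ends and positive between them, where (sin z)^L < sin z; so
  \<open>GREATEST\<close> denotes a genuine maximum.\<close>

lemma Phi_chi_attained:
  assumes L: "1 < L"
  obtains x where "0 < x" "x < pi / 2" "Phi_chi L = x - arcsin (sin x powr L)" "arcsin (sin x powr L) < x"
proof -
  define g where "g = (\<lambda>x. x - arcsin (sin x powr L))"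
  have sin_le: "0 \<le> sin x \<and> sin x powr L \<le> 1" if "x \<in> {0..pi / 2}" for x
  proof -
    have "0 \<le> sin x" using that by (intro sin_ge_zero) auto
    moreover have "sin x powr L \<le> 1" using calculation L by (intro powr_le1) auto
    ultimately show ?thesis by simp
  qed
  have "continuous_on {0..pi / 2} (\<lambda>x. sin x powr L)"
    by (rule continuous_on_powr') (use sin_le L in \<open>auto intro!: continuous_intros\<close>)
  moreover have "\<forall>x\<in>{0..pi / 2}. - 1 \<le> sin x powr L \<and> sin x powr L \<le> 1"
    using sin_le powr_ge_zero by (meson dual_order.trans neg_le_0_iff_le zero_le_one)
  ultimately have "continuous_on {0..pi / 2} (\<lambda>x. arcsin (sin x powr L))"
    by (rule continuous_on_arcsin)
  then have "continuous_on {0..pi / 2} g" unfolding g_def by (intro continuous_on_diff continuous_on_id)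
  then obtain x where x: "x \<in> {0..pi / 2}" "\<And>y. y \<in> {0..pi / 2} \<Longrightarrow> g y \<le> g x"
    using continuous_attains_sup[of "{0..pi / 2}" g] by auto
  have small: "arcsin (sin z powr L) < z" if z: "0 < z" "z < pi / 2" for z
  proof -
    have s: "0 < sin z" "sin z < 1"
      using z sin_gt_zero[of z] sin_monotone_2pi[of z "pi / 2"] by auto
    have "sin z powr L < sin z powr 1" using s L by (intro powr_less_mono') auto
    then have "sin z powr L < sin z" using s by simp
    then have "arcsin (sin z powr L) < arcsin (sin z)"
      using s powr_ge_zero[of "sin z" L] by (intro arcsin_less_arcsin) linarith+
    then show ?thesis using z by (simp add: arcsin_sin)
  qed
  have "g x \<ge> g (pi / 4)" using x(2)[of "pi / 4"] by simp
  moreover have "g (pi / 4) > 0" using small[of "pi / 4"] by (simp add: g_def)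
  ultimately have gx: "g x > 0" by simp
  moreover have "g 0 = 0" "g (pi / 2) = 0" using L by (auto simp: g_def)
  ultimately have "x \<noteq> 0" "x \<noteq> pi / 2" by (metis less_irrefl)+
  then have x_in: "0 < x" "x < pi / 2" using x(1) by auto
  have "Phi_chi L = g x"
    unfolding Phi_chi_def
  proof (rule Greatest_equality)
    show "g x \<in> (\<lambda>x. x - arcsin (sin x powr L)) ` {0<..<pi / 2}" using x_in by (auto simp: g_def)
    show "y \<le> g x" if "y \<in> (\<lambda>x. x - arcsin (sin x powr L)) ` {0<..<pi / 2}" for y
      using that x(2) by (auto simp: g_def)
  qed
  then show thesis using that[OF x_in] small[OF x_in] by (simp add: g_def)
qed

text \<open>The bounds on \<open>chi\<close> have the number of coordinates, one more than the
  dimension, as exponent. For K strictly between L' and L, the surplus (K - L') * m eventually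
  absorbs the extra summand L'.\<close>

lemma eventually_ratio_Suc_ge:
  fixes m n :: "nat \<Rightarrow> nat"
  assumes "filterlim m at_top sequentially" "(\<lambda>j. real (n j) / real (m j)) \<longlonglongrightarrow> L" "L' < L"
  shows "\<forall>\<^sub>F j in sequentially. L' * real (Suc (m j)) \<le> real (Suc (n j))"
proof -
  define K where "K = (L' + L) / 2"
  have K: "L' < K" "K < L" using assms(3) by (auto simp: K_def)
  have "\<forall>\<^sub>F j in sequentially. K < real (n j) / real (m j)"
    using assms(2) K(2) by (rule order_tendstoD)
  moreover have "\<forall>\<^sub>F j in sequentially. max 1 (nat \<lceil>L' / (K - L')\<rceil>) \<le> m j"
    using assms(1) unfolding filterlim_at_top by blast
  ultimately show ?thesis
  proof eventually_elim
    case (elim j)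
    then have m: "1 \<le> m j" "L' / (K - L') \<le> real (m j)" by linarith+
    have "L' \<le> real (m j) * (K - L')" using m(2) K by (simp add: pos_divide_le_eq)
    moreover have "K * real (m j) < real (n j)" using elim(1) m(1) by (simp add: pos_less_divide_eq)
    ultimately show ?case by (simp add: algebra_simps)
  qed
qed

text \<open>At the maximiser x, an interleaving with \<delta> < 2c would colour the larger sphere at
  scale 2 * x with no more colours than the smaller one needs at scale 2 * y', where sin y' slightly
  exceeds (sin x)^L. The two exponential bounds then contradict each other once the dimension is
  large.\<close>

lemma eventually_dI_chi_sphere_ge:
  fixes m n :: "nat \<Rightarrow> nat"
  assumes m: "filterlim m at_top sequentially" and ratio: "(\<lambda>j. real (n j) / real (m j)) \<longlonglongrightarrow> L"
    and L: "1 < L" and c: "c < Phi_chi L"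
  shows "\<forall>\<^sub>F j in sequentially. ereal c \<le> dI_chi_sphere (m j) (n j) / 2"
proof -
  obtain x where x: "0 < x" "x < pi / 2" "Phi_chi L = x - arcsin (sin x powr L)" "arcsin (sin x powr L) < x"
    using Phi_chi_attained[OF L] by blast
  define y where "y = arcsin (sin x powr L)"
  have s: "0 < sin x" "sin x < 1" using x sin_gt_zero[of x] sin_monotone_2pi[of x "pi / 2"] by auto
  have sL: "0 < sin x powr L" "sin x powr L < 1"
    using s L powr_less_mono2[of L "sin x" 1] by auto
  have "sin y = sin x powr L" unfolding y_def
    by (rule sin_arcsin) (use sL in linarith)+
  moreover have "0 \<le> y" "y < x"
    using sL x(4) arcsin_le_arcsin[of 0 "sin x powr L"] by (auto simp: y_def)
  ultimately have y: "sin y = sin x powr L" "0 \<le> y" "y < x" by blast+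
  have cxy: "c < x - y" using c x(3) by (simp add: y_def)
  \<comment> \<open>The first bound keeps y' below x, the second keeps x - y' at least c.\<close>
  define t where "t = min ((x - y) / 2) (x - y - c)"
  have t: "t \<le> (x - y) / 2" "t \<le> x - y - c"
    unfolding t_def by (rule min.cobounded1, rule min.cobounded2)
  have t0: "0 < t" using y(3) cxy by (simp add: t_def)
  define y' where "y' = y + t"
  have y': "y < y'" "y' < x" "c \<le> x - y'"
    using t t0 y(3) by (auto simp: y'_def field_simps)
  define \<sigma> where "\<sigma> = sin y'"
  have \<sigma>: "sin x powr L < \<sigma>" "\<sigma> < 1"
    unfolding y(1)[symmetric] \<sigma>_def
    using y y' x sin_monotone_2pi[of y y'] sin_monotone_2pi[of y' "pi / 2"] by auto
  \<comment> \<open>This and \<alpha> below give a strict chain (sin x)^L < \<alpha>^L < \<beta> <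
    \<sigma>. The gap from sin x to \<alpha> pays for the thickening by \<eta>, the gap from \<beta>
    to \<sigma> for the covering, and the middle one for a ratio n / m that only tends to L.\<close>
  define \<beta> where "\<beta> = (sin x powr L + \<sigma>) / 2"
  have \<beta>: "sin x powr L < \<beta>" "\<beta> < \<sigma>" using \<sigma> by (auto simp: \<beta>_def)
  moreover have "0 < \<beta>" using sL(1) \<beta>(1) by linarith
  ultimately have \<beta>: "sin x powr L < \<beta>" "\<beta> < \<sigma>" "0 < \<beta>" by blast+
  define \<alpha> where "\<alpha> = ((sin x powr L + \<beta>) / 2) powr (1 / L)"
  have \<alpha>L: "\<alpha> powr L = (sin x powr L + \<beta>) / 2" using L sL \<beta> by (simp add: \<alpha>_def powr_powr)
  have \<alpha>: "sin x < \<alpha>" "\<alpha> < 1" "\<alpha> powr L < \<beta>"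
  proof -
    have "sin x = (sin x powr L) powr (1 / L)" using s L by (simp add: powr_powr)
    also have "\<dots> < \<alpha>" unfolding \<alpha>_def using sL \<beta> L by (intro powr_less_mono2) auto
    finally show "sin x < \<alpha>" .
    have "\<alpha> < 1 powr (1 / L)" unfolding \<alpha>_def using sL \<beta> \<sigma> L by (intro powr_less_mono2) auto
    then show "\<alpha> < 1" by simp
    show "\<alpha> powr L < \<beta>" unfolding \<alpha>L using \<beta> by simp
  qed
  define \<eta> where "\<eta> = (\<alpha> - sin x) / 2"
  have \<eta>: "0 < \<eta>" "\<eta> < 1" "sin x + 2 * \<eta> = \<alpha>" using \<alpha> s by (auto simp: \<eta>_def field_simps)
  have \<alpha>0: "0 < \<alpha>" using \<alpha> s by simp
  have ln\<alpha>: "ln \<alpha> < 0" using \<alpha>0 \<alpha> by simp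
  have "ln (\<alpha> powr L) < ln \<beta>" using \<alpha>(3) \<alpha>0 \<beta> by (subst ln_less_cancel_iff) auto
  then have "L * ln \<alpha> < ln \<beta>" using \<alpha>0 by (simp add: ln_powr)
  then have L_gt: "ln \<beta> / ln \<alpha> < L" using ln\<alpha> by (simp add: neg_divide_less_eq)
  \<comment> \<open>Since ln \<alpha> is negative, the lower bound on L' says that \<alpha> to the
    power L' is still below \<beta>; staying below L makes L' an eventual lower bound for the
    ratio.\<close>
  obtain L' where L': "ln \<beta> / ln \<alpha> < L'" "L' < L" using dense[OF L_gt] by blast
  define \<theta> where "\<theta> = \<alpha> powr L' / \<beta>"
  have \<theta>: "0 \<le> \<theta>" "\<theta> < 1"
  proof -
    have "L' * ln \<alpha> < ln \<beta>" using L'(1) ln\<alpha> by (simp add: neg_divide_less_eq)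
    then have "ln (\<alpha> powr L') < ln \<beta>" using \<alpha>0 by (simp add: ln_powr)
    then have "\<alpha> powr L' < \<beta>" using \<alpha>0 \<beta> by (subst (asm) ln_less_cancel_iff) auto
    then show "\<theta> < 1" using \<beta> by (simp add: \<theta>_def)
    show "0 \<le> \<theta>" using \<beta> by (simp add: \<theta>_def)
  qed
  obtain A :: real and m0 :: nat where A: "A > 0" and upper: "\<And>m. m \<ge> m0 \<Longrightarrow>
      \<exists>k. chi_sphere m (2 * y') \<le> enat k \<and> real k \<le> A * (real (Suc m))\<^sup>2 / \<beta> ^ Suc m"
    using chi_sphere_upper_bound[of \<beta> \<sigma> y'] \<beta> \<sigma> y y' x by (auto simp: \<sigma>_def)
  have "(\<lambda>N. A * ((real N)\<^sup>2 * \<theta> ^ N)) \<longlonglongrightarrow> A * 0"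
    by (intro tendsto_mult tendsto_const poly_times_geometric_tendsto_0 \<theta>)
  then have "\<forall>\<^sub>F N in sequentially. A * ((real N)\<^sup>2 * \<theta> ^ N) < \<eta>"
    using \<eta>(1) by (intro order_tendstoD(2)[of _ 0]) auto
  then obtain N0 where N0: "\<And>N. N \<ge> N0 \<Longrightarrow> A * ((real N)\<^sup>2 * \<theta> ^ N) < \<eta>"
    by (auto simp: eventually_sequentially)
  have "\<forall>\<^sub>F j in sequentially. max m0 N0 \<le> m j" using m unfolding filterlim_at_top by blast
  with eventually_ratio_Suc_ge[OF m ratio L'(2)] show ?thesis
  proof eventually_elim
    case (elim j)
    have mj: "m0 \<le> m j" "N0 \<le> Suc (m j)" using elim(2) by auto
    obtain k where k: "chi_sphere (m j) (2 * y') \<le> enat k"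
      "real k \<le> A * (real (Suc (m j)))\<^sup>2 / \<beta> ^ Suc (m j)"
      using upper[OF mj(1)] by blast
    have ge: "2 * c \<le> \<delta>"
      if \<delta>: "0 \<le> \<delta>" "\<forall>u>\<delta>. chi_sphere (m j) u
            \<le> chi_sphere (n j) (u - \<delta>) \<and>
          chi_sphere (n j) u \<le> chi_sphere (m j) (u - \<delta>)" for \<delta>
    proof (rule ccontr)
      assume "\<not> 2 * c \<le> \<delta>"
      then have \<delta>2: "2 * y' \<le> 2 * x - \<delta>" using y'(3) by linarith
      then have "\<delta> < 2 * x" using y y' by linarith
      then have "chi_sphere (n j) (2 * x)
          \<le> chi_sphere (m j) (2 * x - \<delta>)" using \<delta>(2) by blast
      also have "\<dots> \<le> chi_sphere (m j) (2 * y')" using \<delta>2 by (rule chi_antimono)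
      also have "\<dots> \<le> enat k" by (rule k(1))
      finally have "\<eta> \<le> real k * (sin x + 2 * \<eta>) ^ Suc (n j)"
        using x \<eta> by (intro chi_sphere_lower_bound) auto
      also have "\<dots> = real k * \<alpha> ^ Suc (n j)" unfolding \<eta>(3) ..
      \<comment> \<open>As \<alpha> < 1, replacing the exponent n + 1 by the smaller L' (m + 1) can
        only increase the power.\<close>
      also have "\<dots> \<le> (A * (real (Suc (m j)))\<^sup>2 / \<beta> ^ Suc (m j)) * (\<alpha> powr L') ^ Suc (m j)"
      proof (intro mult_mono k(2))
        have "\<alpha> ^ Suc (n j) = \<alpha> powr real (Suc (n j))" using \<alpha>0 by (rule powr_realpow[symmetric])
        also have "\<dots> \<le> \<alpha> powr (L' * real (Suc (m j)))"
          using elim(1) \<alpha>0 \<alpha>(2) by (intro powr_mono') auto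
        also have "\<dots> = (\<alpha> powr L') powr real (Suc (m j))" by (rule powr_powr[symmetric])
        also have "\<dots> = (\<alpha> powr L') ^ Suc (m j)" using \<alpha>0 by (intro powr_realpow) auto
        finally show "\<alpha> ^ Suc (n j) \<le> (\<alpha> powr L') ^ Suc (m j)" .
      qed (use \<alpha>0 A \<beta> in auto)
      also have "\<dots> = A * ((real (Suc (m j)))\<^sup>2 * \<theta> ^ Suc (m j))"
        unfolding \<theta>_def power_divide by simp
      also have "\<dots> < \<eta>" by (rule N0[OF mj(2)])
      finally show False by simp
    qed
    have "ereal (2 * c) \<le> dI_chi_sphere (m j) (n j)"
      unfolding dI_chi_sphere_def chi_interleaving_dist_def
      by (rule INF_greatest) (use ge in auto)
    then have "ereal (2 * c) / 2 \<le> dI_chi_sphere (m j) (n j) / 2"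
      by (intro ereal_divide_right_mono) auto
    then show ?case by simp
  qed
qed

text \<open>The number n + 1 of vectors needed grows linearly with m, while the number of almost
  orthogonal vectors available grows exponentially for each fixed \<epsilon>.\<close>

lemma eventually_c_VR_le:
  fixes m n :: "nat \<Rightarrow> nat"
  assumes m: "filterlim m at_top sequentially" and ratio: "(\<lambda>j. real (n j) / real (m j)) \<longlonglongrightarrow> L"
    and L: "1 < L" and \<epsilon>: "0 < \<epsilon>" "\<epsilon> < pi / 2"
  shows "\<forall>\<^sub>F j in sequentially. c_VR (m j) (n j) \<le> ereal (pi / 2 + \<epsilon>)"
proof -
  have cos: "0 < cos \<epsilon>" "cos \<epsilon> < 1"
    using \<epsilon> cos_gt_zero[of \<epsilon>] cos_monotone_0_pi[of 0 \<epsilon>] by auto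
  \<comment> \<open>Half of the distance from cos \<epsilon> to 1 is spent, so the base of the power
    stays below 1.\<close>
  define \<eta> where "\<eta> = (1 - cos \<epsilon>) / 4"
  have \<eta>: "0 < \<eta>" "\<eta> < 1" "cos \<epsilon> + 2 * \<eta> < 1" "0 \<le> cos \<epsilon> + 2 * \<eta>"
    using cos by (simp_all add: \<eta>_def field_simps)
  define q where "q = cos \<epsilon> + 2 * \<eta>"
  have q: "0 \<le> q" "q < 1" using \<eta> by (auto simp: q_def)
  have "(\<lambda>N. 2 * (L + 1) * ((real N)\<^sup>2 * q ^ N)) \<longlonglongrightarrow> 2 * (L + 1) * 0"
    by (intro tendsto_mult tendsto_const poly_times_geometric_tendsto_0 q)
  then have "\<forall>\<^sub>F N in sequentially. 2 * (L + 1) * ((real N)\<^sup>2 * q ^ N) < \<eta>"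
    using \<eta>(1) by (intro order_tendstoD(2)[of _ 0]) auto
  then obtain N0 where N0: "\<And>N. N \<ge> N0 \<Longrightarrow> 2 * (L + 1) * ((real N)\<^sup>2 * q ^ N) < \<eta>"
    by (auto simp: eventually_sequentially)
  have "\<forall>\<^sub>F j in sequentially. N0 \<le> m j" using m by (simp add: filterlim_at_top)
  with eventually_le_of_ratio[OF m ratio] show ?thesis
  proof eventually_elim
    case (elim j)
    \<comment> \<open>The linear bound on n is weakened to a quadratic one to match the limit used
      for \<open>N0\<close>.\<close>
    have "real (2 * n j) \<le> 2 * (L + 1) * (real (Suc (m j)))\<^sup>2"
    proof -
      have "real (m j) \<le> (real (Suc (m j)))\<^sup>2" by (simp add: power2_eq_square algebra_simps)
      then have "(L + 1) * real (m j) \<le> (L + 1) * (real (Suc (m j)))\<^sup>2" using L by (intro mult_left_mono) auto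
      then have "real (n j) \<le> (L + 1) * (real (Suc (m j)))\<^sup>2" using elim(1) by linarith
      then show ?thesis by (simp add: algebra_simps)
    qed
    then have "real (2 * n j) * q ^ Suc (m j) \<le> 2 * (L + 1) * (real (Suc (m j)))\<^sup>2 * q ^ Suc (m j)"
      using q by (intro mult_right_mono) auto
    also have "\<dots> < \<eta>" using N0[of "Suc (m j)"] elim(2) by (simp add: mult.assoc)
    finally have small: "real (2 * n j) * (cos \<epsilon> + 2 * \<eta>) ^ Suc (m j) < \<eta>" by (simp add: q_def)
    obtain v :: "nat \<Rightarrow> nat \<Rightarrow> real" where v: "\<forall>i<Suc (n j). v i \<in> sphere_set (m j)"
      "\<forall>i<Suc (n j). \<forall>l<Suc (n j). i \<noteq> l \<longrightarrow> \<bar>\<Sum>k\<le>m j. v i k * v l k\<bar> \<le> sin \<epsilon>"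
      using exists_almost_orthogonal[OF \<epsilon> \<eta>(1,2) small order_refl] by blast
    have "enat (n j) \<le> coind (VR_sphere (m j) (pi / 2 + \<epsilon>)) VR_antipode"
      by (rule coind_VR_sphere_ge[of _ v]) (use v \<epsilon> in auto)
    then show ?case unfolding c_VR_def using \<epsilon> pi_gt_zero by (intro INF_lower) auto
  qed
qed

theorem theorem8p12:
  fixes m n :: "nat \<Rightarrow> nat" and L :: real
  assumes "\<And>j. 1 \<le> m j" and "\<And>j. m j < n j"
    and "filterlim m at_top sequentially"
    and "(\<lambda>j. real (n j) / real (m j)) \<longlonglongrightarrow> L"
    and "1 < L"
  shows "ereal (Phi_chi L) \<le> liminf (\<lambda>j. dI_chi_sphere (m j) (n j) / 2)
    \<and> ereal (Phi_chi L) \<le> liminf (\<lambda>j. GH_sphere (m j) (n j))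
    \<and> (\<lambda>j. c_VR (m j) (n j) / 2) \<longlonglongrightarrow> ereal (pi / 4)
    \<and> ereal (Phi_chi L - pi / 4)
        \<le> liminf (\<lambda>j. GH_sphere (m j) (n j) - c_VR (m j) (n j) / 2)"
proof -
  have dI_le_GH: "dI_chi_sphere (m j) (n j) / 2 \<le> GH_sphere (m j) (n j)" for j
    unfolding dI_chi_sphere_def GH_sphere_def
  proof (rule chi_interleaving_dist_half_le_GH_dist)
    show "sphere_set (m j) \<noteq> {}" using in_topspace_nsphere by blast
  qed (rule geodesic_dist_self, assumption)+
  have dI: "ereal (Phi_chi L) \<le> liminf (\<lambda>j. dI_chi_sphere (m j) (n j) / 2)"
    unfolding le_Liminf_iff
  proof (intro allI impI)
    fix a assume "a < ereal (Phi_chi L)"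
    then obtain c where c: "a < ereal c" "c < Phi_chi L" by (metis ereal_dense2 ereal_less(2) less_ereal.simps(1))
    show "\<forall>\<^sub>F j in sequentially. a < dI_chi_sphere (m j) (n j) / 2"
      using eventually_dI_chi_sphere_ge[OF assms(3-5) c(2)]
      by eventually_elim (use c(1) in order)
  qed
  have GH: "ereal (Phi_chi L) \<le> liminf (\<lambda>j. GH_sphere (m j) (n j))"
    using dI by (rule order_trans) (intro Liminf_mono always_eventually allI dI_le_GH)
  have c_ge: "ereal (pi / 4) \<le> c_VR (m j) (n j) / 2" for j
  proof -
    have "ereal (pi / 2) / 2 \<le> c_VR (m j) (n j) / 2"
      by (intro ereal_divide_right_mono c_VR_ge assms(2)) auto
    then show ?thesis by simp
  qed
  have c_le: "\<forall>\<^sub>F j in sequentially. c_VR (m j) (n j) / 2 \<le> ereal (pi / 4 + e)" if "e > 0" for e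
  proof -
    \<comment> \<open>The cap pi / 4 keeps \<epsilon> below pi / 2 when e is large.\<close>
    define \<epsilon> where "\<epsilon> = min (2 * e) (pi / 4)"
    have "\<epsilon> \<le> pi / 4" unfolding \<epsilon>_def by (rule min.cobounded2)
    then have "\<epsilon> < pi / 2" using pi_gt_zero by linarith
    moreover have "0 < \<epsilon>" "\<epsilon> \<le> 2 * e" using that pi_gt_zero by (auto simp: \<epsilon>_def)
    ultimately have \<epsilon>: "0 < \<epsilon>" "\<epsilon> < pi / 2" "\<epsilon> \<le> 2 * e" by blast+
    show ?thesis
      using eventually_c_VR_le[OF assms(3-5) \<epsilon>(1,2)]
    proof eventually_elim
      case (elim j)
      then have "c_VR (m j) (n j) / 2 \<le> ereal (pi / 2 + \<epsilon>) / 2" by (intro ereal_divide_right_mono) auto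
      also have "\<dots> \<le> ereal (pi / 4 + e)" using \<epsilon>(3) by simp
      finally show ?case .
    qed
  qed
  have c_lim: "(\<lambda>j. c_VR (m j) (n j) / 2) \<longlonglongrightarrow> ereal (pi / 4)"
  proof (rule order_tendstoI)
    fix a assume "a < ereal (pi / 4)"
    then show "\<forall>\<^sub>F j in sequentially. a < c_VR (m j) (n j) / 2"
      using c_ge by (intro always_eventually allI) (rule order.strict_trans2)
  next
    fix a assume "ereal (pi / 4) < a"
    then obtain b where b: "pi / 4 < b" "ereal b < a" by (metis ereal_dense2 less_ereal.simps(1))
    show "\<forall>\<^sub>F j in sequentially. c_VR (m j) (n j) / 2 < a"
      using c_le[of "b - pi / 4"] b by (auto elim!: eventually_mono intro: order.strict_trans1)
  qed
  have "ereal (Phi_chi L - pi / 4) \<le> liminf (\<lambda>j. GH_sphere (m j) (n j) - c_VR (m j) (n j) / 2)"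
    unfolding le_Liminf_iff
  proof (intro allI impI)
    fix a assume "a < ereal (Phi_chi L - pi / 4)"
    then obtain b where b: "a < ereal b" "b < Phi_chi L - pi / 4" by (metis ereal_dense2 less_ereal.simps(1))
    \<comment> \<open>The gap is split evenly between the lower estimate for the Gromov--Hausdorff
      distance and the upper estimate for half of \<open>c_VR\<close>.\<close>
    define e where "e = (Phi_chi L - pi / 4 - b) / 2"
    have e: "e > 0" "b = (Phi_chi L - e) - (pi / 4 + e)" using b(2) by (auto simp: e_def field_simps)
    have "\<forall>\<^sub>F j in sequentially. ereal (Phi_chi L - e) < GH_sphere (m j) (n j)"
      using GH e(1) unfolding le_Liminf_iff by simp
    with c_le[OF e(1)] show "\<forall>\<^sub>F j in sequentially. a < GH_sphere (m j) (n j) - c_VR (m j) (n j) / 2"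
    proof eventually_elim
      case (elim j)
      \<comment> \<open>Half of \<open>c_VR\<close> lies between pi / 4 and pi / 4 + e, so it is a
        real number and the subtraction never meets two infinities.\<close>
      obtain r where r: "c_VR (m j) (n j) / 2 = ereal r" "r \<le> pi / 4 + e"
        using elim(1) c_ge[of j] by (cases "c_VR (m j) (n j) / 2") auto
      have "ereal b \<le> GH_sphere (m j) (n j) - ereal r"
        using elim(2) r(2) e(2) by (cases "GH_sphere (m j) (n j)") auto
      then show ?case using b(1) r(1) by simp
    qed
  qed
  with dI GH c_lim show ?thesis by blast
qed

end
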